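(* Let $\mathbf{A}$ be an additive category. If $\mathbf{A}$ has decidable homotopy equations, then its Adelman category $\mathrm{Adel}(\mathbf{A})$ is a computable abelian category.
   Context: The setting is constructive mathematics (e.g. Bishop's): a category is realized by data types for its objects and morphisms together with algorithms for composition and for constructing identities; additive categories come with algorithms for addition and negation of morphisms, zero object, and direct sums. A category is computable if there is an algorithm deciding whether two given morphisms with the same source and range are equal. A computable abelian category is a computable category equipped with algorithms realizing all existential quantifiers in the definition of an abelian category: addition, subtraction and zero morphisms, zero object, direct sums with their structure morphisms and induced morphisms, kernels and cokernels (object, embedding/projection, and the morphisms induced by their universal properties), lifts along monomorphisms (given a mono $\iota: k \to a$ and $\tau: t \to a$ whose composite with the cokernel projection of $\iota$ is zero, compute $u: t\to k$ with $u\cdot\iota=\tau$), and dually colifts along epimorphisms. Composition is written in diagrammatic order: $\alpha\cdot\beta$ means first $\alpha$, then $\beta$. Decidable homotopy equations: an additive category $\mathbf{A}$ has decidable homotopy equations if it comes equipped with an algorithm which, given morphisms $\alpha: a\to b$, $\beta: d\to b$, $\gamma: a\to c$ in $\mathbf{A}$, decides whether there exist morphisms $\sigma_1: a\to d$ and $\sigma_2: c\to b$ with $\alpha=\sigma_1\cdot\beta+\gamma\cdot\sigma_2$, and outputs such $\sigma_1,\sigma_2$ in the affirmative case. The Adelman category $\mathrm{Adel}(\mathbf{A})$ of an additive category $\mathbf{A}$: its objects are composable pairs $(r_a\xrightarrow{\rho_a}a\xrightarrow{\gamma_a}c_a)$ of morphisms in $\mathbf{A}$ (no condition on $\rho_a\cdot\gamma_a$).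 A morphism from $(r_a\xrightarrow{\rho_a}a\xrightarrow{\gamma_a}c_a)$ to $(r_b\xrightarrow{\rho_b}b\xrightarrow{\gamma_b}c_b)$ is given by a morphism $\alpha:a\to b$ in $\mathbf{A}$ such that there exist $\omega_\alpha: r_a\to r_b$ and $\psi_\alpha: c_a\to c_b$ with $\rho_a\cdot\alpha=\omega_\alpha\cdot\rho_b$ and $\gamma_a\cdot\psi_\alpha=\alpha\cdot\gamma_b$; two such morphisms given by $\alpha,\alpha'$ are defined to be equal if there exist $\sigma_1: a\to r_b$ and $\sigma_2:c_a\to b$ with $\alpha-\alpha'=\sigma_1\cdot\rho_b+\gamma_a\cdot\sigma_2$. Composition, identities and addition are those of $\mathbf{A}$ on the morphisms $\alpha$; direct sums are formed componentwise. *)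

theory Defs
  imports "HOL-Library.Nat_Bijection"
begin

text \<open>
  HOL functions need not be computable, so ``algorithm'' is made precise through recursion theory:
  a \<^emph>\<open>data type\<close> is a type whose elements have natural number codes, and an \<^emph>\<open>algorithm\<close> is a
  partial recursive function on codes. Operations on data are HOL functions; their values outside
  the set of admissible inputs are irrelevant, and the realizing algorithm need not halt there.
\<close>

section \<open>Algorithms\<close>

inductive partial_recursive :: "(nat \<Rightarrow> nat option) \<Rightarrow> bool" where
  zero: "partial_recursive (\<lambda>n. Some 0)"
| succ: "partial_recursive (\<lambda>n. Some (Suc n))"
| left: "partial_recursive (\<lambda>n. Some (fst (prod_decode n)))"
| right: "partial_recursive (\<lambda>n. Some (snd (prod_decode n)))"
| pair: "partial_recursive f \<Longrightarrow> partial_recursive g \<Longrightarrow>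
    partial_recursive (\<lambda>n. Option.bind (f n) (\<lambda>x. Option.bind (g n) (\<lambda>y. Some (prod_encode (x, y)))))"
| compose: "partial_recursive f \<Longrightarrow> partial_recursive g \<Longrightarrow>
    partial_recursive (\<lambda>n. Option.bind (g n) f)"
| recursion: "partial_recursive f \<Longrightarrow> partial_recursive g \<Longrightarrow>
    partial_recursive (\<lambda>n. case prod_decode n of (a, m) \<Rightarrow>
      rec_nat (f a) (\<lambda>y r. Option.bind r (\<lambda>i. g (prod_encode (a, prod_encode (y, i))))) m)"
| minimize: "partial_recursive f \<Longrightarrow>
    partial_recursive (\<lambda>a.
      if \<exists>m. f (prod_encode (a, m)) = Some 0 \<and> (\<forall>k<m. \<exists>y. f (prod_encode (a, k)) = Some (Suc y))
      then Some (LEAST m. f (prod_encode (a, m)) = Some 0) else None)"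

class data =
  fixes encode :: "'a \<Rightarrow> nat"
  assumes inj_encode: "inj encode"

instantiation bool :: data
begin
definition encode_bool :: "bool \<Rightarrow> nat" where "encode b = (if b then 1 else 0)"
instance by standard (auto simp: encode_bool_def inj_def split: if_splits)
end

instantiation prod :: (data, data) data
begin
definition encode_prod :: "'a \<times> 'b \<Rightarrow> nat" where
  "encode p = prod_encode (encode (fst p), encode (snd p))"
instance by standard
  (auto simp: encode_prod_def inj_def prod_encode_eq dest: injD[OF inj_encode])
end

instantiation option :: (data) data
begin
definition encode_option :: "'a option \<Rightarrow> nat" where
  "encode x = (case x of None \<Rightarrow> 0 | Some y \<Rightarrow> Suc (encode y))"
instance by standard
  (auto simp: encode_option_def inj_def split: option.splits dest: injD[OF inj_encode])
end

definition computable_on :: "'a::data set \<Rightarrow> ('a \<Rightarrow> 'b::data) \<Rightarrow> bool" where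
  "computable_on D f \<longleftrightarrow>
    (\<exists>\<phi>. partial_recursive \<phi> \<and> (\<forall>x\<in>D. \<phi> (encode x) = Some (encode (f x))))"

section \<open>Categories with algorithms\<close>

text \<open>
  Morphisms carry their source and range. As usual in constructive mathematics, morphisms come
  with their own equality relation \<open>\<approx>\<close>, only meaningful between morphisms with the same source and
  the same range; it is not assumed to be decidable. Objects (and hence composability) are
  compared as data. Composition is in diagrammatic order.
\<close>

record ('o, 'm) cat_data =
  Obj :: "'o set"
  Mor :: "'m set"
  src :: "'m \<Rightarrow> 'o"
  tgt :: "'m \<Rightarrow> 'o"
  eqv :: "'m \<Rightarrow> 'm \<Rightarrow> bool" (infix "\<approx>\<index>" 50)
  cmp :: "'m \<Rightarrow> 'm \<Rightarrow> 'm" (infixl "\<cdot>\<index>" 70)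
  ide :: "'o \<Rightarrow> 'm"

record ('o, 'm) additive_data = "('o, 'm) cat_data" +
  add :: "'m \<Rightarrow> 'm \<Rightarrow> 'm" (infixl "\<boxplus>\<index>" 65)
  neg :: "'m \<Rightarrow> 'm"
  zero_mor :: "'o \<Rightarrow> 'o \<Rightarrow> 'm"
  zero_obj :: "'o"
  dsum :: "'o \<Rightarrow> 'o \<Rightarrow> 'o"
  inj1 :: "'o \<Rightarrow> 'o \<Rightarrow> 'm"
  inj2 :: "'o \<Rightarrow> 'o \<Rightarrow> 'm"
  proj1 :: "'o \<Rightarrow> 'o \<Rightarrow> 'm"
  proj2 :: "'o \<Rightarrow> 'o \<Rightarrow> 'm"
  into_dsum :: "'m \<Rightarrow> 'm \<Rightarrow> 'm"
  from_dsum :: "'m \<Rightarrow> 'm \<Rightarrow> 'm"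

definition Hom :: "('o, 'm, 'z) cat_data_scheme \<Rightarrow> 'o \<Rightarrow> 'o \<Rightarrow> 'm set" where
  "Hom C a b = {f \<in> Mor C. src C f = a \<and> tgt C f = b}"

locale category =
  fixes C :: "('o::data, 'm::data, 'z) cat_data_scheme" (structure)
  assumes src_closed: "f \<in> Mor C \<Longrightarrow> src C f \<in> Obj C"
    and tgt_closed: "f \<in> Mor C \<Longrightarrow> tgt C f \<in> Obj C"
    and ide_closed: "a \<in> Obj C \<Longrightarrow> ide C a \<in> Hom C a a"
    and cmp_closed: "f \<in> Hom C a b \<Longrightarrow> g \<in> Hom C b c \<Longrightarrow> f \<cdot> g \<in> Hom C a c"
    and eqv_refl: "f \<in> Mor C \<Longrightarrow> f \<approx> f"
    and eqv_sym: "f \<in> Hom C a b \<Longrightarrow> g \<in> Hom C a b \<Longrightarrow> f \<approx> g \<Longrightarrow> g \<approx> f"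
    and eqv_trans: "f \<in> Hom C a b \<Longrightarrow> g \<in> Hom C a b \<Longrightarrow> h \<in> Hom C a b \<Longrightarrow>
      f \<approx> g \<Longrightarrow> g \<approx> h \<Longrightarrow> f \<approx> h"
    and cmp_cong: "f \<in> Hom C a b \<Longrightarrow> f' \<in> Hom C a b \<Longrightarrow> g \<in> Hom C b c \<Longrightarrow> g' \<in> Hom C b c \<Longrightarrow>
      f \<approx> f' \<Longrightarrow> g \<approx> g' \<Longrightarrow> f \<cdot> g \<approx> f' \<cdot> g'"
    and ide_left: "f \<in> Hom C a b \<Longrightarrow> ide C a \<cdot> f \<approx> f"
    and ide_right: "f \<in> Hom C a b \<Longrightarrow> f \<cdot> ide C b \<approx> f"
    and cmp_assoc: "f \<in> Hom C a b \<Longrightarrow> g \<in> Hom C b c \<Longrightarrow> h \<in> Hom C c d \<Longrightarrow>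
      (f \<cdot> g) \<cdot> h \<approx> f \<cdot> (g \<cdot> h)"
    and src_computable: "computable_on (Mor C) (src C)"
    and tgt_computable: "computable_on (Mor C) (tgt C)"
    and ide_computable: "computable_on (Obj C) (ide C)"
    and cmp_computable: "computable_on {(f, g). f \<in> Mor C \<and> g \<in> Mor C \<and> tgt C f = src C g}
      (\<lambda>(f, g). f \<cdot> g)"

locale additive_category = category C
  for C :: "('o::data, 'm::data, 'z) additive_data_scheme" (structure) +
  assumes add_closed: "f \<in> Hom C a b \<Longrightarrow> g \<in> Hom C a b \<Longrightarrow> f \<boxplus> g \<in> Hom C a b"
    and neg_closed: "f \<in> Hom C a b \<Longrightarrow> neg C f \<in> Hom C a b"
    and zero_mor_closed: "a \<in> Obj C \<Longrightarrow> b \<in> Obj C \<Longrightarrow> zero_mor C a b \<in> Hom C a b"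
    and add_cong: "f \<in> Hom C a b \<Longrightarrow> f' \<in> Hom C a b \<Longrightarrow> g \<in> Hom C a b \<Longrightarrow> g' \<in> Hom C a b \<Longrightarrow>
      f \<approx> f' \<Longrightarrow> g \<approx> g' \<Longrightarrow> f \<boxplus> g \<approx> f' \<boxplus> g'"
    and neg_cong: "f \<in> Hom C a b \<Longrightarrow> f' \<in> Hom C a b \<Longrightarrow> f \<approx> f' \<Longrightarrow> neg C f \<approx> neg C f'"
    and add_assoc: "f \<in> Hom C a b \<Longrightarrow> g \<in> Hom C a b \<Longrightarrow> h \<in> Hom C a b \<Longrightarrow>
      (f \<boxplus> g) \<boxplus> h \<approx> f \<boxplus> (g \<boxplus> h)"
    and add_commute: "f \<in> Hom C a b \<Longrightarrow> g \<in> Hom C a b \<Longrightarrow> f \<boxplus> g \<approx> g \<boxplus> f"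
    and add_zero: "f \<in> Hom C a b \<Longrightarrow> f \<boxplus> zero_mor C a b \<approx> f"
    and add_neg: "f \<in> Hom C a b \<Longrightarrow> f \<boxplus> neg C f \<approx> zero_mor C a b"
    and cmp_add_left: "f \<in> Hom C a b \<Longrightarrow> f' \<in> Hom C a b \<Longrightarrow> g \<in> Hom C b c \<Longrightarrow>
      (f \<boxplus> f') \<cdot> g \<approx> f \<cdot> g \<boxplus> f' \<cdot> g"
    and cmp_add_right: "f \<in> Hom C a b \<Longrightarrow> g \<in> Hom C b c \<Longrightarrow> g' \<in> Hom C b c \<Longrightarrow>
      f \<cdot> (g \<boxplus> g') \<approx> f \<cdot> g \<boxplus> f \<cdot> g'"
    and zero_obj_closed: "zero_obj C \<in> Obj C"
    and zero_obj_terminal: "f \<in> Hom C a (zero_obj C) \<Longrightarrow> f \<approx> zero_mor C a (zero_obj C)"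
    and zero_obj_initial: "f \<in> Hom C (zero_obj C) a \<Longrightarrow> f \<approx> zero_mor C (zero_obj C) a"
    and dsum_closed: "a \<in> Obj C \<Longrightarrow> b \<in> Obj C \<Longrightarrow> dsum C a b \<in> Obj C"
    and inj1_closed: "a \<in> Obj C \<Longrightarrow> b \<in> Obj C \<Longrightarrow> inj1 C a b \<in> Hom C a (dsum C a b)"
    and inj2_closed: "a \<in> Obj C \<Longrightarrow> b \<in> Obj C \<Longrightarrow> inj2 C a b \<in> Hom C b (dsum C a b)"
    and proj1_closed: "a \<in> Obj C \<Longrightarrow> b \<in> Obj C \<Longrightarrow> proj1 C a b \<in> Hom C (dsum C a b) a"
    and proj2_closed: "a \<in> Obj C \<Longrightarrow> b \<in> Obj C \<Longrightarrow> proj2 C a b \<in> Hom C (dsum C a b) b"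
    and inj1_proj1: "a \<in> Obj C \<Longrightarrow> b \<in> Obj C \<Longrightarrow> inj1 C a b \<cdot> proj1 C a b \<approx> ide C a"
    and inj2_proj2: "a \<in> Obj C \<Longrightarrow> b \<in> Obj C \<Longrightarrow> inj2 C a b \<cdot> proj2 C a b \<approx> ide C b"
    and inj1_proj2: "a \<in> Obj C \<Longrightarrow> b \<in> Obj C \<Longrightarrow> inj1 C a b \<cdot> proj2 C a b \<approx> zero_mor C a b"
    and inj2_proj1: "a \<in> Obj C \<Longrightarrow> b \<in> Obj C \<Longrightarrow> inj2 C a b \<cdot> proj1 C a b \<approx> zero_mor C b a"
    and proj_inj: "a \<in> Obj C \<Longrightarrow> b \<in> Obj C \<Longrightarrow>
      proj1 C a b \<cdot> inj1 C a b \<boxplus> proj2 C a b \<cdot> inj2 C a b \<approx> ide C (dsum C a b)"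
    and into_dsum_closed: "f \<in> Hom C t a \<Longrightarrow> g \<in> Hom C t b \<Longrightarrow>
      into_dsum C f g \<in> Hom C t (dsum C a b)"
    and into_dsum_proj1: "f \<in> Hom C t a \<Longrightarrow> g \<in> Hom C t b \<Longrightarrow> into_dsum C f g \<cdot> proj1 C a b \<approx> f"
    and into_dsum_proj2: "f \<in> Hom C t a \<Longrightarrow> g \<in> Hom C t b \<Longrightarrow> into_dsum C f g \<cdot> proj2 C a b \<approx> g"
    and from_dsum_closed: "f \<in> Hom C a t \<Longrightarrow> g \<in> Hom C b t \<Longrightarrow>
      from_dsum C f g \<in> Hom C (dsum C a b) t"
    and inj1_from_dsum: "f \<in> Hom C a t \<Longrightarrow> g \<in> Hom C b t \<Longrightarrow> inj1 C a b \<cdot> from_dsum C f g \<approx> f"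
    and inj2_from_dsum: "f \<in> Hom C a t \<Longrightarrow> g \<in> Hom C b t \<Longrightarrow> inj2 C a b \<cdot> from_dsum C f g \<approx> g"
    and add_computable: "computable_on
      {(f, g). f \<in> Mor C \<and> g \<in> Mor C \<and> src C f = src C g \<and> tgt C f = tgt C g} (\<lambda>(f, g). f \<boxplus> g)"
    and neg_computable: "computable_on (Mor C) (neg C)"
    and zero_mor_computable: "computable_on (Obj C \<times> Obj C) (\<lambda>(a, b). zero_mor C a b)"
    and dsum_computable: "computable_on (Obj C \<times> Obj C) (\<lambda>(a, b). dsum C a b)"
    and inj1_computable: "computable_on (Obj C \<times> Obj C) (\<lambda>(a, b). inj1 C a b)"
    and inj2_computable: "computable_on (Obj C \<times> Obj C) (\<lambda>(a, b). inj2 C a b)"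
    and proj1_computable: "computable_on (Obj C \<times> Obj C) (\<lambda>(a, b). proj1 C a b)"
    and proj2_computable: "computable_on (Obj C \<times> Obj C) (\<lambda>(a, b). proj2 C a b)"
    and into_dsum_computable: "computable_on
      {(f, g). f \<in> Mor C \<and> g \<in> Mor C \<and> src C f = src C g} (\<lambda>(f, g). into_dsum C f g)"
    and from_dsum_computable: "computable_on
      {(f, g). f \<in> Mor C \<and> g \<in> Mor C \<and> tgt C f = tgt C g} (\<lambda>(f, g). from_dsum C f g)"

definition decidable_homotopy_equations ::
    "('o::data, 'm::data, 'z) additive_data_scheme \<Rightarrow> bool" where
  "decidable_homotopy_equations A \<longleftrightarrow>
    (\<exists>solve :: 'm \<times> 'm \<times> 'm \<Rightarrow> ('m \<times> 'm) option.
      computable_on {(\<alpha>, \<beta>, \<gamma>). \<alpha> \<in> Mor A \<and> \<beta> \<in> Mor A \<and> \<gamma> \<in> Mor A \<and>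
        tgt A \<beta> = tgt A \<alpha> \<and> src A \<gamma> = src A \<alpha>} solve \<and>
      (\<forall>a b c d. \<forall>\<alpha>\<in>Hom A a b. \<forall>\<beta>\<in>Hom A d b. \<forall>\<gamma>\<in>Hom A a c.
        (case solve (\<alpha>, \<beta>, \<gamma>) of
          Some (\<sigma>1, \<sigma>2) \<Rightarrow> \<sigma>1 \<in> Hom A a d \<and> \<sigma>2 \<in> Hom A c b \<and>
            \<alpha> \<approx>\<^bsub>A\<^esub> \<sigma>1 \<cdot>\<^bsub>A\<^esub> \<beta> \<boxplus>\<^bsub>A\<^esub> \<gamma> \<cdot>\<^bsub>A\<^esub> \<sigma>2
        | None \<Rightarrow> \<not> (\<exists>\<sigma>1\<in>Hom A a d. \<exists>\<sigma>2\<in>Hom A c b.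
            \<alpha> \<approx>\<^bsub>A\<^esub> \<sigma>1 \<cdot>\<^bsub>A\<^esub> \<beta> \<boxplus>\<^bsub>A\<^esub> \<gamma> \<cdot>\<^bsub>A\<^esub> \<sigma>2))))"

section \<open>Computable abelian categories\<close>

definition is_mono :: "('o, 'm, 'z) cat_data_scheme \<Rightarrow> 'm \<Rightarrow> bool" where
  "is_mono C f \<longleftrightarrow> f \<in> Mor C \<and>
    (\<forall>t. \<forall>u\<in>Hom C t (src C f). \<forall>v\<in>Hom C t (src C f). u \<cdot>\<^bsub>C\<^esub> f \<approx>\<^bsub>C\<^esub> v \<cdot>\<^bsub>C\<^esub> f \<longrightarrow> u \<approx>\<^bsub>C\<^esub> v)"

definition is_epi :: "('o, 'm, 'z) cat_data_scheme \<Rightarrow> 'm \<Rightarrow> bool" where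
  "is_epi C f \<longleftrightarrow> f \<in> Mor C \<and>
    (\<forall>t. \<forall>u\<in>Hom C (tgt C f) t. \<forall>v\<in>Hom C (tgt C f) t. f \<cdot>\<^bsub>C\<^esub> u \<approx>\<^bsub>C\<^esub> f \<cdot>\<^bsub>C\<^esub> v \<longrightarrow> u \<approx>\<^bsub>C\<^esub> v)"

definition is_zero :: "('o, 'm, 'z) additive_data_scheme \<Rightarrow> 'm \<Rightarrow> bool" where
  "is_zero C f \<longleftrightarrow> f \<approx>\<^bsub>C\<^esub> zero_mor C (src C f) (tgt C f)"

definition decidable_equality :: "('o, 'm::data, 'z) cat_data_scheme \<Rightarrow> bool" where
  "decidable_equality C \<longleftrightarrow>
    computable_on {(f, g). f \<in> Mor C \<and> g \<in> Mor C \<and> src C f = src C g \<and> tgt C f = tgt C g}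
      (\<lambda>(f, g). f \<approx>\<^bsub>C\<^esub> g)"

text \<open>
  The lifts \<open>u\<close> and colifts \<open>v\<close> take as arguments the given morphism \<open>f\<close> and the test morphism \<open>t\<close>.
\<close>

definition kernel_algorithms ::
    "('o::data, 'm::data, 'z) additive_data_scheme \<Rightarrow>
      ('m \<Rightarrow> 'o) \<Rightarrow> ('m \<Rightarrow> 'm) \<Rightarrow> ('m \<times> 'm \<Rightarrow> 'm) \<Rightarrow> bool" where
  "kernel_algorithms C K \<kappa> u \<longleftrightarrow>
    computable_on (Mor C) K \<and> computable_on (Mor C) \<kappa> \<and>
    computable_on {(f, t). f \<in> Mor C \<and> t \<in> Mor C \<and> tgt C t = src C f \<and> is_zero C (t \<cdot>\<^bsub>C\<^esub> f)} u \<and>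
    (\<forall>f\<in>Mor C.
      K f \<in> Obj C \<and> \<kappa> f \<in> Hom C (K f) (src C f) \<and> is_zero C (\<kappa> f \<cdot>\<^bsub>C\<^esub> f) \<and>
      (\<forall>s. \<forall>t\<in>Hom C s (src C f). is_zero C (t \<cdot>\<^bsub>C\<^esub> f) \<longrightarrow>
        u (f, t) \<in> Hom C s (K f) \<and> u (f, t) \<cdot>\<^bsub>C\<^esub> \<kappa> f \<approx>\<^bsub>C\<^esub> t \<and>
        (\<forall>u'\<in>Hom C s (K f). u' \<cdot>\<^bsub>C\<^esub> \<kappa> f \<approx>\<^bsub>C\<^esub> t \<longrightarrow> u' \<approx>\<^bsub>C\<^esub> u (f, t))))"

definition cokernel_algorithms ::
    "('o::data, 'm::data, 'z) additive_data_scheme \<Rightarrow>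
      ('m \<Rightarrow> 'o) \<Rightarrow> ('m \<Rightarrow> 'm) \<Rightarrow> ('m \<times> 'm \<Rightarrow> 'm) \<Rightarrow> bool" where
  "cokernel_algorithms C Q \<pi> v \<longleftrightarrow>
    computable_on (Mor C) Q \<and> computable_on (Mor C) \<pi> \<and>
    computable_on {(f, t). f \<in> Mor C \<and> t \<in> Mor C \<and> src C t = tgt C f \<and> is_zero C (f \<cdot>\<^bsub>C\<^esub> t)} v \<and>
    (\<forall>f\<in>Mor C.
      Q f \<in> Obj C \<and> \<pi> f \<in> Hom C (tgt C f) (Q f) \<and> is_zero C (f \<cdot>\<^bsub>C\<^esub> \<pi> f) \<and>
      (\<forall>s. \<forall>t\<in>Hom C (tgt C f) s. is_zero C (f \<cdot>\<^bsub>C\<^esub> t) \<longrightarrow>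
        v (f, t) \<in> Hom C (Q f) s \<and> \<pi> f \<cdot>\<^bsub>C\<^esub> v (f, t) \<approx>\<^bsub>C\<^esub> t \<and>
        (\<forall>v'\<in>Hom C (Q f) s. \<pi> f \<cdot>\<^bsub>C\<^esub> v' \<approx>\<^bsub>C\<^esub> t \<longrightarrow> v' \<approx>\<^bsub>C\<^esub> v (f, t))))"

definition mono_lift_algorithm ::
    "('o, 'm::data, 'z) additive_data_scheme \<Rightarrow> ('m \<Rightarrow> 'm) \<Rightarrow> ('m \<times> 'm \<Rightarrow> 'm) \<Rightarrow> bool" where
  "mono_lift_algorithm C \<pi> u \<longleftrightarrow>
    computable_on {(\<iota>, \<tau>). is_mono C \<iota> \<and> \<tau> \<in> Mor C \<and> tgt C \<tau> = tgt C \<iota> \<and> is_zero C (\<tau> \<cdot>\<^bsub>C\<^esub> \<pi> \<iota>)} u \<and>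
    (\<forall>k a t. \<forall>\<iota>\<in>Hom C k a. \<forall>\<tau>\<in>Hom C t a. is_mono C \<iota> \<and> is_zero C (\<tau> \<cdot>\<^bsub>C\<^esub> \<pi> \<iota>) \<longrightarrow>
      u (\<iota>, \<tau>) \<in> Hom C t k \<and> u (\<iota>, \<tau>) \<cdot>\<^bsub>C\<^esub> \<iota> \<approx>\<^bsub>C\<^esub> \<tau>)"

definition epi_colift_algorithm ::
    "('o, 'm::data, 'z) additive_data_scheme \<Rightarrow> ('m \<Rightarrow> 'm) \<Rightarrow> ('m \<times> 'm \<Rightarrow> 'm) \<Rightarrow> bool" where
  "epi_colift_algorithm C \<kappa> v \<longleftrightarrow>
    computable_on {(\<epsilon>, \<tau>). is_epi C \<epsilon> \<and> \<tau> \<in> Mor C \<and> src C \<tau> = src C \<epsilon> \<and> is_zero C (\<kappa> \<epsilon> \<cdot>\<^bsub>C\<^esub> \<tau>)} v \<and>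
    (\<forall>a q t. \<forall>\<epsilon>\<in>Hom C a q. \<forall>\<tau>\<in>Hom C a t. is_epi C \<epsilon> \<and> is_zero C (\<kappa> \<epsilon> \<cdot>\<^bsub>C\<^esub> \<tau>) \<longrightarrow>
      v (\<epsilon>, \<tau>) \<in> Hom C q t \<and> \<epsilon> \<cdot>\<^bsub>C\<^esub> v (\<epsilon>, \<tau>) \<approx>\<^bsub>C\<^esub> \<tau>)"

definition computable_abelian_category ::
    "('o::data, 'm::data, 'z) additive_data_scheme \<Rightarrow> bool" where
  "computable_abelian_category C \<longleftrightarrow>
    additive_category C \<and> decidable_equality C \<and>
    (\<exists>K \<kappa> kernel_lift Q \<pi> cokernel_colift mono_lift epi_colift.
      kernel_algorithms C K \<kappa> kernel_lift \<and>
      cokernel_algorithms C Q \<pi> cokernel_colift \<and>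
      mono_lift_algorithm C \<pi> mono_lift \<and>
      epi_colift_algorithm C \<kappa> epi_colift)"

section \<open>The Adelman category\<close>

text \<open>
  An object is a composable pair \<open>(\<rho>, \<gamma>)\<close>; a morphism is a triple \<open>(X, \<alpha>, Y)\<close> of its source, the
  underlying morphism of \<open>A\<close>, and its range.
\<close>

type_synonym 'm adel_obj = "'m \<times> 'm"
type_synonym 'm adel_mor = "'m adel_obj \<times> 'm \<times> 'm adel_obj"

definition adel_Obj :: "('o, 'm, 'z) cat_data_scheme \<Rightarrow> 'm adel_obj set" where
  "adel_Obj A = {(\<rho>, \<gamma>). \<rho> \<in> Mor A \<and> \<gamma> \<in> Mor A \<and> tgt A \<rho> = src A \<gamma>}"

definition rel :: "('o, 'm, 'z) cat_data_scheme \<Rightarrow> 'm adel_obj \<Rightarrow> 'o" where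
  "rel A X = src A (fst X)"

definition mid :: "('o, 'm, 'z) cat_data_scheme \<Rightarrow> 'm adel_obj \<Rightarrow> 'o" where
  "mid A X = src A (snd X)"

definition corel :: "('o, 'm, 'z) cat_data_scheme \<Rightarrow> 'm adel_obj \<Rightarrow> 'o" where
  "corel A X = tgt A (snd X)"

definition adel_Mor :: "('o, 'm, 'z) cat_data_scheme \<Rightarrow> 'm adel_mor set" where
  "adel_Mor A = {(X, \<alpha>, Y). X \<in> adel_Obj A \<and> Y \<in> adel_Obj A \<and> \<alpha> \<in> Hom A (mid A X) (mid A Y) \<and>
    (\<exists>\<omega>\<in>Hom A (rel A X) (rel A Y). fst X \<cdot>\<^bsub>A\<^esub> \<alpha> \<approx>\<^bsub>A\<^esub> \<omega> \<cdot>\<^bsub>A\<^esub> fst Y) \<and>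
    (\<exists>\<psi>\<in>Hom A (corel A X) (corel A Y). snd X \<cdot>\<^bsub>A\<^esub> \<psi> \<approx>\<^bsub>A\<^esub> \<alpha> \<cdot>\<^bsub>A\<^esub> snd Y)}"

definition adel_eqv :: "('o, 'm, 'z) additive_data_scheme \<Rightarrow> 'm adel_mor \<Rightarrow> 'm adel_mor \<Rightarrow> bool" where
  "adel_eqv A = (\<lambda>(X, \<alpha>, Y) (X', \<alpha>', Y'). X = X' \<and> Y = Y' \<and>
    (\<exists>\<sigma>1\<in>Hom A (mid A X) (rel A Y). \<exists>\<sigma>2\<in>Hom A (corel A X) (mid A Y).
      \<alpha> \<boxplus>\<^bsub>A\<^esub> neg A \<alpha>' \<approx>\<^bsub>A\<^esub> \<sigma>1 \<cdot>\<^bsub>A\<^esub> fst Y \<boxplus>\<^bsub>A\<^esub> snd X \<cdot>\<^bsub>A\<^esub> \<sigma>2))"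

definition dsum_mor :: "('o, 'm, 'z) additive_data_scheme \<Rightarrow> 'm \<Rightarrow> 'm \<Rightarrow> 'm" where
  "dsum_mor A f g = into_dsum A
    (proj1 A (src A f) (src A g) \<cdot>\<^bsub>A\<^esub> f) (proj2 A (src A f) (src A g) \<cdot>\<^bsub>A\<^esub> g)"

definition adel_dsum ::
    "('o, 'm, 'z) additive_data_scheme \<Rightarrow> 'm adel_obj \<Rightarrow> 'm adel_obj \<Rightarrow> 'm adel_obj" where
  "adel_dsum A X Y = (dsum_mor A (fst X) (fst Y), dsum_mor A (snd X) (snd Y))"

definition Adel :: "('o, 'm, 'z) additive_data_scheme \<Rightarrow> ('m adel_obj, 'm adel_mor) additive_data" where
  "Adel A = \<lparr>
    Obj = adel_Obj A,
    Mor = adel_Mor A,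
    src = (\<lambda>(X, \<alpha>, Y). X),
    tgt = (\<lambda>(X, \<alpha>, Y). Y),
    eqv = adel_eqv A,
    cmp = (\<lambda>(X, \<alpha>, Y) (Y', \<beta>, Z). (X, \<alpha> \<cdot>\<^bsub>A\<^esub> \<beta>, Z)),
    ide = (\<lambda>X. (X, ide A (mid A X), X)),
    add = (\<lambda>(X, \<alpha>, Y) (X', \<beta>, Y'). (X, \<alpha> \<boxplus>\<^bsub>A\<^esub> \<beta>, Y)),
    neg = (\<lambda>(X, \<alpha>, Y). (X, neg A \<alpha>, Y)),
    zero_mor = (\<lambda>X Y. (X, zero_mor A (mid A X) (mid A Y), Y)),
    zero_obj = (zero_mor A (zero_obj A) (zero_obj A), zero_mor A (zero_obj A) (zero_obj A)),
    dsum = adel_dsum A,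
    inj1 = (\<lambda>X Y. (X, inj1 A (mid A X) (mid A Y), adel_dsum A X Y)),
    inj2 = (\<lambda>X Y. (Y, inj2 A (mid A X) (mid A Y), adel_dsum A X Y)),
    proj1 = (\<lambda>X Y. (adel_dsum A X Y, proj1 A (mid A X) (mid A Y), X)),
    proj2 = (\<lambda>X Y. (adel_dsum A X Y, proj2 A (mid A X) (mid A Y), Y)),
    into_dsum = (\<lambda>(T, \<alpha>, X) (T', \<beta>, Y). (T, into_dsum A \<alpha> \<beta>, adel_dsum A X Y)),
    from_dsum = (\<lambda>(X, \<alpha>, T) (Y, \<beta>, T'). (adel_dsum A X Y, from_dsum A \<alpha> \<beta>, T)) \<rparr>"

end

theory Submission
  imports Defs
begin

text \<open>
  Think of an object \<open>(\<rho>, \<gamma>)\<close> of the Adelman category as the image of the kernel of \<open>\<gamma>\<close> in the cokernel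
  of \<open>\<rho>\<close>, where kernel and cokernel are formally adjoined. Two morphisms are equal when they differ by a
  \<^emph>\<open>null homotopy\<close> \<open>\<sigma>1 \<cdot> \<rho> + \<gamma> \<cdot> \<sigma>2\<close>, with \<open>\<rho>\<close> from the range and \<open>\<gamma>\<close> from the source, so deciding equality
  is exactly solving a homotopy equation. The additive structure is that of the given category; one only checks that the
  two side conditions on a morphism and the null homotopies are stable under all operations.

  Kernels are read off from the intuition. For \<open>\<alpha>\<close> from \<open>X = (\<rho>X, \<gamma>X)\<close> to \<open>Y = (\<rho>Y, \<gamma>Y)\<close>, an element of the
  kernel is some \<open>x\<close> killed by \<open>\<gamma>X\<close> together with an explicit \<open>y\<close> satisfying \<open>x \<cdot> \<alpha> + y \<cdot> \<rho>Y = 0\<close>, and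
  the kernel object has middle term \<open>mid X \<oplus> rel Y\<close>. Its embedding is the first projection. If \<open>\<tau> \<cdot> \<alpha>\<close>
  is zero, a null homotopy \<open>(\<sigma>1, \<sigma>2)\<close> of it is the missing component: the lift is \<open>(\<tau>, -\<sigma>1)\<close>. Cokernels
  are dual. All of this needs null homotopies as data, and they are what the given algorithm outputs
  (\<open>kernel_lift_correct\<close>, \<open>cokernel_colift_correct\<close>).

  Every monomorphism \<open>\<iota>\<close> from \<open>K\<close> to \<open>A\<close> is a kernel of its cokernel, effectively. Its kernel embedding is
  zero, and a null homotopy of that embedding expresses the identity of \<open>mid K\<close> as
  \<open>r \<cdot> \<rho>K + \<gamma>K \<cdot> x + \<iota> \<cdot> y\<close>, where \<open>\<rho>A \<cdot> y\<close> factors through \<open>\<rho>K\<close>. If \<open>\<tau>\<close> becomes zero in the cokernel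
  of \<open>\<iota>\<close>, a null homotopy gives \<open>\<tau> = s1 \<cdot> \<rho>A + s2 \<cdot> \<iota> + \<gamma>T \<cdot> s3\<close> with \<open>s2 \<cdot> \<gamma>K + \<gamma>T \<cdot> s4 = 0\<close>. Now \<open>s2\<close> is
  compatible with the \<open>\<gamma>\<close>'s and \<open>\<tau> \<cdot> y\<close> with the \<open>\<rho>\<close>'s, and the two differ by a null homotopy
  \<open>p \<cdot> \<rho>K + \<gamma>T \<cdot> q\<close>. Moving only the summand \<open>\<gamma>T \<cdot> q\<close> to the other side yields
  \<open>s2 - \<gamma>T \<cdot> q = \<tau> \<cdot> y + p \<cdot> \<rho>K\<close>, which is compatible with both and hence a morphism: the required lift
  (\<open>mono_lift_correct\<close>). Epimorphisms are dual (\<open>epi_colift_correct\<close>).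

  The equational reasoning takes place in a calculus of values that turns the equality relation of
  the given category into identity and makes its operations total. Computability of each construction follows from
  closure of the computable functions under composition, since the solver of homotopy equations is
  the only algorithm used besides those of its additive structure.
\<close>

section \<open>Computable functions\<close>

lemma partial_recursive_id: "partial_recursive Some"
  using partial_recursive.pair[OF partial_recursive.left partial_recursive.right] by simp

lemma partial_recursive_const: "partial_recursive (\<lambda>n. Some k)"
proof (induction k)
  case (Suc k)
  show ?case using partial_recursive.compose[OF partial_recursive.succ Suc] by simp
qed (rule partial_recursive.zero)

text \<open>
  Primitive recursion that looks at the recursion variable and discards the recursive value is a case
  distinction. It will be used to inspect and to remove the constructor \<open>Some\<close>.
\<close>

lemma partial_recursive_nat_case:
  assumes g: "partial_recursive (\<lambda>n. Some (g n))"
  shows "partial_recursive (\<lambda>n. Some (case n of 0 \<Rightarrow> 0 | Suc m \<Rightarrow> g m))"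
proof -
  let ?step = "\<lambda>n. Some (g (fst (prod_decode (snd (prod_decode n)))))"
  have step: "partial_recursive ?step"
    using partial_recursive.compose[OF g
        partial_recursive.compose[OF partial_recursive.left partial_recursive.right]] by simp
  \<comment> \<open>the parameter of the recursion is a dummy; the recursion starts from the pair \<open>(0, n)\<close> below\<close>
  have rec: "(case prod_decode n of (a, m) \<Rightarrow> rec_nat (Some 0)
      (\<lambda>y r. Option.bind r (\<lambda>i. ?step (prod_encode (a, prod_encode (y, i))))) m) =
    Some (case snd (prod_decode n) of 0 \<Rightarrow> 0 | Suc m \<Rightarrow> g m)" for n
  proof -
    have "rec_nat (Some 0) (\<lambda>y r. Option.bind r (\<lambda>i. ?step (prod_encode (a, prod_encode (y, i))))) m =
      Some (case m of 0 \<Rightarrow> 0 | Suc m \<Rightarrow> g m)" for a m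
      by (induction m) (auto split: nat.split)
    then show ?thesis by (simp split: prod.split)
  qed
  show ?thesis
    using partial_recursive.compose[OF partial_recursive.recursion[OF partial_recursive.zero step]
        partial_recursive.pair[OF partial_recursive.zero partial_recursive_id]]
    unfolding rec by simp
qed

lemma computable_on_cong:
  "computable_on D f \<Longrightarrow> (\<And>x. x \<in> D \<Longrightarrow> f x = g x) \<Longrightarrow> computable_on D g"
  unfolding computable_on_def by metis

lemma computable_on_id: "computable_on D (\<lambda>x. x)"
  unfolding computable_on_def using partial_recursive_id by auto

lemma computable_on_const: "computable_on D (\<lambda>x. c)"
  unfolding computable_on_def using partial_recursive_const by auto

lemma computable_on_compose:
  assumes "computable_on E g" "computable_on D f" "\<And>x. x \<in> D \<Longrightarrow> f x \<in> E"
  shows "computable_on D (\<lambda>x. g (f x))"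
proof -
  obtain \<phi> \<psi> where \<phi>: "partial_recursive \<phi>" "\<forall>x\<in>E. \<phi> (encode x) = Some (encode (g x))"
    and \<psi>: "partial_recursive \<psi>" "\<forall>x\<in>D. \<psi> (encode x) = Some (encode (f x))"
    using assms unfolding computable_on_def by metis
  show ?thesis unfolding computable_on_def
    using partial_recursive.compose[OF \<phi>(1) \<psi>(1)] \<phi>(2) \<psi>(2) assms(3)
    by (intro exI[of _ "\<lambda>n. Option.bind (\<psi> n) \<phi>"]) simp
qed

lemma computable_on_Pair:
  assumes "computable_on D f" "computable_on D g"
  shows "computable_on D (\<lambda>x. (f x, g x))"
proof -
  obtain \<phi> \<psi> where \<phi>: "partial_recursive \<phi>" "\<forall>x\<in>D. \<phi> (encode x) = Some (encode (f x))"
    and \<psi>: "partial_recursive \<psi>" "\<forall>x\<in>D. \<psi> (encode x) = Some (encode (g x))"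
    using assms unfolding computable_on_def by metis
  show ?thesis unfolding computable_on_def
    using partial_recursive.pair[OF \<phi>(1) \<psi>(1)] \<phi>(2) \<psi>(2)
    by (intro exI conjI) (assumption, simp add: encode_prod_def)
qed

lemma computable_on_fst: "computable_on D f \<Longrightarrow> computable_on D (\<lambda>x. fst (f x))"
  by (rule computable_on_compose[of UNIV fst])
     (auto simp: computable_on_def encode_prod_def intro!: exI partial_recursive.left)

lemma computable_on_snd: "computable_on D f \<Longrightarrow> computable_on D (\<lambda>x. snd (f x))"
  by (rule computable_on_compose[of UNIV snd])
     (auto simp: computable_on_def encode_prod_def intro!: exI partial_recursive.right)

lemma computable_on_the:
  assumes "computable_on D f" "\<And>x. x \<in> D \<Longrightarrow> f x \<noteq> None"
  shows "computable_on D (\<lambda>x. the (f x))"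
proof (rule computable_on_compose[of "- {None}" the])
  show "computable_on (- {None}) (the :: 'b option \<Rightarrow> 'b)"
    unfolding computable_on_def using partial_recursive_nat_case[OF partial_recursive_id]
    by (intro exI conjI) (assumption, auto simp: encode_option_def split: option.split)
qed (use assms in auto)

lemma computable_on_is_Some:
  assumes "computable_on D f"
  shows "computable_on D (\<lambda>x. f x \<noteq> None)"
proof (rule computable_on_compose[of UNIV "\<lambda>y. y \<noteq> None"])
  show "computable_on UNIV (\<lambda>y :: 'b option. y \<noteq> None)"
    unfolding computable_on_def using partial_recursive_nat_case[OF partial_recursive_const[of 1]]
    by (intro exI conjI) (assumption, auto simp: encode_option_def encode_bool_def)
qed (use assms in auto)

section \<open>Arithmetic of morphisms up to equality\<close>

context additive_category
begin

lemma Hom_iff: "f \<in> Hom C a b \<longleftrightarrow> f \<in> Mor C \<and> src C f = a \<and> tgt C f = b"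
  by (auto simp: Hom_def)

lemma cmp_Mor [simp]:
  assumes "f \<in> Mor C" "g \<in> Mor C" "tgt C f = src C g"
  shows "f \<cdot> g \<in> Mor C" "src C (f \<cdot> g) = src C f" "tgt C (f \<cdot> g) = tgt C g"
  using cmp_closed[of f "src C f" "tgt C f" g "tgt C g"] assms by (auto simp: Hom_iff)

lemma add_Mor [simp]:
  assumes "f \<in> Mor C" "g \<in> Mor C" "src C f = src C g" "tgt C f = tgt C g"
  shows "f \<boxplus> g \<in> Mor C" "src C (f \<boxplus> g) = src C g" "tgt C (f \<boxplus> g) = tgt C g"
  using add_closed[of f "src C f" "tgt C f" g] assms by (auto simp: Hom_iff)

lemma neg_Mor [simp]:
  assumes "f \<in> Mor C"
  shows "neg C f \<in> Mor C" "src C (neg C f) = src C f" "tgt C (neg C f) = tgt C f"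
  using neg_closed[of f "src C f" "tgt C f"] assms by (auto simp: Hom_iff)

lemma ide_Mor [simp]:
  assumes "a \<in> Obj C"
  shows "ide C a \<in> Mor C" "src C (ide C a) = a" "tgt C (ide C a) = a"
  using ide_closed[of a] assms by (auto simp: Hom_iff)

lemma zero_mor_Mor [simp]:
  assumes "a \<in> Obj C" "b \<in> Obj C"
  shows "zero_mor C a b \<in> Mor C" "src C (zero_mor C a b) = a" "tgt C (zero_mor C a b) = b"
  using zero_mor_closed[of a b] assms by (auto simp: Hom_iff)

lemma dsum_structure_Mor [simp]:
  assumes "a \<in> Obj C" "b \<in> Obj C"
  shows "inj1 C a b \<in> Mor C" "src C (inj1 C a b) = a" "tgt C (inj1 C a b) = dsum C a b"
    and "inj2 C a b \<in> Mor C" "src C (inj2 C a b) = b" "tgt C (inj2 C a b) = dsum C a b"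
    and "proj1 C a b \<in> Mor C" "src C (proj1 C a b) = dsum C a b" "tgt C (proj1 C a b) = a"
    and "proj2 C a b \<in> Mor C" "src C (proj2 C a b) = dsum C a b" "tgt C (proj2 C a b) = b"
  using inj1_closed[of a b] inj2_closed[of a b] proj1_closed[of a b] proj2_closed[of a b] assms
  by (auto simp: Hom_iff)

lemma into_dsum_Mor [simp]:
  assumes "f \<in> Mor C" "g \<in> Mor C" "src C f = src C g"
  shows "into_dsum C f g \<in> Mor C" "src C (into_dsum C f g) = src C g"
    "tgt C (into_dsum C f g) = dsum C (tgt C f) (tgt C g)"
  using into_dsum_closed[of f "src C f" "tgt C f" g "tgt C g"] assms by (auto simp: Hom_iff)

lemma from_dsum_Mor [simp]:
  assumes "f \<in> Mor C" "g \<in> Mor C" "tgt C f = tgt C g"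
  shows "from_dsum C f g \<in> Mor C" "src C (from_dsum C f g) = dsum C (src C f) (src C g)"
    "tgt C (from_dsum C f g) = tgt C g"
  using from_dsum_closed[of f "src C f" "tgt C f" g "src C g"] assms by (auto simp: Hom_iff)

declare src_closed [simp] tgt_closed [simp] zero_obj_closed [simp] dsum_closed [simp]

end

text \<open>
  Terms built from composition and addition obey the ring laws only up to \<open>\<approx>\<close> and only when well-typed,
  which makes them unsuitable for rewriting. A value remembers the endpoints of a morphism and a
  representative of its class; \<open>None\<close> marks an ill-typed expression. With the operations extended
  to all values, associativity, commutativity and distributivity become unconditional equations. The
  endpoints of a composite are those of its factors even if it is ill-typed, which keeps the computation
  of endpoints by rewriting cheap.
\<close>

datatype ('o, 'm) hval = HVal (dm: 'o) (cd: 'o) (rp: "'m option")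

context additive_category
begin

text \<open>
  A partial equivalence relation on all of the type of morphisms, so that symmetry, transitivity and
  congruence need no separate typing assumptions.
\<close>

definition same :: "'m \<Rightarrow> 'm \<Rightarrow> bool" where
  "same f g \<longleftrightarrow> f \<in> Mor C \<and> g \<in> Mor C \<and> src C f = src C g \<and> tgt C f = tgt C g \<and> f \<approx> g"

lemma same_sym: "same f g \<Longrightarrow> same g f"
  unfolding same_def using eqv_sym[of f "src C f" "tgt C f" g] by (auto simp: Hom_iff)

lemma same_trans: "same f g \<Longrightarrow> same g h \<Longrightarrow> same f h"
  unfolding same_def using eqv_trans[of f "src C f" "tgt C f" g h] by (auto simp: Hom_iff)

lemma same_cmp: "same f f' \<Longrightarrow> same g g' \<Longrightarrow> tgt C f = src C g \<Longrightarrow> same (f \<cdot> g) (f' \<cdot> g')"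
  unfolding same_def using cmp_cong[of f "src C f" "tgt C f" f' g "tgt C g" g'] by (auto simp: Hom_iff)

lemma same_add: "same f f' \<Longrightarrow> same g g' \<Longrightarrow> src C f = src C g \<Longrightarrow> tgt C f = tgt C g \<Longrightarrow>
    same (f \<boxplus> g) (f' \<boxplus> g')"
  unfolding same_def using add_cong[of f "src C f" "tgt C f" f' g g'] by (auto simp: Hom_iff)

lemma same_neg: "same f f' \<Longrightarrow> same (neg C f) (neg C f')"
  unfolding same_def using neg_cong[of f "src C f" "tgt C f" f'] by (auto simp: Hom_iff)

text \<open>
  The choice is not effective; representatives occur in proofs only, never in an algorithm.
\<close>

definition rep :: "'m \<Rightarrow> 'm" where "rep f = (SOME g. same f g)"

lemma same_rep: "f \<in> Mor C \<Longrightarrow> same f (rep f)"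
  unfolding rep_def by (rule someI[of _ f]) (simp add: same_def eqv_refl)

lemma rep_eq_iff: "f \<in> Mor C \<Longrightarrow> g \<in> Mor C \<Longrightarrow> rep f = rep g \<longleftrightarrow> same f g"
proof
  assume "f \<in> Mor C" "g \<in> Mor C" "rep f = rep g"
  then show "same f g" using same_rep[of f] same_rep[of g] same_sym same_trans by metis
next
  assume "same f g"
  then have "same f = same g" using same_sym same_trans by blast
  then show "rep f = rep g" by (simp add: rep_def)
qed

lemma rep_Mor [simp]:
  assumes "f \<in> Mor C"
  shows "rep f \<in> Mor C" "src C (rep f) = src C f" "tgt C (rep f) = tgt C f"
  using same_rep[OF assms] by (auto simp: same_def)

definition val :: "'m \<Rightarrow> ('o, 'm) hval" where
  "val f = HVal (src C f) (tgt C f) (if f \<in> Mor C then Some (rep f) else None)"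

definition ok :: "('o, 'm) hval \<Rightarrow> bool" where "ok x \<longleftrightarrow> x \<in> val ` Mor C"

abbreviation mor :: "('o, 'm) hval \<Rightarrow> 'm" where "mor x \<equiv> the (rp x)"

definition vmul :: "('o, 'm) hval \<Rightarrow> ('o, 'm) hval \<Rightarrow> ('o, 'm) hval" (infixl "\<odot>" 70) where
  "x \<odot> y = HVal (dm x) (cd y)
    (if ok x \<and> ok y \<and> cd x = dm y then Some (rep (mor x \<cdot> mor y)) else None)"
text \<open>
  Where endpoints of summands disagree, the endpoint of the sum is \<open>undefined\<close>: taking it from one of
  the summands would destroy commutativity for ill-typed sums.
\<close>

definition vadd :: "('o, 'm) hval \<Rightarrow> ('o, 'm) hval \<Rightarrow> ('o, 'm) hval" (infixl "\<oplus>" 65) where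
  "x \<oplus> y = HVal (if dm x = dm y then dm y else undefined) (if cd x = cd y then cd y else undefined)
    (if ok x \<and> ok y \<and> dm x = dm y \<and> cd x = cd y then Some (rep (mor x \<boxplus> mor y)) else None)"
definition vneg :: "('o, 'm) hval \<Rightarrow> ('o, 'm) hval" ("\<ominus> _" [81] 80) where
  "\<ominus> x = HVal (dm x) (cd x) (if ok x then Some (rep (neg C (mor x))) else None)"

lemma ok_val [simp]: "f \<in> Mor C \<Longrightarrow> ok (val f)" by (simp add: ok_def)
lemma dm_val [simp]: "dm (val f) = src C f" by (simp add: val_def)
lemma cd_val [simp]: "cd (val f) = tgt C f" by (simp add: val_def)
lemma mor_val: "f \<in> Mor C \<Longrightarrow> mor (val f) = rep f" by (simp add: val_def)
lemma ok_cases: assumes "ok x" obtains f where "f \<in> Mor C" "x = val f"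
  using assms by (auto simp: ok_def)

lemma val_eq_iff: "f \<in> Mor C \<Longrightarrow> g \<in> Mor C \<Longrightarrow> val f = val g \<longleftrightarrow> same f g"
  by (auto simp: val_def rep_eq_iff same_def)

lemma eqv_iff [simp]: "f \<in> Mor C \<Longrightarrow> g \<in> Mor C \<Longrightarrow> src C f = src C g \<Longrightarrow> tgt C f = tgt C g \<Longrightarrow>
    f \<approx> g \<longleftrightarrow> val f = val g"
  by (simp add: val_eq_iff same_def)

lemma val_cmp [simp]:
  assumes "f \<in> Mor C" "g \<in> Mor C" "tgt C f = src C g"
  shows "val (f \<cdot> g) = val f \<odot> val g"
  using assms same_cmp[OF same_rep[of f] same_rep[of g]]
  by (simp add: vmul_def mor_val val_def[of "f \<cdot> g"] rep_eq_iff)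

lemma val_add [simp]:
  assumes "f \<in> Mor C" "g \<in> Mor C" "src C f = src C g" "tgt C f = tgt C g"
  shows "val (f \<boxplus> g) = val f \<oplus> val g"
  using assms same_add[OF same_rep[of f] same_rep[of g]]
  by (simp add: vadd_def mor_val val_def[of "f \<boxplus> g"] rep_eq_iff)

lemma val_neg [simp]:
  assumes "f \<in> Mor C"
  shows "val (neg C f) = \<ominus> val f"
  using assms same_neg[OF same_rep[of f]]
  by (simp add: vneg_def mor_val val_def[of "neg C f"] rep_eq_iff)

lemma dm_vmul [simp]: "dm (x \<odot> y) = dm x" and cd_vmul [simp]: "cd (x \<odot> y) = cd y"
  by (simp_all add: vmul_def)
lemma dm_vadd_if: "dm (x \<oplus> y) = (if dm x = dm y then dm y else undefined)"
  and cd_vadd_if: "cd (x \<oplus> y) = (if cd x = cd y then cd y else undefined)"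
  by (simp_all add: vadd_def)
lemma dm_vadd [simp]: "dm x = dm y \<Longrightarrow> dm (x \<oplus> y) = dm y"
  and cd_vadd [simp]: "cd x = cd y \<Longrightarrow> cd (x \<oplus> y) = cd y"
  by (simp_all add: vadd_def)
lemma dm_vneg [simp]: "dm (\<ominus> x) = dm x" and cd_vneg [simp]: "cd (\<ominus> x) = cd x"
  by (simp_all add: vneg_def)

lemma ok_rp: "ok x \<Longrightarrow> rp x \<noteq> None"
  by (auto simp: ok_def val_def)

lemma ok_vmul [simp]: "ok (x \<odot> y) \<longleftrightarrow> ok x \<and> ok y \<and> cd x = dm y"
proof
  show "ok x \<and> ok y \<and> cd x = dm y" if "ok (x \<odot> y)"
    using ok_rp[OF that] by (auto simp: vmul_def split: if_splits)
  show "ok (x \<odot> y)" if *: "ok x \<and> ok y \<and> cd x = dm y"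
  proof -
    from * obtain f g where "f \<in> Mor C" "g \<in> Mor C" "tgt C f = src C g" "x = val f" "y = val g"
      by (auto elim!: ok_cases)
    then show ?thesis by (simp flip: val_cmp)
  qed
qed
lemma ok_vadd [simp]: "ok (x \<oplus> y) \<longleftrightarrow> ok x \<and> ok y \<and> dm x = dm y \<and> cd x = cd y"
proof
  show "ok x \<and> ok y \<and> dm x = dm y \<and> cd x = cd y" if "ok (x \<oplus> y)"
    using ok_rp[OF that] by (auto simp: vadd_def split: if_splits)
  show "ok (x \<oplus> y)" if *: "ok x \<and> ok y \<and> dm x = dm y \<and> cd x = cd y"
  proof -
    from * obtain f g where "f \<in> Mor C" "g \<in> Mor C" "src C f = src C g" "tgt C f = tgt C g"
      "x = val f" "y = val g" by (auto elim!: ok_cases)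
    then show ?thesis by (simp flip: val_add)
  qed
qed
lemma ok_vneg [simp]: "ok (\<ominus> x) \<longleftrightarrow> ok x"
proof
  show "ok x" if "ok (\<ominus> x)" using ok_rp[OF that] by (auto simp: vneg_def split: if_splits)
  show "ok (\<ominus> x)" if "ok x" using that by (auto elim!: ok_cases simp flip: val_neg)
qed

lemma not_ok_vmul: "\<not> ok (x \<odot> y) \<Longrightarrow> x \<odot> y = HVal (dm x) (cd y) None"
  unfolding ok_vmul by (auto simp: vmul_def)
lemma not_ok_vadd: "\<not> ok (x \<oplus> y) \<Longrightarrow> x \<oplus> y = HVal (dm (x \<oplus> y)) (cd (x \<oplus> y)) None"
  unfolding ok_vadd by (auto simp: vadd_def)
lemma not_ok_vneg: "\<not> ok (\<ominus> x) \<Longrightarrow> \<ominus> x = HVal (dm x) (cd x) None"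
  unfolding ok_vneg by (simp add: vneg_def)

lemma val_eqI: "f \<in> Hom C a b \<Longrightarrow> g \<in> Hom C a b \<Longrightarrow> f \<approx> g \<Longrightarrow> val f = val g"
  by (simp add: Hom_iff)

text \<open>
  Ring laws hold for well-typed values by the axioms of an additive category. An expression that is
  ill-typed on one side is ill-typed on the other, and then both sides are determined by their
  endpoints.
\<close>

lemma vmul_assoc: "(x \<odot> y) \<odot> z = x \<odot> (y \<odot> z)"
proof (cases "ok x \<and> ok y \<and> ok z \<and> cd x = dm y \<and> cd y = dm z")
  case True
  then obtain f g h where *: "f \<in> Mor C" "g \<in> Mor C" "h \<in> Mor C" "tgt C f = src C g"
    "tgt C g = src C h" "x = val f" "y = val g" "z = val h" by (auto elim!: ok_cases)
  with cmp_assoc[of f "src C f" "tgt C f" g "tgt C g" h "tgt C h"] show ?thesis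
    by (simp add: Hom_iff)
next
  case False
  then have "\<not> ok ((x \<odot> y) \<odot> z)" "\<not> ok (x \<odot> (y \<odot> z))" by (auto)
  then show ?thesis by (metis not_ok_vmul dm_vmul cd_vmul)
qed

lemma vadd_assoc: "(x \<oplus> y) \<oplus> z = x \<oplus> (y \<oplus> z)"
proof (cases "ok x \<and> ok y \<and> ok z \<and> dm x = dm y \<and> dm y = dm z \<and> cd x = cd y \<and> cd y = cd z")
  case True
  then obtain f g h where *: "f \<in> Mor C" "g \<in> Mor C" "h \<in> Mor C" "src C f = src C g" "src C g = src C h"
    "tgt C f = tgt C g" "tgt C g = tgt C h" "x = val f" "y = val g" "z = val h" by (auto elim!: ok_cases)
  with add_assoc[of f "src C f" "tgt C f" g h] show ?thesis
    by (simp add: Hom_iff)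
next
  case False
  then have "\<not> ok ((x \<oplus> y) \<oplus> z)" "\<not> ok (x \<oplus> (y \<oplus> z))" by (auto)
  moreover have "dm ((x \<oplus> y) \<oplus> z) = dm (x \<oplus> (y \<oplus> z))" "cd ((x \<oplus> y) \<oplus> z) = cd (x \<oplus> (y \<oplus> z))"
    by (auto simp: dm_vadd_if cd_vadd_if)
  ultimately show ?thesis by (metis not_ok_vadd)
qed

lemma vadd_commute: "x \<oplus> y = y \<oplus> x"
proof (cases "ok (x \<oplus> y)")
  case True
  then obtain f g where *: "f \<in> Mor C" "g \<in> Mor C" "src C f = src C g"
    "tgt C f = tgt C g" "x = val f" "y = val g" by (auto elim!: ok_cases)
  with add_commute[of f "src C f" "tgt C f" g] show ?thesis
    by (simp add: Hom_iff)
next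
  case False
  then have "\<not> ok (y \<oplus> x)" by (auto)
  moreover have "dm (x \<oplus> y) = dm (y \<oplus> x)" "cd (x \<oplus> y) = cd (y \<oplus> x)"
    by (auto simp: dm_vadd_if cd_vadd_if)
  ultimately show ?thesis using False by (metis not_ok_vadd)
qed

lemma vadd_left_commute: "x \<oplus> (y \<oplus> z) = y \<oplus> (x \<oplus> z)"
  by (metis vadd_assoc vadd_commute)

lemma vmul_vadd_left: "(x \<oplus> y) \<odot> z = x \<odot> z \<oplus> y \<odot> z"
proof (cases "ok ((x \<oplus> y) \<odot> z)")
  case True
  then obtain f g h where *: "f \<in> Mor C" "g \<in> Mor C" "h \<in> Mor C" "src C f = src C g"
    "tgt C f = tgt C g" "tgt C g = src C h" "x = val f" "y = val g" "z = val h"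
    by (auto elim!: ok_cases)
  with cmp_add_left[of f "src C f" "tgt C f" g h "tgt C h"] show ?thesis
    by (simp add: Hom_iff)
next
  case False
  then have "\<not> ok (x \<odot> z \<oplus> y \<odot> z)" by (auto)
  moreover have "dm ((x \<oplus> y) \<odot> z) = dm (x \<odot> z \<oplus> y \<odot> z)" "cd ((x \<oplus> y) \<odot> z) = cd (x \<odot> z \<oplus> y \<odot> z)"
    by (auto simp: dm_vadd_if cd_vadd_if)
  ultimately show ?thesis using False by (metis not_ok_vmul not_ok_vadd dm_vmul cd_vmul)
qed

lemma vmul_vadd_right: "z \<odot> (x \<oplus> y) = z \<odot> x \<oplus> z \<odot> y"
proof (cases "ok (z \<odot> (x \<oplus> y))")
  case True
  then obtain f g h where *: "f \<in> Mor C" "g \<in> Mor C" "h \<in> Mor C" "src C f = src C g"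
    "tgt C f = tgt C g" "tgt C h = src C g" "x = val f" "y = val g" "z = val h"
    by (auto elim!: ok_cases)
  with cmp_add_right[of h "src C h" "tgt C h" f "tgt C f" g] show ?thesis
    by (simp add: Hom_iff)
next
  case False
  then have "\<not> ok (z \<odot> x \<oplus> z \<odot> y)" by (auto)
  moreover have "dm (z \<odot> (x \<oplus> y)) = dm (z \<odot> x \<oplus> z \<odot> y)" "cd (z \<odot> (x \<oplus> y)) = cd (z \<odot> x \<oplus> z \<odot> y)"
    by (auto simp: dm_vadd_if cd_vadd_if)
  ultimately show ?thesis using False by (metis not_ok_vmul not_ok_vadd dm_vmul cd_vmul)
qed

abbreviation vzero :: "'o \<Rightarrow> 'o \<Rightarrow> ('o, 'm) hval" where "vzero a b \<equiv> val (zero_mor C a b)"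
abbreviation vide :: "'o \<Rightarrow> ('o, 'm) hval" where "vide a \<equiv> val (ide C a)"

lemma ok_Obj [simp]: "ok x \<Longrightarrow> dm x \<in> Obj C" "ok x \<Longrightarrow> cd x \<in> Obj C"
  by (auto elim!: ok_cases)

lemma vide_left [simp]: "ok x \<Longrightarrow> dm x = a \<Longrightarrow> vide a \<odot> x = x"
proof -
  assume "ok x" "dm x = a"
  then obtain f where f: "f \<in> Mor C" "x = val f" "src C f = a" by (auto elim!: ok_cases)
  then have "val (ide C a \<cdot> f) = val f" using ide_left[of f a "tgt C f"] f
    by (intro val_eqI[of _ a "tgt C f"]) (auto simp: Hom_iff)
  then show ?thesis using f by auto
qed

lemma vide_right [simp]: "ok x \<Longrightarrow> cd x = b \<Longrightarrow> x \<odot> vide b = x"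
proof -
  assume "ok x" "cd x = b"
  then obtain f where f: "f \<in> Mor C" "x = val f" "tgt C f = b" by (auto elim!: ok_cases)
  then have "val (f \<cdot> ide C b) = val f" using ide_right[of f "src C f" b] f
    by (intro val_eqI[of _ "src C f" b]) (auto simp: Hom_iff)
  then show ?thesis using f by auto
qed

lemma vadd_vzero [simp]: "ok x \<Longrightarrow> dm x = a \<Longrightarrow> cd x = b \<Longrightarrow> x \<oplus> vzero a b = x"
proof -
  assume "ok x" "dm x = a" "cd x = b"
  then obtain f where f: "f \<in> Mor C" "x = val f" "src C f = a" "tgt C f = b" by (auto elim!: ok_cases)
  then have "val (f \<boxplus> zero_mor C a b) = val f" using add_zero[of f a b] f
    by (intro val_eqI[of _ a b]) (auto simp: Hom_iff)
  then show ?thesis using f by auto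
qed

lemma vzero_vadd [simp]: "ok x \<Longrightarrow> dm x = a \<Longrightarrow> cd x = b \<Longrightarrow> vzero a b \<oplus> x = x"
  by (subst vadd_commute) simp

lemma vadd_vneg [simp]: "ok x \<Longrightarrow> x \<oplus> \<ominus> x = vzero (dm x) (cd x)"
proof -
  assume "ok x"
  then obtain f where f: "f \<in> Mor C" "x = val f" by (auto elim!: ok_cases)
  then have "val (f \<boxplus> neg C f) = val (zero_mor C (src C f) (tgt C f))"
    using add_neg[of f "src C f" "tgt C f"] f
    by (intro val_eqI[of _ "src C f" "tgt C f"]) (auto simp: Hom_iff)
  then show ?thesis using f by auto
qed

text \<open>
  Uniqueness of negatives makes negation commute with the other operations.
\<close>

lemma vneg_unique:
  assumes "ok x" "ok y" "dm x = dm y" "cd x = cd y" "x \<oplus> y = vzero (dm x) (cd x)"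
  shows "y = \<ominus> x"
proof -
  have "y = \<ominus> x \<oplus> x \<oplus> y" using assms by (simp add: vadd_commute[of "\<ominus> x"])
  also have "\<dots> = \<ominus> x" using assms by (simp add: vadd_assoc)
  finally show ?thesis .
qed

lemma vadd_idem_zero: "ok x \<Longrightarrow> x \<oplus> x = x \<Longrightarrow> x = vzero (dm x) (cd x)"
  by (metis vadd_assoc vadd_vneg vadd_vzero)

lemma vzero_vmul [simp]:
  assumes "a \<in> Obj C" "ok x" "dm x = b" shows "vzero a b \<odot> x = vzero a (cd x)"
proof -
  have b: "b \<in> Obj C" using assms by auto
  have "vzero a b \<odot> x \<oplus> vzero a b \<odot> x = vzero a b \<odot> x"
    using assms b by (subst vmul_vadd_left[symmetric]) simp
  from vadd_idem_zero[OF _ this] show ?thesis using assms b by simp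
qed

lemma vmul_vzero [simp]:
  assumes "c \<in> Obj C" "ok x" "cd x = b" shows "x \<odot> vzero b c = vzero (dm x) c"
proof -
  have b: "b \<in> Obj C" using assms by auto
  have "x \<odot> vzero b c \<oplus> x \<odot> vzero b c = x \<odot> vzero b c"
    using assms b by (subst vmul_vadd_right[symmetric]) simp
  from vadd_idem_zero[OF _ this] show ?thesis using assms b by simp
qed

lemma vneg_vmul_left: "(\<ominus> x) \<odot> y = \<ominus> (x \<odot> y)"
proof (cases "ok (x \<odot> y)")
  case True
  then show ?thesis by (intro vneg_unique) (auto simp flip: vmul_vadd_left)
next
  case False
  then have "\<not> ok ((\<ominus> x) \<odot> y)" "\<not> ok (\<ominus> (x \<odot> y))" by auto
  then show ?thesis by (metis not_ok_vmul not_ok_vneg dm_vmul cd_vmul dm_vneg cd_vneg)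
qed

lemma vneg_vmul_right: "x \<odot> (\<ominus> y) = \<ominus> (x \<odot> y)"
proof (cases "ok (x \<odot> y)")
  case True
  then show ?thesis by (intro vneg_unique) (auto simp flip: vmul_vadd_right)
next
  case False
  then have "\<not> ok (x \<odot> (\<ominus> y))" "\<not> ok (\<ominus> (x \<odot> y))" by auto
  then show ?thesis by (metis not_ok_vmul not_ok_vneg dm_vmul cd_vmul dm_vneg cd_vneg)
qed

lemma vneg_vzero [simp]: "a \<in> Obj C \<Longrightarrow> b \<in> Obj C \<Longrightarrow> \<ominus> vzero a b = vzero a b"
  by (rule vneg_unique[symmetric]) auto

lemma vadd_cancel [simp]:
  assumes "ok x" "ok y" "dm x = dm y" "cd x = cd y"
  shows "x \<oplus> (\<ominus> x \<oplus> y) = y" "\<ominus> x \<oplus> (x \<oplus> y) = y" "\<ominus> x \<oplus> x = vzero (dm x) (cd x)"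
  using assms by (simp_all add: vadd_commute[of "\<ominus> x" x] flip: vadd_assoc)

lemma vneg_vadd: "\<ominus> (x \<oplus> y) = \<ominus> x \<oplus> \<ominus> y"
proof (cases "ok (x \<oplus> y)")
  case True
  have "(x \<oplus> y) \<oplus> (\<ominus> x \<oplus> \<ominus> y) = (x \<oplus> \<ominus> x) \<oplus> (y \<oplus> \<ominus> y)"
    by (simp only: vadd_assoc vadd_left_commute)
  with True show ?thesis by (intro vneg_unique[symmetric]) auto
next
  case False
  then have "\<not> ok (\<ominus> (x \<oplus> y))" "\<not> ok (\<ominus> x \<oplus> \<ominus> y)" by auto
  moreover have "dm (\<ominus> (x \<oplus> y)) = dm (\<ominus> x \<oplus> \<ominus> y)" "cd (\<ominus> (x \<oplus> y)) = cd (\<ominus> x \<oplus> \<ominus> y)"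
    by (auto simp: dm_vadd_if cd_vadd_if)
  ultimately show ?thesis by (metis not_ok_vadd not_ok_vneg dm_vneg cd_vneg)
qed

lemma vdsum_simps [simp]:
  assumes "a \<in> Obj C" "b \<in> Obj C"
  shows "val (inj1 C a b) \<odot> val (proj1 C a b) = vide a"
    and "val (inj2 C a b) \<odot> val (proj2 C a b) = vide b"
    and "val (inj1 C a b) \<odot> val (proj2 C a b) = vzero a b"
    and "val (inj2 C a b) \<odot> val (proj1 C a b) = vzero b a"
    and "val (proj1 C a b) \<odot> val (inj1 C a b) \<oplus> val (proj2 C a b) \<odot> val (inj2 C a b) = vide (dsum C a b)"
  using assms inj1_proj1[of a b] inj2_proj2[of a b] inj1_proj2[of a b] inj2_proj1[of a b] proj_inj[of a b]
  by simp_all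

text \<open>
  Rewriting right-associates composites, which hides the pairs of factors that the preceding relations match.
\<close>

lemma vdsum_simps' [simp]:
  assumes "a \<in> Obj C" "b \<in> Obj C"
  shows "ok x \<Longrightarrow> dm x = a \<Longrightarrow> val (inj1 C a b) \<odot> (val (proj1 C a b) \<odot> x) = x"
    and "ok x \<Longrightarrow> dm x = b \<Longrightarrow> val (inj2 C a b) \<odot> (val (proj2 C a b) \<odot> x) = x"
    and "ok x \<Longrightarrow> dm x = b \<Longrightarrow> val (inj1 C a b) \<odot> (val (proj2 C a b) \<odot> x) = vzero a (cd x)"
    and "ok x \<Longrightarrow> dm x = a \<Longrightarrow> val (inj2 C a b) \<odot> (val (proj1 C a b) \<odot> x) = vzero b (cd x)"
  using assms by (simp_all flip: vmul_assoc)

lemma split_source: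
  assumes "ok x" "dm x = dsum C a b" "a \<in> Obj C" "b \<in> Obj C"
  shows "val (proj1 C a b) \<odot> (val (inj1 C a b) \<odot> x) \<oplus> val (proj2 C a b) \<odot> (val (inj2 C a b) \<odot> x) = x"
  using assms by (simp flip: vmul_assoc vmul_vadd_left)

lemma split_target:
  assumes "ok x" "cd x = dsum C a b" "a \<in> Obj C" "b \<in> Obj C"
  shows "x \<odot> (val (proj1 C a b) \<odot> val (inj1 C a b)) \<oplus> x \<odot> (val (proj2 C a b) \<odot> val (inj2 C a b)) = x"
  using assms by (simp flip: vmul_vadd_right)

text \<open>
  Equality of matrices can be checked row by row, and dually column by column.
\<close>

lemma eq_from_dsum:
  assumes "ok x" "ok y" "dm x = dsum C a b" "dm y = dsum C a b" "a \<in> Obj C" "b \<in> Obj C"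
    "val (inj1 C a b) \<odot> x = val (inj1 C a b) \<odot> y" "val (inj2 C a b) \<odot> x = val (inj2 C a b) \<odot> y"
  shows "x = y"
  using split_source[of x a b] split_source[of y a b] assms by metis

lemma eq_into_dsum:
  assumes "ok x" "ok y" "cd x = dsum C a b" "cd y = dsum C a b" "a \<in> Obj C" "b \<in> Obj C"
    "x \<odot> val (proj1 C a b) = y \<odot> val (proj1 C a b)" "x \<odot> val (proj2 C a b) = y \<odot> val (proj2 C a b)"
  shows "x = y"
  using split_target[of x a b] split_target[of y a b] assms by (metis vmul_assoc)

text \<open>
  Rewriting to sums of right-associated products. Together with the relations for direct sums this
  multiplies block matrices.
\<close>

lemmas vring = vmul_assoc vadd_assoc vadd_commute vadd_left_commute vmul_vadd_left vmul_vadd_right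
  vneg_vmul_left vneg_vmul_right vneg_vadd

text \<open>
  The universal property determines the induced morphisms, so they can be expanded into matrices.
\<close>

lemma val_into_dsum [simp]:
  assumes "f \<in> Mor C" "g \<in> Mor C" "src C f = src C g"
  shows "val (into_dsum C f g) =
    val f \<odot> val (inj1 C (tgt C f) (tgt C g)) \<oplus> val g \<odot> val (inj2 C (tgt C f) (tgt C g))"
  supply facts = assms into_dsum_proj1[of f "src C f" "tgt C f" g "tgt C g"]
    into_dsum_proj2[of f "src C f" "tgt C f" g "tgt C g"]
  by (rule eq_into_dsum[of _ _ "tgt C f" "tgt C g"]) (insert facts, simp_all add: Hom_iff vring)

lemma val_from_dsum [simp]:
  assumes "f \<in> Mor C" "g \<in> Mor C" "tgt C f = tgt C g"
  shows "val (from_dsum C f g) =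
    val (proj1 C (src C f) (src C g)) \<odot> val f \<oplus> val (proj2 C (src C f) (src C g)) \<odot> val g"
  supply facts = assms inj1_from_dsum[of f "src C f" "tgt C f" g "src C g"]
    inj2_from_dsum[of f "src C f" "tgt C f" g "src C g"]
  by (rule eq_from_dsum[of _ _ "src C f" "src C g"]) (insert facts, simp_all add: Hom_iff vring)

lemma dsum_mor_Mor [simp]:
  assumes "f \<in> Mor C" "g \<in> Mor C"
  shows "dsum_mor C f g \<in> Mor C" "src C (dsum_mor C f g) = dsum C (src C f) (src C g)"
    "tgt C (dsum_mor C f g) = dsum C (tgt C f) (tgt C g)"
  using assms by (simp_all add: dsum_mor_def)

lemma val_dsum_mor [simp]:
  assumes "f \<in> Mor C" "g \<in> Mor C"
  shows "val (dsum_mor C f g) =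
    val (proj1 C (src C f) (src C g)) \<odot> (val f \<odot> val (inj1 C (tgt C f) (tgt C g))) \<oplus>
    val (proj2 C (src C f) (src C g)) \<odot> (val g \<odot> val (inj2 C (tgt C f) (tgt C g)))"
  using assms by (simp add: dsum_mor_def vmul_assoc)

lemma val_terminal: "f \<in> Mor C \<Longrightarrow> tgt C f = zero_obj C \<Longrightarrow> val f = vzero (src C f) (zero_obj C)"
  using zero_obj_terminal[of f "src C f"] by (simp add: Hom_iff)
lemma val_initial: "f \<in> Mor C \<Longrightarrow> src C f = zero_obj C \<Longrightarrow> val f = vzero (zero_obj C) (tgt C f)"
  using zero_obj_initial[of f "tgt C f"] by (simp add: Hom_iff)

end

section \<open>Computability of composite constructions\<close>

context additive_category
begin

lemma computable_on_cmp:
  assumes "computable_on D f" "computable_on D g"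
    "\<And>x. x \<in> D \<Longrightarrow> f x \<in> Mor C \<and> g x \<in> Mor C \<and> tgt C (f x) = src C (g x)"
  shows "computable_on D (\<lambda>x. f x \<cdot> g x)"
  using computable_on_compose[OF cmp_computable computable_on_Pair[OF assms(1,2)]] assms(3) by simp

lemma computable_on_add:
  assumes "computable_on D f" "computable_on D g"
    "\<And>x. x \<in> D \<Longrightarrow> f x \<in> Mor C \<and> g x \<in> Mor C \<and> src C (f x) = src C (g x) \<and> tgt C (f x) = tgt C (g x)"
  shows "computable_on D (\<lambda>x. f x \<boxplus> g x)"
  using computable_on_compose[OF add_computable computable_on_Pair[OF assms(1,2)]] assms(3) by simp

lemma computable_on_neg:
  assumes "computable_on D f" "\<And>x. x \<in> D \<Longrightarrow> f x \<in> Mor C"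
  shows "computable_on D (\<lambda>x. neg C (f x))"
  using computable_on_compose[OF neg_computable] assms by blast

lemma computable_on_src_tgt:
  assumes "computable_on D f" "\<And>x. x \<in> D \<Longrightarrow> f x \<in> Mor C"
  shows "computable_on D (\<lambda>x. src C (f x))" "computable_on D (\<lambda>x. tgt C (f x))"
  using computable_on_compose[OF src_computable] computable_on_compose[OF tgt_computable] assms
  by blast+

lemma computable_on_ide:
  assumes "computable_on D f" "\<And>x. x \<in> D \<Longrightarrow> f x \<in> Obj C"
  shows "computable_on D (\<lambda>x. ide C (f x))"
  using computable_on_compose[OF ide_computable] assms by blast

lemma computable_on_dsum_structure:
  assumes "computable_on D f" "computable_on D g" "\<And>x. x \<in> D \<Longrightarrow> f x \<in> Obj C \<and> g x \<in> Obj C"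
  shows "computable_on D (\<lambda>x. zero_mor C (f x) (g x))" "computable_on D (\<lambda>x. inj1 C (f x) (g x))"
    "computable_on D (\<lambda>x. inj2 C (f x) (g x))" "computable_on D (\<lambda>x. proj1 C (f x) (g x))"
    "computable_on D (\<lambda>x. proj2 C (f x) (g x))"
  using computable_on_compose[OF zero_mor_computable computable_on_Pair[OF assms(1,2)]]
    computable_on_compose[OF inj1_computable computable_on_Pair[OF assms(1,2)]]
    computable_on_compose[OF inj2_computable computable_on_Pair[OF assms(1,2)]]
    computable_on_compose[OF proj1_computable computable_on_Pair[OF assms(1,2)]]
    computable_on_compose[OF proj2_computable computable_on_Pair[OF assms(1,2)]] assms(3)
  by simp_all

lemma computable_on_into_dsum:
  assumes "computable_on D f" "computable_on D g"
    "\<And>x. x \<in> D \<Longrightarrow> f x \<in> Mor C \<and> g x \<in> Mor C \<and> src C (f x) = src C (g x)"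
  shows "computable_on D (\<lambda>x. into_dsum C (f x) (g x))"
  using computable_on_compose[OF into_dsum_computable computable_on_Pair[OF assms(1,2)]] assms(3)
  by simp

lemma computable_on_from_dsum:
  assumes "computable_on D f" "computable_on D g"
    "\<And>x. x \<in> D \<Longrightarrow> f x \<in> Mor C \<and> g x \<in> Mor C \<and> tgt C (f x) = tgt C (g x)"
  shows "computable_on D (\<lambda>x. from_dsum C (f x) (g x))"
  using computable_on_compose[OF from_dsum_computable computable_on_Pair[OF assms(1,2)]] assms(3)
  by simp

lemma computable_on_dsum_mor:
  assumes "computable_on D f" "computable_on D g"
    "\<And>x. x \<in> D \<Longrightarrow> f x \<in> Mor C \<and> g x \<in> Mor C"
  shows "computable_on D (\<lambda>x. dsum_mor C (f x) (g x))"
  unfolding dsum_mor_def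
  by (intro computable_on_into_dsum computable_on_cmp computable_on_dsum_structure
      computable_on_src_tgt assms(1,2)) (use assms(3) in auto)

lemmas computable_intros = computable_on_cmp computable_on_add computable_on_neg computable_on_src_tgt
  computable_on_ide computable_on_dsum_structure computable_on_into_dsum computable_on_from_dsum
  computable_on_dsum_mor computable_on_Pair computable_on_fst computable_on_snd computable_on_const
  computable_on_id

end

section \<open>Morphisms and null homotopies in the Adelman category\<close>

context additive_category
begin

text \<open>
  Solutions of equations are quantified over values rather than over morphisms of \<open>C\<close>, so that they can
  be given by arbitrary expressions.
\<close>

definition vHom :: "'o \<Rightarrow> 'o \<Rightarrow> ('o, 'm) hval set" where
  "vHom a b = {x. ok x \<and> dm x = a \<and> cd x = b}"

lemma vHom_iff [simp]: "x \<in> vHom a b \<longleftrightarrow> ok x \<and> dm x = a \<and> cd x = b"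
  by (simp add: vHom_def)

lemma vHom_eq: "vHom a b = val ` Hom C a b"
  by (auto simp: Hom_iff elim!: ok_cases)

lemma vmul_extend: "x \<odot> y = z \<odot> w \<Longrightarrow> x \<odot> (y \<odot> v) = z \<odot> (w \<odot> v)"
  by (metis vmul_assoc)

lemma adel_Obj_simps [simp]:
  assumes "X \<in> adel_Obj C"
  shows "fst X \<in> Mor C" "snd X \<in> Mor C" "src C (fst X) = rel C X" "tgt C (fst X) = mid C X"
    "src C (snd X) = mid C X" "tgt C (snd X) = corel C X"
    "rel C X \<in> Obj C" "mid C X \<in> Obj C" "corel C X \<in> Obj C"
  using assms by (auto simp: adel_Obj_def rel_def mid_def corel_def)

lemma adel_pair:
  "rel C (r, g) = src C r" "mid C (r, g) = src C g" "corel C (r, g) = tgt C g"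
  by (simp_all add: rel_def mid_def corel_def)

lemma adel_ObjI: "r \<in> Mor C \<Longrightarrow> g \<in> Mor C \<Longrightarrow> tgt C r = src C g \<Longrightarrow> (r, g) \<in> adel_Obj C"
  by (simp add: adel_Obj_def)

lemma adel_MorI:
  assumes "X \<in> adel_Obj C" "Y \<in> adel_Obj C" "\<alpha> \<in> Mor C" "src C \<alpha> = mid C X" "tgt C \<alpha> = mid C Y"
    and "\<omega> \<in> vHom (rel C X) (rel C Y)" "val (fst X) \<odot> val \<alpha> = \<omega> \<odot> val (fst Y)"
    and "\<psi> \<in> vHom (corel C X) (corel C Y)" "val \<alpha> \<odot> val (snd Y) = val (snd X) \<odot> \<psi>"
  shows "(X, \<alpha>, Y) \<in> adel_Mor C"
proof -
  obtain \<omega>' \<psi>' where "\<omega>' \<in> Hom C (rel C X) (rel C Y)" "\<omega> = val \<omega>'"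
    and "\<psi>' \<in> Hom C (corel C X) (corel C Y)" "\<psi> = val \<psi>'"
    using assms(6,8) unfolding vHom_eq by blast
  then have "fst X \<cdot> \<alpha> \<approx> \<omega>' \<cdot> fst Y" "snd X \<cdot> \<psi>' \<approx> \<alpha> \<cdot> snd Y"
    using assms by (simp_all add: Hom_iff)
  with \<open>\<omega>' \<in> _\<close> \<open>\<psi>' \<in> _\<close> show ?thesis using assms(1-5) unfolding adel_Mor_def
    by (auto simp: Hom_iff)
qed

text \<open>
  The side conditions are also provided in the form in which they rewrite a longer right-associated
  composite.
\<close>

lemma adel_MorE:
  assumes "(X, \<alpha>, Y) \<in> adel_Mor C"
  obtains \<omega> \<psi> where "X \<in> adel_Obj C" "Y \<in> adel_Obj C" "\<alpha> \<in> Mor C" "src C \<alpha> = mid C X"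
    "tgt C \<alpha> = mid C Y"
    "ok \<omega>" "dm \<omega> = rel C X" "cd \<omega> = rel C Y" "val (fst X) \<odot> val \<alpha> = \<omega> \<odot> val (fst Y)"
    "\<And>z. val (fst X) \<odot> (val \<alpha> \<odot> z) = \<omega> \<odot> (val (fst Y) \<odot> z)"
    "ok \<psi>" "dm \<psi> = corel C X" "cd \<psi> = corel C Y" "val \<alpha> \<odot> val (snd Y) = val (snd X) \<odot> \<psi>"
    "\<And>z. val \<alpha> \<odot> (val (snd Y) \<odot> z) = val (snd X) \<odot> (\<psi> \<odot> z)"
proof -
  from assms have *: "X \<in> adel_Obj C" "Y \<in> adel_Obj C" "\<alpha> \<in> Mor C" "src C \<alpha> = mid C X"
    "tgt C \<alpha> = mid C Y" by (auto simp: adel_Mor_def Hom_iff)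
  from assms obtain \<omega> \<psi> where w: "\<omega> \<in> Mor C" "src C \<omega> = rel C X" "tgt C \<omega> = rel C Y"
    "fst X \<cdot> \<alpha> \<approx> \<omega> \<cdot> fst Y"
    and p: "\<psi> \<in> Mor C" "src C \<psi> = corel C X" "tgt C \<psi> = corel C Y" "snd X \<cdot> \<psi> \<approx> \<alpha> \<cdot> snd Y"
    by (auto simp: adel_Mor_def Hom_iff)
  then have "val (fst X) \<odot> val \<alpha> = val \<omega> \<odot> val (fst Y)"
    "val \<alpha> \<odot> val (snd Y) = val (snd X) \<odot> val \<psi>" using * by simp_all
  from that[OF * _ _ _ this(1) vmul_extend[OF this(1)] _ _ _ this(2) vmul_extend[OF this(2)]] w p
  show thesis by simp
qed

text \<open>
  Equality in the Adelman category without subtraction, so that most proofs are plain expansions and need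
  no cancellation.
\<close>

definition homotopic :: "'m adel_obj \<Rightarrow> 'm adel_obj \<Rightarrow> ('o, 'm) hval \<Rightarrow> ('o, 'm) hval \<Rightarrow> bool" where
  "homotopic X Y x y \<longleftrightarrow> (\<exists>s1 \<in> vHom (mid C X) (rel C Y). \<exists>s2 \<in> vHom (corel C X) (mid C Y).
    x = y \<oplus> (s1 \<odot> val (fst Y) \<oplus> val (snd X) \<odot> s2))"

lemma homotopicI:
  "ok s1 \<Longrightarrow> dm s1 = mid C X \<Longrightarrow> cd s1 = rel C Y \<Longrightarrow> ok s2 \<Longrightarrow> dm s2 = corel C X \<Longrightarrow> cd s2 = mid C Y \<Longrightarrow>
    x = y \<oplus> (s1 \<odot> val (fst Y) \<oplus> val (snd X) \<odot> s2) \<Longrightarrow> homotopic X Y x y"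
  unfolding homotopic_def vHom_def by blast

lemma homotopicE:
  assumes "homotopic X Y x y"
  obtains s1 s2 where "ok s1" "dm s1 = mid C X" "cd s1 = rel C Y" "ok s2" "dm s2 = corel C X"
    "cd s2 = mid C Y" "x = y \<oplus> (s1 \<odot> val (fst Y) \<oplus> val (snd X) \<odot> s2)"
  using assms unfolding homotopic_def by auto

lemma vminus_eq_iff:
  assumes "ok x" "ok y" "ok z" "dm x = dm y" "cd x = cd y" "dm y = dm z" "cd y = cd z"
  shows "x \<oplus> \<ominus> y = z \<longleftrightarrow> x = y \<oplus> z"
proof
  assume "x \<oplus> \<ominus> y = z"
  then have "y \<oplus> z = y \<oplus> (\<ominus> y \<oplus> x)" by (simp add: vadd_commute)
  with assms show "x = y \<oplus> z" by simp
next
  assume "x = y \<oplus> z"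
  with assms show "x \<oplus> \<ominus> y = z" by (simp add: vadd_commute)
qed

lemma adel_eqv_iff:
  assumes "(X, \<alpha>, Y) \<in> adel_Mor C" "(X', \<beta>, Y') \<in> adel_Mor C"
  shows "adel_eqv C (X, \<alpha>, Y) (X', \<beta>, Y') \<longleftrightarrow> X = X' \<and> Y = Y' \<and> homotopic X Y (val \<alpha>) (val \<beta>)"
proof (cases "X = X' \<and> Y = Y'")
  case True
  have *: "\<alpha> \<in> Mor C" "\<beta> \<in> Mor C" "src C \<alpha> = mid C X" "tgt C \<alpha> = mid C Y" "src C \<beta> = mid C X"
    "tgt C \<beta> = mid C Y" "X \<in> adel_Obj C" "Y \<in> adel_Obj C"
    using assms True by (auto elim!: adel_MorE)
  have "\<alpha> \<boxplus> neg C \<beta> \<approx> \<sigma>1 \<cdot> fst Y \<boxplus> snd X \<cdot> \<sigma>2 \<longleftrightarrow>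
      val \<alpha> = val \<beta> \<oplus> (val \<sigma>1 \<odot> val (fst Y) \<oplus> val (snd X) \<odot> val \<sigma>2)"
    if "\<sigma>1 \<in> Hom C (mid C X) (rel C Y)" "\<sigma>2 \<in> Hom C (corel C X) (mid C Y)" for \<sigma>1 \<sigma>2
    using that * by (simp add: Hom_iff vminus_eq_iff)
  with True show ?thesis unfolding adel_eqv_def homotopic_def vHom_eq by (auto 0 3)
next
  case False
  then show ?thesis by (auto simp: adel_eqv_def)
qed

lemma homotopic_refl:
  assumes "X \<in> adel_Obj C" "Y \<in> adel_Obj C" "ok x" "dm x = mid C X" "cd x = mid C Y"
  shows "homotopic X Y x x"
  by (rule homotopicI[of "vzero (mid C X) (rel C Y)" _ _ "vzero (corel C X) (mid C Y)"])
     (use assms in simp_all)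

lemma homotopic_sym:
  assumes "X \<in> adel_Obj C" "Y \<in> adel_Obj C" "ok y" "dm y = mid C X" "cd y = mid C Y" "homotopic X Y x y"
  shows "homotopic X Y y x"
  using assms(6)
proof (rule homotopicE)
  fix s1 s2 assume *: "ok s1" "dm s1 = mid C X" "cd s1 = rel C Y" "ok s2" "dm s2 = corel C X"
    "cd s2 = mid C Y" "x = y \<oplus> (s1 \<odot> val (fst Y) \<oplus> val (snd X) \<odot> s2)"
  show ?thesis by (rule homotopicI[of "\<ominus> s1" _ _ "\<ominus> s2"]) (use assms * in \<open>simp_all add: vring\<close>)
qed

lemma homotopic_trans:
  assumes "X \<in> adel_Obj C" "Y \<in> adel_Obj C" "homotopic X Y x y" "homotopic X Y y z"
  shows "homotopic X Y x z"
  using assms(3)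
proof (rule homotopicE)
  fix s1 s2 assume *: "ok s1" "dm s1 = mid C X" "cd s1 = rel C Y" "ok s2" "dm s2 = corel C X"
    "cd s2 = mid C Y" "x = y \<oplus> (s1 \<odot> val (fst Y) \<oplus> val (snd X) \<odot> s2)"
  from assms(4) show ?thesis
  proof (rule homotopicE)
    fix t1 t2 assume **: "ok t1" "dm t1 = mid C X" "cd t1 = rel C Y" "ok t2" "dm t2 = corel C X"
      "cd t2 = mid C Y" "y = z \<oplus> (t1 \<odot> val (fst Y) \<oplus> val (snd X) \<odot> t2)"
    show ?thesis by (rule homotopicI[of "s1 \<oplus> t1" _ _ "s2 \<oplus> t2"]) (use assms * ** in \<open>simp_all add: vring\<close>)
  qed
qed

lemma homotopic_add:
  assumes "X \<in> adel_Obj C" "Y \<in> adel_Obj C" "homotopic X Y x y" "homotopic X Y x' y'"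
  shows "homotopic X Y (x \<oplus> x') (y \<oplus> y')"
  using assms(3)
proof (rule homotopicE)
  fix s1 s2 assume *: "ok s1" "dm s1 = mid C X" "cd s1 = rel C Y" "ok s2" "dm s2 = corel C X"
    "cd s2 = mid C Y" "x = y \<oplus> (s1 \<odot> val (fst Y) \<oplus> val (snd X) \<odot> s2)"
  from assms(4) show ?thesis
  proof (rule homotopicE)
    fix t1 t2 assume **: "ok t1" "dm t1 = mid C X" "cd t1 = rel C Y" "ok t2" "dm t2 = corel C X"
      "cd t2 = mid C Y" "x' = y' \<oplus> (t1 \<odot> val (fst Y) \<oplus> val (snd X) \<odot> t2)"
    show ?thesis by (rule homotopicI[of "s1 \<oplus> t1" _ _ "s2 \<oplus> t2"]) (use assms * ** in \<open>simp_all add: vring\<close>)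
  qed
qed

lemma homotopic_neg:
  assumes "X \<in> adel_Obj C" "Y \<in> adel_Obj C" "homotopic X Y x y"
  shows "homotopic X Y (\<ominus> x) (\<ominus> y)"
  using assms(3)
proof (rule homotopicE)
  fix s1 s2 assume *: "ok s1" "dm s1 = mid C X" "cd s1 = rel C Y" "ok s2" "dm s2 = corel C X"
    "cd s2 = mid C Y" "x = y \<oplus> (s1 \<odot> val (fst Y) \<oplus> val (snd X) \<odot> s2)"
  show ?thesis by (rule homotopicI[of "\<ominus> s1" _ _ "\<ominus> s2"]) (use assms * in \<open>simp_all add: vring\<close>)
qed

text \<open>
  A null homotopy \<open>s1 \<cdot> \<rho>Y + \<gamma>X \<cdot> s2\<close> remains one after composition with \<open>\<beta>\<close> because \<open>\<rho>Y \<cdot> \<beta> = \<omega> \<cdot> \<rho>Z\<close>;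
  composition on the other side uses \<open>\<psi>\<close> instead.
\<close>

lemma homotopic_cmp_right:
  assumes "X \<in> adel_Obj C" "Y \<in> adel_Obj C" "homotopic X Y x y" "(Y, \<beta>, Z) \<in> adel_Mor C"
  shows "homotopic X Z (x \<odot> val \<beta>) (y \<odot> val \<beta>)"
  using assms(4)
proof (rule adel_MorE)
  fix \<omega> \<psi> assume b: "Y \<in> adel_Obj C" "Z \<in> adel_Obj C" "\<beta> \<in> Mor C" "src C \<beta> = mid C Y"
    "tgt C \<beta> = mid C Z" "ok \<omega>" "dm \<omega> = rel C Y" "cd \<omega> = rel C Z"
    "val (fst Y) \<odot> val \<beta> = \<omega> \<odot> val (fst Z)"
  from assms(3) show ?thesis
  proof (rule homotopicE)
    fix s1 s2 assume *: "ok s1" "dm s1 = mid C X" "cd s1 = rel C Y" "ok s2" "dm s2 = corel C X"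
      "cd s2 = mid C Y" "x = y \<oplus> (s1 \<odot> val (fst Y) \<oplus> val (snd X) \<odot> s2)"
    show ?thesis by (rule homotopicI[of "s1 \<odot> \<omega>" _ _ "s2 \<odot> val \<beta>"])
      (use assms * b in \<open>simp_all add: vring\<close>)
  qed
qed

lemma homotopic_cmp_left:
  assumes "Y \<in> adel_Obj C" "Z \<in> adel_Obj C" "homotopic Y Z x y" "(X, \<alpha>, Y) \<in> adel_Mor C"
  shows "homotopic X Z (val \<alpha> \<odot> x) (val \<alpha> \<odot> y)"
  using assms(4)
proof (rule adel_MorE)
  fix \<omega> \<psi> assume b: "X \<in> adel_Obj C" "Y \<in> adel_Obj C" "\<alpha> \<in> Mor C" "src C \<alpha> = mid C X"
    "tgt C \<alpha> = mid C Y" "ok \<psi>" "dm \<psi> = corel C X" "cd \<psi> = corel C Y"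
    "\<And>z. val \<alpha> \<odot> (val (snd Y) \<odot> z) = val (snd X) \<odot> (\<psi> \<odot> z)"
  from assms(3) show ?thesis
  proof (rule homotopicE)
    fix s1 s2 assume *: "ok s1" "dm s1 = mid C Y" "cd s1 = rel C Z" "ok s2" "dm s2 = corel C Y"
      "cd s2 = mid C Z" "x = y \<oplus> (s1 \<odot> val (fst Z) \<oplus> val (snd Y) \<odot> s2)"
    show ?thesis by (rule homotopicI[of "val \<alpha> \<odot> s1" _ _ "\<psi> \<odot> s2"])
      (use assms * b in \<open>simp_all add: vring\<close>)
  qed
qed

lemma adel_Mor_cases:
  assumes "f \<in> adel_Mor C"
  obtains X \<alpha> Y where "f = (X, \<alpha>, Y)" "X \<in> adel_Obj C" "Y \<in> adel_Obj C" "\<alpha> \<in> Mor C"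
    "src C \<alpha> = mid C X" "tgt C \<alpha> = mid C Y"
  using assms by (auto simp: adel_Mor_def Hom_iff)

lemma adel_MorD [simp]:
  assumes "(X, \<alpha>, Y) \<in> adel_Mor C"
  shows "X \<in> adel_Obj C" "Y \<in> adel_Obj C" "\<alpha> \<in> Mor C" "src C \<alpha> = mid C X" "tgt C \<alpha> = mid C Y"
  using assms by (auto simp: adel_Mor_def Hom_iff)

lemma adel_ide: "X \<in> adel_Obj C \<Longrightarrow> (X, ide C (mid C X), X) \<in> adel_Mor C"
  by (rule adel_MorI[of _ _ _ "vide (rel C X)" "vide (corel C X)"]) simp_all

lemma adel_cmp:
  assumes "(X, \<alpha>, Y) \<in> adel_Mor C" "(Y, \<beta>, Z) \<in> adel_Mor C"
  shows "(X, \<alpha> \<cdot> \<beta>, Z) \<in> adel_Mor C"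
  using assms(1)
proof (rule adel_MorE)
  fix \<omega> \<psi> assume a: "X \<in> adel_Obj C" "Y \<in> adel_Obj C" "\<alpha> \<in> Mor C" "src C \<alpha> = mid C X"
    "tgt C \<alpha> = mid C Y" "ok \<omega>" "dm \<omega> = rel C X" "cd \<omega> = rel C Y"
    "\<And>z. val (fst X) \<odot> (val \<alpha> \<odot> z) = \<omega> \<odot> (val (fst Y) \<odot> z)"
    "ok \<psi>" "dm \<psi> = corel C X" "cd \<psi> = corel C Y"
    "\<And>z. val \<alpha> \<odot> (val (snd Y) \<odot> z) = val (snd X) \<odot> (\<psi> \<odot> z)"
  from assms(2) show ?thesis
  proof (rule adel_MorE)
    fix \<omega>' \<psi>' assume "Z \<in> adel_Obj C" "\<beta> \<in> Mor C" "src C \<beta> = mid C Y"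
      "tgt C \<beta> = mid C Z" "ok \<omega>'" "dm \<omega>' = rel C Y" "cd \<omega>' = rel C Z"
      "val (fst Y) \<odot> val \<beta> = \<omega>' \<odot> val (fst Z)"
      "ok \<psi>'" "dm \<psi>' = corel C Y" "cd \<psi>' = corel C Z" "val \<beta> \<odot> val (snd Z) = val (snd Y) \<odot> \<psi>'"
    with a show ?thesis
      by (intro adel_MorI[of _ _ _ "\<omega> \<odot> \<omega>'" "\<psi> \<odot> \<psi>'"]) (simp_all add: vmul_assoc)
  qed
qed

lemma adel_add:
  assumes "(X, \<alpha>, Y) \<in> adel_Mor C" "(X, \<beta>, Y) \<in> adel_Mor C"
  shows "(X, \<alpha> \<boxplus> \<beta>, Y) \<in> adel_Mor C"
  using assms(1)
proof (rule adel_MorE)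
  fix \<omega> \<psi> assume a: "X \<in> adel_Obj C" "Y \<in> adel_Obj C" "\<alpha> \<in> Mor C" "src C \<alpha> = mid C X"
    "tgt C \<alpha> = mid C Y" "ok \<omega>" "dm \<omega> = rel C X" "cd \<omega> = rel C Y"
    "val (fst X) \<odot> val \<alpha> = \<omega> \<odot> val (fst Y)"
    "ok \<psi>" "dm \<psi> = corel C X" "cd \<psi> = corel C Y"
    "val \<alpha> \<odot> val (snd Y) = val (snd X) \<odot> \<psi>"
  from assms(2) show ?thesis
  proof (rule adel_MorE)
    fix \<omega>' \<psi>' assume "\<beta> \<in> Mor C" "src C \<beta> = mid C X"
      "tgt C \<beta> = mid C Y" "ok \<omega>'" "dm \<omega>' = rel C X" "cd \<omega>' = rel C Y"
      "val (fst X) \<odot> val \<beta> = \<omega>' \<odot> val (fst Y)"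
      "ok \<psi>'" "dm \<psi>' = corel C X" "cd \<psi>' = corel C Y" "val \<beta> \<odot> val (snd Y) = val (snd X) \<odot> \<psi>'"
    with a show ?thesis
      by (intro adel_MorI[of _ _ _ "\<omega> \<oplus> \<omega>'" "\<psi> \<oplus> \<psi>'"])
         (simp_all add: vmul_vadd_left vmul_vadd_right)
  qed
qed

lemma adel_neg:
  assumes "(X, \<alpha>, Y) \<in> adel_Mor C"
  shows "(X, neg C \<alpha>, Y) \<in> adel_Mor C"
  using assms(1)
proof (rule adel_MorE)
  fix \<omega> \<psi> assume a: "X \<in> adel_Obj C" "Y \<in> adel_Obj C" "\<alpha> \<in> Mor C" "src C \<alpha> = mid C X"
    "tgt C \<alpha> = mid C Y" "ok \<omega>" "dm \<omega> = rel C X" "cd \<omega> = rel C Y"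
    "val (fst X) \<odot> val \<alpha> = \<omega> \<odot> val (fst Y)"
    "ok \<psi>" "dm \<psi> = corel C X" "cd \<psi> = corel C Y"
    "val \<alpha> \<odot> val (snd Y) = val (snd X) \<odot> \<psi>"
  then show ?thesis
    by (intro adel_MorI[of _ _ _ "\<ominus> \<omega>" "\<ominus> \<psi>"]) (simp_all add: vneg_vmul_left vneg_vmul_right)
qed

lemma adel_zero_mor:
  "X \<in> adel_Obj C \<Longrightarrow> Y \<in> adel_Obj C \<Longrightarrow> (X, zero_mor C (mid C X) (mid C Y), Y) \<in> adel_Mor C"
  by (rule adel_MorI[of _ _ _ "vzero (rel C X) (rel C Y)" "vzero (corel C X) (corel C Y)"]) simp_all

lemma adel_dsum_simps [simp]:
  assumes "X \<in> adel_Obj C" "Y \<in> adel_Obj C"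
  shows "adel_dsum C X Y \<in> adel_Obj C" "rel C (adel_dsum C X Y) = dsum C (rel C X) (rel C Y)"
    "mid C (adel_dsum C X Y) = dsum C (mid C X) (mid C Y)"
    "corel C (adel_dsum C X Y) = dsum C (corel C X) (corel C Y)"
    "fst (adel_dsum C X Y) = dsum_mor C (fst X) (fst Y)"
    "snd (adel_dsum C X Y) = dsum_mor C (snd X) (snd Y)"
  using assms by (auto simp: adel_dsum_def adel_pair intro!: adel_ObjI)

lemma adel_dsum_structure:
  assumes "X \<in> adel_Obj C" "Y \<in> adel_Obj C"
  shows "(X, inj1 C (mid C X) (mid C Y), adel_dsum C X Y) \<in> adel_Mor C"
    and "(Y, inj2 C (mid C X) (mid C Y), adel_dsum C X Y) \<in> adel_Mor C"
    and "(adel_dsum C X Y, proj1 C (mid C X) (mid C Y), X) \<in> adel_Mor C"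
    and "(adel_dsum C X Y, proj2 C (mid C X) (mid C Y), Y) \<in> adel_Mor C"
proof -
  show "(X, inj1 C (mid C X) (mid C Y), adel_dsum C X Y) \<in> adel_Mor C"
    by (rule adel_MorI[of _ _ _ "val (inj1 C (rel C X) (rel C Y))" "val (inj1 C (corel C X) (corel C Y))"])
       (use assms in \<open>simp_all add: vring\<close>)
  show "(Y, inj2 C (mid C X) (mid C Y), adel_dsum C X Y) \<in> adel_Mor C"
    by (rule adel_MorI[of _ _ _ "val (inj2 C (rel C X) (rel C Y))" "val (inj2 C (corel C X) (corel C Y))"])
       (use assms in \<open>simp_all add: vring\<close>)
  show "(adel_dsum C X Y, proj1 C (mid C X) (mid C Y), X) \<in> adel_Mor C"
    by (rule adel_MorI[of _ _ _ "val (proj1 C (rel C X) (rel C Y))" "val (proj1 C (corel C X) (corel C Y))"])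
       (use assms in \<open>simp_all add: vring\<close>)
  show "(adel_dsum C X Y, proj2 C (mid C X) (mid C Y), Y) \<in> adel_Mor C"
    by (rule adel_MorI[of _ _ _ "val (proj2 C (rel C X) (rel C Y))" "val (proj2 C (corel C X) (corel C Y))"])
       (use assms in \<open>simp_all add: vring\<close>)
qed

lemma adel_into_dsum:
  assumes "(T, \<alpha>, X) \<in> adel_Mor C" "(T, \<beta>, Y) \<in> adel_Mor C"
  shows "(T, into_dsum C \<alpha> \<beta>, adel_dsum C X Y) \<in> adel_Mor C"
  using assms(1)
proof (rule adel_MorE)
  fix \<omega> \<psi> assume a: "T \<in> adel_Obj C" "X \<in> adel_Obj C" "\<alpha> \<in> Mor C" "src C \<alpha> = mid C T"
    "tgt C \<alpha> = mid C X" "ok \<omega>" "dm \<omega> = rel C T" "cd \<omega> = rel C X"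
    "\<And>z. val (fst T) \<odot> (val \<alpha> \<odot> z) = \<omega> \<odot> (val (fst X) \<odot> z)"
    "ok \<psi>" "dm \<psi> = corel C T" "cd \<psi> = corel C X"
    "\<And>z. val \<alpha> \<odot> (val (snd X) \<odot> z) = val (snd T) \<odot> (\<psi> \<odot> z)"
  from assms(2) show ?thesis
  proof (rule adel_MorE)
    fix \<omega>' \<psi>' assume "Y \<in> adel_Obj C" "\<beta> \<in> Mor C" "src C \<beta> = mid C T"
      "tgt C \<beta> = mid C Y" "ok \<omega>'" "dm \<omega>' = rel C T" "cd \<omega>' = rel C Y"
      "\<And>z. val (fst T) \<odot> (val \<beta> \<odot> z) = \<omega>' \<odot> (val (fst Y) \<odot> z)"
      "ok \<psi>'" "dm \<psi>' = corel C T" "cd \<psi>' = corel C Y"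
      "\<And>z. val \<beta> \<odot> (val (snd Y) \<odot> z) = val (snd T) \<odot> (\<psi>' \<odot> z)"
    with a show ?thesis
      by (intro adel_MorI[of _ _ _ "\<omega> \<odot> val (inj1 C (rel C X) (rel C Y)) \<oplus> \<omega>' \<odot> val (inj2 C (rel C X) (rel C Y))"
        "\<psi> \<odot> val (inj1 C (corel C X) (corel C Y)) \<oplus> \<psi>' \<odot> val (inj2 C (corel C X) (corel C Y))"])
         (simp_all add: vring)
  qed
qed

lemma adel_from_dsum:
  assumes "(X, \<alpha>, T) \<in> adel_Mor C" "(Y, \<beta>, T) \<in> adel_Mor C"
  shows "(adel_dsum C X Y, from_dsum C \<alpha> \<beta>, T) \<in> adel_Mor C"
  using assms(1)
proof (rule adel_MorE)
  fix \<omega> \<psi> assume a: "X \<in> adel_Obj C" "T \<in> adel_Obj C" "\<alpha> \<in> Mor C" "src C \<alpha> = mid C X"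
    "tgt C \<alpha> = mid C T" "ok \<omega>" "dm \<omega> = rel C X" "cd \<omega> = rel C T"
    "val (fst X) \<odot> val \<alpha> = \<omega> \<odot> val (fst T)"
    "ok \<psi>" "dm \<psi> = corel C X" "cd \<psi> = corel C T"
    "val \<alpha> \<odot> val (snd T) = val (snd X) \<odot> \<psi>"
  from assms(2) show ?thesis
  proof (rule adel_MorE)
    fix \<omega>' \<psi>' assume "Y \<in> adel_Obj C" "\<beta> \<in> Mor C" "src C \<beta> = mid C Y"
      "tgt C \<beta> = mid C T" "ok \<omega>'" "dm \<omega>' = rel C Y" "cd \<omega>' = rel C T"
      "val (fst Y) \<odot> val \<beta> = \<omega>' \<odot> val (fst T)"
      "ok \<psi>'" "dm \<psi>' = corel C Y" "cd \<psi>' = corel C T"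
      "val \<beta> \<odot> val (snd T) = val (snd Y) \<odot> \<psi>'"
    with a show ?thesis
      by (intro adel_MorI[of _ _ _ "val (proj1 C (rel C X) (rel C Y)) \<odot> \<omega> \<oplus> val (proj2 C (rel C X) (rel C Y)) \<odot> \<omega>'"
        "val (proj1 C (corel C X) (corel C Y)) \<odot> \<psi> \<oplus> val (proj2 C (corel C X) (corel C Y)) \<odot> \<psi>'"])
         (simp_all add: vring)
  qed
qed

lemma Adel_simps [simp]:
  "Obj (Adel C) = adel_Obj C" "Mor (Adel C) = adel_Mor C" "src (Adel C) = fst"
  "tgt (Adel C) = (\<lambda>f. snd (snd f))" "eqv (Adel C) = adel_eqv C"
  "cmp (Adel C) f g = (fst f, fst (snd f) \<cdot> fst (snd g), snd (snd g))"
  "ide (Adel C) X = (X, ide C (mid C X), X)"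
  "add (Adel C) f g = (fst f, fst (snd f) \<boxplus> fst (snd g), snd (snd f))"
  "neg (Adel C) f = (fst f, neg C (fst (snd f)), snd (snd f))"
  "zero_mor (Adel C) X Y = (X, zero_mor C (mid C X) (mid C Y), Y)"
  "zero_obj (Adel C) = (zero_mor C (zero_obj C) (zero_obj C), zero_mor C (zero_obj C) (zero_obj C))"
  "dsum (Adel C) = adel_dsum C"
  "inj1 (Adel C) X Y = (X, inj1 C (mid C X) (mid C Y), adel_dsum C X Y)"
  "inj2 (Adel C) X Y = (Y, inj2 C (mid C X) (mid C Y), adel_dsum C X Y)"
  "proj1 (Adel C) X Y = (adel_dsum C X Y, proj1 C (mid C X) (mid C Y), X)"
  "proj2 (Adel C) X Y = (adel_dsum C X Y, proj2 C (mid C X) (mid C Y), Y)"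
  "into_dsum (Adel C) f g =
    (fst f, into_dsum C (fst (snd f)) (fst (snd g)), adel_dsum C (snd (snd f)) (snd (snd g)))"
  "from_dsum (Adel C) f g =
    (adel_dsum C (fst f) (fst g), from_dsum C (fst (snd f)) (fst (snd g)), snd (snd f))"
  by (auto simp: Adel_def split: prod.splits)

lemma Hom_Adel: "f \<in> Hom (Adel C) X Y \<longleftrightarrow> (\<exists>\<alpha>. f = (X, \<alpha>, Y) \<and> (X, \<alpha>, Y) \<in> adel_Mor C)"
  by (cases f) (auto simp: Hom_def)

text \<open>
  Most laws of the Adelman category are inherited from \<open>C\<close> through this lemma.
\<close>

lemma adel_eqv_of_eqv:
  assumes "(X, \<alpha>, Y) \<in> adel_Mor C" "(X, \<beta>, Y) \<in> adel_Mor C" "val \<alpha> = val \<beta>"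
  shows "adel_eqv C (X, \<alpha>, Y) (X, \<beta>, Y)"
  using assms adel_eqv_iff[OF assms(1,2)] by (simp add: homotopic_refl)

lemma computable_on_adel:
  assumes "computable_on D F" "\<And>x. x \<in> D \<Longrightarrow> F x \<in> adel_Obj C"
  shows "computable_on D (\<lambda>x. rel C (F x))" "computable_on D (\<lambda>x. mid C (F x))"
    "computable_on D (\<lambda>x. corel C (F x))"
  unfolding rel_def mid_def corel_def
  by (intro computable_intros assms(1); use assms(2) in simp)+

lemma computable_on_adel_dsum:
  assumes "computable_on D F" "computable_on D G"
    "\<And>x. x \<in> D \<Longrightarrow> F x \<in> adel_Obj C \<and> G x \<in> adel_Obj C"
  shows "computable_on D (\<lambda>x. adel_dsum C (F x) (G x))"
  unfolding adel_dsum_def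
  by (intro computable_intros assms(1,2)) (use assms(3) in simp_all)

end

section \<open>Additivity of the Adelman category\<close>

context additive_category
begin

lemma category_Adel: "category (Adel C)"
proof
  fix f X Y g Z assume "f \<in> Hom (Adel C) X Y" "g \<in> Hom (Adel C) Y Z"
  then show "f \<cdot>\<^bsub>Adel C\<^esub> g \<in> Hom (Adel C) X Z" by (auto simp: Hom_Adel intro: adel_cmp)
next
  fix f X Y g assume "f \<in> Hom (Adel C) X Y" "g \<in> Hom (Adel C) X Y" "f \<approx>\<^bsub>Adel C\<^esub> g"
  then show "g \<approx>\<^bsub>Adel C\<^esub> f" by (auto simp: Hom_Adel adel_eqv_iff homotopic_sym)
next
  fix f X Y g h assume "f \<in> Hom (Adel C) X Y" "g \<in> Hom (Adel C) X Y" "h \<in> Hom (Adel C) X Y"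
    "f \<approx>\<^bsub>Adel C\<^esub> g" "g \<approx>\<^bsub>Adel C\<^esub> h"
  then show "f \<approx>\<^bsub>Adel C\<^esub> h" by (auto simp: Hom_Adel adel_eqv_iff) (blast intro: homotopic_trans adel_MorD(1,2))
next
  fix f X Y f' g Z g' assume *: "f \<in> Hom (Adel C) X Y" "f' \<in> Hom (Adel C) X Y" "g \<in> Hom (Adel C) Y Z"
    "g' \<in> Hom (Adel C) Y Z" "f \<approx>\<^bsub>Adel C\<^esub> f'" "g \<approx>\<^bsub>Adel C\<^esub> g'"
  then obtain \<alpha> \<alpha>' \<beta> \<beta>' where m: "f = (X, \<alpha>, Y)" "f' = (X, \<alpha>', Y)" "g = (Y, \<beta>, Z)" "g' = (Y, \<beta>', Z)"
    "(X, \<alpha>, Y) \<in> adel_Mor C" "(X, \<alpha>', Y) \<in> adel_Mor C" "(Y, \<beta>, Z) \<in> adel_Mor C" "(Y, \<beta>', Z) \<in> adel_Mor C"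
    by (auto simp: Hom_Adel)
  with * have h: "homotopic X Y (val \<alpha>) (val \<alpha>')" "homotopic Y Z (val \<beta>) (val \<beta>')"
    by (auto simp: adel_eqv_iff)
  have "homotopic X Z (val \<alpha> \<odot> val \<beta>) (val \<alpha>' \<odot> val \<beta>')"
    by (rule homotopic_trans[OF _ _ homotopic_cmp_right[OF _ _ h(1) m(7)] homotopic_cmp_left[OF _ _ h(2) m(6)]])
       (use m in simp_all)
  then show "f \<cdot>\<^bsub>Adel C\<^esub> g \<approx>\<^bsub>Adel C\<^esub> f' \<cdot>\<^bsub>Adel C\<^esub> g'"
    using m adel_cmp[OF m(5) m(7)] adel_cmp[OF m(6) m(8)] by (simp add: adel_eqv_iff)
next
  fix f X Y assume "f \<in> Hom (Adel C) X Y"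
  then obtain \<alpha> where *: "f = (X, \<alpha>, Y)" "(X, \<alpha>, Y) \<in> adel_Mor C" by (auto simp: Hom_Adel)
  note ide = adel_ide[OF adel_MorD(1)[OF *(2)]] adel_ide[OF adel_MorD(2)[OF *(2)]]
  from * show "ide (Adel C) X \<cdot>\<^bsub>Adel C\<^esub> f \<approx>\<^bsub>Adel C\<^esub> f" "f \<cdot>\<^bsub>Adel C\<^esub> ide (Adel C) Y \<approx>\<^bsub>Adel C\<^esub> f"
    using adel_cmp[OF ide(1) *(2)] adel_cmp[OF *(2) ide(2)] by (auto intro!: adel_eqv_of_eqv)
next
  fix f X Y g Z h W assume "f \<in> Hom (Adel C) X Y" "g \<in> Hom (Adel C) Y Z" "h \<in> Hom (Adel C) Z W"
  then show "(f \<cdot>\<^bsub>Adel C\<^esub> g) \<cdot>\<^bsub>Adel C\<^esub> h \<approx>\<^bsub>Adel C\<^esub> f \<cdot>\<^bsub>Adel C\<^esub> (g \<cdot>\<^bsub>Adel C\<^esub> h)"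
    by (auto simp: Hom_Adel vmul_assoc intro!: adel_eqv_of_eqv) (blast intro: adel_cmp)+
next
  show "computable_on (Obj (Adel C)) (ide (Adel C))"
    unfolding Adel_simps by (intro computable_intros computable_on_adel) simp_all
next
  show "computable_on {(f, g). f \<in> Mor (Adel C) \<and> g \<in> Mor (Adel C) \<and> tgt (Adel C) f = src (Adel C) g}
      (\<lambda>(f, g). f \<cdot>\<^bsub>Adel C\<^esub> g)"
    unfolding Adel_simps case_prod_beta
    by (intro computable_intros) (auto elim!: adel_Mor_cases)
next
  show "computable_on (Mor (Adel C)) (src (Adel C))" "computable_on (Mor (Adel C)) (tgt (Adel C))"
    using computable_on_fst[OF computable_on_id] computable_on_snd[OF computable_on_snd[OF computable_on_id]]
    by simp_all
next
  fix f assume "f \<in> Mor (Adel C)"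
  then obtain X \<alpha> Y where *: "f = (X, \<alpha>, Y)" "(X, \<alpha>, Y) \<in> adel_Mor C" by (cases f) auto
  from * show "src (Adel C) f \<in> Obj (Adel C)" "tgt (Adel C) f \<in> Obj (Adel C)" by simp_all
  from * show "f \<approx>\<^bsub>Adel C\<^esub> f" by (simp add: adel_eqv_of_eqv)
qed (auto simp: Hom_Adel adel_ide)

text \<open>
  All laws hold already for the underlying morphisms of \<open>C\<close>. What remains is that the structure morphisms
  satisfy the side conditions and that addition and negation respect null homotopies.
\<close>

lemma additive_category_Adel: "additive_category (Adel C)"
proof (intro additive_category.intro[OF category_Adel] additive_category_axioms.intro)
  fix f X Y g assume "f \<in> Hom (Adel C) X Y" "g \<in> Hom (Adel C) X Y"
  then show "f \<boxplus>\<^bsub>Adel C\<^esub> g \<in> Hom (Adel C) X Y" by (auto simp: Hom_Adel intro: adel_add)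
next
  fix f X Y assume "f \<in> Hom (Adel C) X Y"
  then show "neg (Adel C) f \<in> Hom (Adel C) X Y" by (auto simp: Hom_Adel intro: adel_neg)
next
  fix X Y assume "X \<in> Obj (Adel C)" "Y \<in> Obj (Adel C)"
  then show "zero_mor (Adel C) X Y \<in> Hom (Adel C) X Y" by (auto simp: Hom_Adel intro: adel_zero_mor)
next
  fix f X Y f' g g' assume "f \<in> Hom (Adel C) X Y" "f' \<in> Hom (Adel C) X Y" "g \<in> Hom (Adel C) X Y"
    "g' \<in> Hom (Adel C) X Y" "f \<approx>\<^bsub>Adel C\<^esub> f'" "g \<approx>\<^bsub>Adel C\<^esub> g'"
  then show "f \<boxplus>\<^bsub>Adel C\<^esub> g \<approx>\<^bsub>Adel C\<^esub> f' \<boxplus>\<^bsub>Adel C\<^esub> g'"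
    by (auto simp: Hom_Adel adel_eqv_iff adel_add) (blast intro: homotopic_add adel_MorD(1,2))
next
  fix f X Y f' assume "f \<in> Hom (Adel C) X Y" "f' \<in> Hom (Adel C) X Y" "f \<approx>\<^bsub>Adel C\<^esub> f'"
  then show "neg (Adel C) f \<approx>\<^bsub>Adel C\<^esub> neg (Adel C) f'"
    by (auto simp: Hom_Adel adel_eqv_iff adel_neg) (blast intro: homotopic_neg adel_MorD(1,2))
next
  fix f X Y g h assume "f \<in> Hom (Adel C) X Y" "g \<in> Hom (Adel C) X Y" "h \<in> Hom (Adel C) X Y"
  then show "(f \<boxplus>\<^bsub>Adel C\<^esub> g) \<boxplus>\<^bsub>Adel C\<^esub> h \<approx>\<^bsub>Adel C\<^esub> f \<boxplus>\<^bsub>Adel C\<^esub> (g \<boxplus>\<^bsub>Adel C\<^esub> h)"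
    by (auto simp: Hom_Adel vadd_assoc intro!: adel_eqv_of_eqv adel_add)
next
  fix f X Y g assume "f \<in> Hom (Adel C) X Y" "g \<in> Hom (Adel C) X Y"
  then show "f \<boxplus>\<^bsub>Adel C\<^esub> g \<approx>\<^bsub>Adel C\<^esub> g \<boxplus>\<^bsub>Adel C\<^esub> f"
    by (auto simp: Hom_Adel vadd_commute intro!: adel_eqv_of_eqv) (blast intro: adel_add)+
next
  fix f X Y assume "f \<in> Hom (Adel C) X Y"
  then show "f \<boxplus>\<^bsub>Adel C\<^esub> zero_mor (Adel C) X Y \<approx>\<^bsub>Adel C\<^esub> f"
    "f \<boxplus>\<^bsub>Adel C\<^esub> neg (Adel C) f \<approx>\<^bsub>Adel C\<^esub> zero_mor (Adel C) X Y"
    by (auto simp: Hom_Adel intro!: adel_eqv_of_eqv adel_add adel_neg adel_zero_mor)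
next
  fix f X Y f' g Z assume "f \<in> Hom (Adel C) X Y" "f' \<in> Hom (Adel C) X Y" "g \<in> Hom (Adel C) Y Z"
  then show "(f \<boxplus>\<^bsub>Adel C\<^esub> f') \<cdot>\<^bsub>Adel C\<^esub> g \<approx>\<^bsub>Adel C\<^esub> f \<cdot>\<^bsub>Adel C\<^esub> g \<boxplus>\<^bsub>Adel C\<^esub> f' \<cdot>\<^bsub>Adel C\<^esub> g"
    by (auto simp: Hom_Adel vmul_vadd_left intro!: adel_eqv_of_eqv) (blast intro: adel_add adel_cmp)+
next
  fix f X Y g Z g' assume "f \<in> Hom (Adel C) X Y" "g \<in> Hom (Adel C) Y Z" "g' \<in> Hom (Adel C) Y Z"
  then show "f \<cdot>\<^bsub>Adel C\<^esub> (g \<boxplus>\<^bsub>Adel C\<^esub> g') \<approx>\<^bsub>Adel C\<^esub> f \<cdot>\<^bsub>Adel C\<^esub> g \<boxplus>\<^bsub>Adel C\<^esub> f \<cdot>\<^bsub>Adel C\<^esub> g'"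
    by (auto simp: Hom_Adel vmul_vadd_right intro!: adel_eqv_of_eqv) (blast intro: adel_add adel_cmp)+
next
  let ?Z = "(zero_mor C (zero_obj C) (zero_obj C), zero_mor C (zero_obj C) (zero_obj C))"
  have zero: "?Z \<in> adel_Obj C" by (simp add: adel_ObjI)
  then show "zero_obj (Adel C) \<in> Obj (Adel C)" by simp
  fix f X
  {
    assume "f \<in> Hom (Adel C) X (zero_obj (Adel C))"
    then obtain \<alpha> where *: "f = (X, \<alpha>, ?Z)" "(X, \<alpha>, ?Z) \<in> adel_Mor C" by (auto simp: Hom_Adel)
    have "(X, zero_mor C (mid C X) (mid C ?Z), ?Z) \<in> adel_Mor C"
      by (rule adel_zero_mor[OF adel_MorD(1)[OF *(2)] zero])
    from adel_eqv_of_eqv[OF *(2) this] show "f \<approx>\<^bsub>Adel C\<^esub> zero_mor (Adel C) X (zero_obj (Adel C))"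
      using * val_terminal[of \<alpha>] by (simp add: adel_pair)
  next
    assume "f \<in> Hom (Adel C) (zero_obj (Adel C)) X"
    then obtain \<alpha> where *: "f = (?Z, \<alpha>, X)" "(?Z, \<alpha>, X) \<in> adel_Mor C" by (auto simp: Hom_Adel)
    have "(?Z, zero_mor C (mid C ?Z) (mid C X), X) \<in> adel_Mor C"
      by (rule adel_zero_mor[OF zero adel_MorD(2)[OF *(2)]])
    from adel_eqv_of_eqv[OF *(2) this] show "f \<approx>\<^bsub>Adel C\<^esub> zero_mor (Adel C) (zero_obj (Adel C)) X"
      using * val_initial[of \<alpha>] by (simp add: adel_pair)
  }
next
  fix X Y assume "X \<in> Obj (Adel C)" "Y \<in> Obj (Adel C)"
  then have XY: "X \<in> adel_Obj C" "Y \<in> adel_Obj C" by simp_all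
  note [intro] = adel_dsum_structure[OF XY] adel_cmp adel_ide[OF XY(1)] adel_ide[OF XY(2)]
    adel_zero_mor[OF XY] adel_zero_mor[OF XY(2) XY(1)]
  from XY show "dsum (Adel C) X Y \<in> Obj (Adel C)" by simp
  show "inj1 (Adel C) X Y \<in> Hom (Adel C) X (dsum (Adel C) X Y)"
    "inj2 (Adel C) X Y \<in> Hom (Adel C) Y (dsum (Adel C) X Y)"
    "proj1 (Adel C) X Y \<in> Hom (Adel C) (dsum (Adel C) X Y) X"
    "proj2 (Adel C) X Y \<in> Hom (Adel C) (dsum (Adel C) X Y) Y"
    by (auto simp: Hom_Adel)
  show "inj1 (Adel C) X Y \<cdot>\<^bsub>Adel C\<^esub> proj1 (Adel C) X Y \<approx>\<^bsub>Adel C\<^esub> ide (Adel C) X"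
    "inj2 (Adel C) X Y \<cdot>\<^bsub>Adel C\<^esub> proj2 (Adel C) X Y \<approx>\<^bsub>Adel C\<^esub> ide (Adel C) Y"
    "inj1 (Adel C) X Y \<cdot>\<^bsub>Adel C\<^esub> proj2 (Adel C) X Y \<approx>\<^bsub>Adel C\<^esub> zero_mor (Adel C) X Y"
    "inj2 (Adel C) X Y \<cdot>\<^bsub>Adel C\<^esub> proj1 (Adel C) X Y \<approx>\<^bsub>Adel C\<^esub> zero_mor (Adel C) Y X"
    using XY by (auto intro!: adel_eqv_of_eqv)
  show "proj1 (Adel C) X Y \<cdot>\<^bsub>Adel C\<^esub> inj1 (Adel C) X Y \<boxplus>\<^bsub>Adel C\<^esub>
      proj2 (Adel C) X Y \<cdot>\<^bsub>Adel C\<^esub> inj2 (Adel C) X Y \<approx>\<^bsub>Adel C\<^esub> ide (Adel C) (dsum (Adel C) X Y)"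
    using XY adel_ide[of "adel_dsum C X Y"] by (auto intro!: adel_eqv_of_eqv adel_add)
next
  fix f T X g Y assume "f \<in> Hom (Adel C) T X" "g \<in> Hom (Adel C) T Y"
  then obtain \<alpha> \<beta> where *: "f = (T, \<alpha>, X)" "g = (T, \<beta>, Y)" "(T, \<alpha>, X) \<in> adel_Mor C" "(T, \<beta>, Y) \<in> adel_Mor C"
    by (auto simp: Hom_Adel)
  note m = adel_into_dsum[OF *(3,4)]
  show "into_dsum (Adel C) f g \<in> Hom (Adel C) T (dsum (Adel C) X Y)"
    using * m by (simp add: Hom_Adel)
  show "into_dsum (Adel C) f g \<cdot>\<^bsub>Adel C\<^esub> proj1 (Adel C) X Y \<approx>\<^bsub>Adel C\<^esub> f"
    using * adel_cmp[OF m adel_dsum_structure(3)] by (auto intro!: adel_eqv_of_eqv simp: vring)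
  show "into_dsum (Adel C) f g \<cdot>\<^bsub>Adel C\<^esub> proj2 (Adel C) X Y \<approx>\<^bsub>Adel C\<^esub> g"
    using * adel_cmp[OF m adel_dsum_structure(4)] by (auto intro!: adel_eqv_of_eqv simp: vring)
next
  fix f T X g Y assume "f \<in> Hom (Adel C) X T" "g \<in> Hom (Adel C) Y T"
  then obtain \<alpha> \<beta> where *: "f = (X, \<alpha>, T)" "g = (Y, \<beta>, T)" "(X, \<alpha>, T) \<in> adel_Mor C" "(Y, \<beta>, T) \<in> adel_Mor C"
    by (auto simp: Hom_Adel)
  note m = adel_from_dsum[OF *(3,4)]
  show "from_dsum (Adel C) f g \<in> Hom (Adel C) (dsum (Adel C) X Y) T"
    using * m by (simp add: Hom_Adel)
  show "inj1 (Adel C) X Y \<cdot>\<^bsub>Adel C\<^esub> from_dsum (Adel C) f g \<approx>\<^bsub>Adel C\<^esub> f"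
    using * adel_cmp[OF adel_dsum_structure(1) m] by (auto intro!: adel_eqv_of_eqv simp: vring)
  show "inj2 (Adel C) X Y \<cdot>\<^bsub>Adel C\<^esub> from_dsum (Adel C) f g \<approx>\<^bsub>Adel C\<^esub> g"
    using * adel_cmp[OF adel_dsum_structure(2) m] by (auto intro!: adel_eqv_of_eqv simp: vring)
next
  show "computable_on {(f, g). f \<in> Mor (Adel C) \<and> g \<in> Mor (Adel C) \<and> src (Adel C) f = src (Adel C) g \<and>
      tgt (Adel C) f = tgt (Adel C) g} (\<lambda>(f, g). f \<boxplus>\<^bsub>Adel C\<^esub> g)"
    unfolding Adel_simps case_prod_beta by (intro computable_intros) (auto elim!: adel_Mor_cases)
  show "computable_on (Mor (Adel C)) (neg (Adel C))"
    unfolding Adel_simps by (intro computable_intros) (auto elim!: adel_Mor_cases)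
  show "computable_on (Obj (Adel C) \<times> Obj (Adel C)) (\<lambda>(X, Y). zero_mor (Adel C) X Y)"
    "computable_on (Obj (Adel C) \<times> Obj (Adel C)) (\<lambda>(X, Y). dsum (Adel C) X Y)"
    "computable_on (Obj (Adel C) \<times> Obj (Adel C)) (\<lambda>(X, Y). inj1 (Adel C) X Y)"
    "computable_on (Obj (Adel C) \<times> Obj (Adel C)) (\<lambda>(X, Y). inj2 (Adel C) X Y)"
    "computable_on (Obj (Adel C) \<times> Obj (Adel C)) (\<lambda>(X, Y). proj1 (Adel C) X Y)"
    "computable_on (Obj (Adel C) \<times> Obj (Adel C)) (\<lambda>(X, Y). proj2 (Adel C) X Y)"
    unfolding Adel_simps case_prod_beta
    by (intro computable_intros computable_on_adel computable_on_adel_dsum; simp add: mem_Times_iff)+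
  show "computable_on {(f, g). f \<in> Mor (Adel C) \<and> g \<in> Mor (Adel C) \<and> src (Adel C) f = src (Adel C) g}
      (\<lambda>(f, g). into_dsum (Adel C) f g)"
    unfolding Adel_simps case_prod_beta
    by (intro computable_intros computable_on_adel_dsum) (auto elim!: adel_Mor_cases)
  show "computable_on {(f, g). f \<in> Mor (Adel C) \<and> g \<in> Mor (Adel C) \<and> tgt (Adel C) f = tgt (Adel C) g}
      (\<lambda>(f, g). from_dsum (Adel C) f g)"
    unfolding Adel_simps case_prod_beta
    by (intro computable_intros computable_on_adel_dsum) (auto elim!: adel_Mor_cases)
qed

end

section \<open>Kernel and cokernel objects\<close>

context additive_category
begin

lemma vadd_cancel3 [simp]:
  assumes "ok x" "ok y" "dm x = dm y" "cd x = cd y"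
  shows "x \<oplus> (y \<oplus> \<ominus> x) = y" "y \<oplus> (x \<oplus> \<ominus> x) = y"  "\<ominus> x \<oplus> (y \<oplus> x) = y"
  using assms by (simp_all add: vadd_commute[of y])

lemma is_zero_AdelI:
  assumes "(X, \<alpha>, Y) \<in> adel_Mor C" "ok s1" "dm s1 = mid C X" "cd s1 = rel C Y"
    "ok s2" "dm s2 = corel C X" "cd s2 = mid C Y" "val \<alpha> = s1 \<odot> val (fst Y) \<oplus> val (snd X) \<odot> s2"
  shows "is_zero (Adel C) (X, \<alpha>, Y)"
proof -
  have "homotopic X Y (val \<alpha>) (vzero (mid C X) (mid C Y))"
    by (rule homotopicI[of s1 _ _ s2]) (use assms in simp_all)
  then show ?thesis using assms by (simp add: is_zero_def adel_eqv_iff adel_zero_mor)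
qed

lemma is_zero_AdelE:
  assumes "(X, \<alpha>, Y) \<in> adel_Mor C" "is_zero (Adel C) (X, \<alpha>, Y)"
  obtains s1 s2 where "ok s1" "dm s1 = mid C X" "cd s1 = rel C Y"
    "ok s2" "dm s2 = corel C X" "cd s2 = mid C Y" "val \<alpha> = s1 \<odot> val (fst Y) \<oplus> val (snd X) \<odot> s2"
proof -
  have "homotopic X Y (val \<alpha>) (vzero (mid C X) (mid C Y))"
    using assms by (simp add: is_zero_def adel_eqv_iff adel_zero_mor)
  then obtain s1 s2 where *: "ok s1" "dm s1 = mid C X" "cd s1 = rel C Y"
    "ok s2" "dm s2 = corel C X" "cd s2 = mid C Y"
    "val \<alpha> = vzero (mid C X) (mid C Y) \<oplus> (s1 \<odot> val (fst Y) \<oplus> val (snd X) \<odot> s2)" by (rule homotopicE)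
  then have "val \<alpha> = s1 \<odot> val (fst Y) \<oplus> val (snd X) \<odot> s2" using assms by simp
  with * that show thesis by blast
qed

lemma adel_Mor_sel [simp]:
  assumes "f \<in> adel_Mor C"
  shows "fst f \<in> adel_Obj C" "fst (snd f) \<in> Mor C" "snd (snd f) \<in> adel_Obj C"
    "src C (fst (snd f)) = mid C (fst f)" "tgt C (fst (snd f)) = mid C (snd (snd f))"
  using assms by (auto elim!: adel_Mor_cases)

text \<open>
  Elements \<open>(x, y)\<close> of \<open>mid X \<oplus> rel Y\<close> with \<open>x \<cdot> \<gamma>X = 0\<close> and \<open>x \<cdot> \<alpha> + y \<cdot> \<rho>Y = 0\<close>, modulo the image of \<open>\<rho>X\<close> in
  the first component and modulo everything in the second: \<open>y\<close> is only a witness.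
\<close>

definition kernel_obj :: "'m adel_mor \<Rightarrow> 'm adel_obj" where
  "kernel_obj = (\<lambda>(X, \<alpha>, Y).
    (dsum_mor C (fst X) (ide C (rel C Y)),
     into_dsum C (proj1 C (mid C X) (rel C Y) \<cdot> snd X) (from_dsum C \<alpha> (fst Y))))"

definition kernel_emb :: "'m adel_mor \<Rightarrow> 'm adel_mor" where
  "kernel_emb = (\<lambda>(X, \<alpha>, Y). (kernel_obj (X, \<alpha>, Y), proj1 C (mid C X) (rel C Y), X))"

text \<open>
  Dual to \<open>kernel_obj\<close>: the middle term of \<open>Y\<close> is enlarged by \<open>corel X\<close>, and the relations are \<open>\<rho>Y\<close> and the
  image of \<open>(\<alpha>, \<gamma>X)\<close>.
\<close>

definition cokernel_obj :: "'m adel_mor \<Rightarrow> 'm adel_obj" where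
  "cokernel_obj = (\<lambda>(X, \<alpha>, Y).
    (from_dsum C (fst Y \<cdot> inj1 C (mid C Y) (corel C X)) (into_dsum C \<alpha> (snd X)),
     dsum_mor C (snd Y) (ide C (corel C X))))"

definition cokernel_proj :: "'m adel_mor \<Rightarrow> 'm adel_mor" where
  "cokernel_proj = (\<lambda>(X, \<alpha>, Y). (Y, inj1 C (mid C Y) (corel C X), cokernel_obj (X, \<alpha>, Y)))"

lemma kernel_obj_simps [simp]:
  assumes "X \<in> adel_Obj C" "Y \<in> adel_Obj C" "\<alpha> \<in> Mor C" "src C \<alpha> = mid C X" "tgt C \<alpha> = mid C Y"
  shows "kernel_obj (X, \<alpha>, Y) \<in> adel_Obj C"
    "rel C (kernel_obj (X, \<alpha>, Y)) = dsum C (rel C X) (rel C Y)"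
    "mid C (kernel_obj (X, \<alpha>, Y)) = dsum C (mid C X) (rel C Y)"
    "corel C (kernel_obj (X, \<alpha>, Y)) = dsum C (corel C X) (mid C Y)"
    "fst (kernel_obj (X, \<alpha>, Y)) = dsum_mor C (fst X) (ide C (rel C Y))"
    "snd (kernel_obj (X, \<alpha>, Y)) =
      into_dsum C (proj1 C (mid C X) (rel C Y) \<cdot> snd X) (from_dsum C \<alpha> (fst Y))"
  using assms by (auto simp: kernel_obj_def adel_pair intro!: adel_ObjI)

lemma cokernel_obj_simps [simp]:
  assumes "X \<in> adel_Obj C" "Y \<in> adel_Obj C" "\<alpha> \<in> Mor C" "src C \<alpha> = mid C X" "tgt C \<alpha> = mid C Y"
  shows "cokernel_obj (X, \<alpha>, Y) \<in> adel_Obj C"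
    "rel C (cokernel_obj (X, \<alpha>, Y)) = dsum C (rel C Y) (mid C X)"
    "mid C (cokernel_obj (X, \<alpha>, Y)) = dsum C (mid C Y) (corel C X)"
    "corel C (cokernel_obj (X, \<alpha>, Y)) = dsum C (corel C Y) (corel C X)"
    "fst (cokernel_obj (X, \<alpha>, Y)) =
      from_dsum C (fst Y \<cdot> inj1 C (mid C Y) (corel C X)) (into_dsum C \<alpha> (snd X))"
    "snd (cokernel_obj (X, \<alpha>, Y)) = dsum_mor C (snd Y) (ide C (corel C X))"
  using assms by (auto simp: cokernel_obj_def adel_pair intro!: adel_ObjI)

lemma kernel_emb_Mor:
  assumes "(X, \<alpha>, Y) \<in> adel_Mor C"
  shows "(kernel_obj (X, \<alpha>, Y), proj1 C (mid C X) (rel C Y), X) \<in> adel_Mor C"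
  by (rule adel_MorI[of _ _ _ "val (proj1 C (rel C X) (rel C Y))" "val (proj1 C (corel C X) (mid C Y))"])
     (use adel_MorD[OF assms] in \<open>simp_all add: vring\<close>)

lemma cokernel_proj_Mor:
  assumes "(X, \<alpha>, Y) \<in> adel_Mor C"
  shows "(Y, inj1 C (mid C Y) (corel C X), cokernel_obj (X, \<alpha>, Y)) \<in> adel_Mor C"
  by (rule adel_MorI[of _ _ _ "val (inj1 C (rel C Y) (mid C X))" "val (inj1 C (corel C Y) (corel C X))"])
     (use adel_MorD[OF assms] in \<open>simp_all add: vring\<close>)

text \<open>
  By the second column of the matrix \<open>\<gamma>\<close> of the kernel object, the composite \<open>proj1 \<cdot> \<alpha>\<close> is the sum of
  \<open>- proj2 \<cdot> \<rho>Y\<close> and a multiple of that matrix, which is a null homotopy.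
\<close>

lemma kernel_emb_zero:
  assumes "(X, \<alpha>, Y) \<in> adel_Mor C"
  shows "is_zero (Adel C) (kernel_obj (X, \<alpha>, Y), proj1 C (mid C X) (rel C Y) \<cdot> \<alpha>, Y)"
  by (rule is_zero_AdelI[of _ _ _ "\<ominus> val (proj2 C (mid C X) (rel C Y))" "val (proj2 C (corel C X) (mid C Y))"])
     (use adel_MorD[OF assms] adel_cmp[OF kernel_emb_Mor[OF assms] assms] in \<open>simp_all add: vring\<close>)

lemma cokernel_proj_zero:
  assumes "(X, \<alpha>, Y) \<in> adel_Mor C"
  shows "is_zero (Adel C) (X, \<alpha> \<cdot> inj1 C (mid C Y) (corel C X), cokernel_obj (X, \<alpha>, Y))"
  by (rule is_zero_AdelI[of _ _ _ "val (inj2 C (rel C Y) (mid C X))" "\<ominus> val (inj2 C (mid C Y) (corel C X))"])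
     (use adel_MorD[OF assms] adel_cmp[OF assms cokernel_proj_Mor[OF assms]] in \<open>simp_all add: vring\<close>)

text \<open>
  The kernel embedding is a monomorphism: a null homotopy of the first component extends to both,
  because the identity block in the \<open>\<rho>\<close> of the kernel object makes every second component
  null-homotopic.
\<close>

lemma kernel_emb_cancel:
  assumes f: "(X, \<alpha>, Y) \<in> adel_Mor C" and S: "S \<in> adel_Obj C"
    and x: "ok x" "dm x = mid C S" "cd x = dsum C (mid C X) (rel C Y)"
    and y: "ok y" "dm y = mid C S" "cd y = dsum C (mid C X) (rel C Y)"
    and h: "homotopic S X (x \<odot> val (proj1 C (mid C X) (rel C Y))) (y \<odot> val (proj1 C (mid C X) (rel C Y)))"
  shows "homotopic S (kernel_obj (X, \<alpha>, Y)) x y"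
  using h
proof (rule homotopicE)
  note m = adel_MorD[OF f]
  let ?p1 = "val (proj1 C (mid C X) (rel C Y))" and ?p2 = "val (proj2 C (mid C X) (rel C Y))"
  fix s1 s2 assume *: "ok s1" "dm s1 = mid C S" "cd s1 = rel C X" "ok s2" "dm s2 = corel C S"
    "cd s2 = mid C X" "x \<odot> ?p1 = y \<odot> ?p1 \<oplus> (s1 \<odot> val (fst X) \<oplus> val (snd S) \<odot> s2)"
  \<comment> \<open>the difference of the second components, absorbed by the identity block\<close>
  define d where "d = x \<odot> ?p2 \<oplus> \<ominus> (y \<odot> ?p2)"
  have d: "ok d" "dm d = mid C S" "cd d = rel C Y" using m x y S by (simp_all add: d_def)
  have xd: "x \<odot> ?p2 = y \<odot> ?p2 \<oplus> d" unfolding d_def using m x y S by simp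
  let ?s1 = "s1 \<odot> val (inj1 C (rel C X) (rel C Y)) \<oplus> d \<odot> val (inj2 C (rel C X) (rel C Y))"
  let ?s2 = "s2 \<odot> val (inj1 C (mid C X) (rel C Y))"
  have e: "?s1 \<odot> val (fst (kernel_obj (X, \<alpha>, Y))) =
    s1 \<odot> (val (fst X) \<odot> val (inj1 C (mid C X) (rel C Y))) \<oplus> d \<odot> val (inj2 C (mid C X) (rel C Y))"
    using m * d S by (simp add: vring)
  let ?y = "y \<oplus> (s1 \<odot> (val (fst X) \<odot> val (inj1 C (mid C X) (rel C Y))) \<oplus>
    d \<odot> val (inj2 C (mid C X) (rel C Y)) \<oplus> val (snd S) \<odot> ?s2)"
  have 1: "?y \<odot> ?p1 = x \<odot> ?p1" unfolding *(7) vmul_vadd_left vmul_assoc using m y *(1-6) S d by simp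
  have 2: "?y \<odot> ?p2 = x \<odot> ?p2" unfolding xd vmul_vadd_left vmul_assoc using m y *(1-6) S d by simp
  have "x = ?y"
    by (rule eq_into_dsum[OF _ _ _ _ _ _ 1[symmetric] 2[symmetric]]) (use m x y *(1-6) S d in simp_all)
  then have "x = y \<oplus> (?s1 \<odot> val (fst (kernel_obj (X, \<alpha>, Y))) \<oplus> val (snd S) \<odot> ?s2)"
    unfolding e .
  then show ?thesis by (intro homotopicI[of ?s1 _ _ ?s2]) (use m x y * S d in simp_all)
qed

lemma cokernel_proj_cancel:
  assumes f: "(X, \<alpha>, Y) \<in> adel_Mor C" and S: "S \<in> adel_Obj C"
    and x: "ok x" "dm x = dsum C (mid C Y) (corel C X)" "cd x = mid C S"
    and y: "ok y" "dm y = dsum C (mid C Y) (corel C X)" "cd y = mid C S"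
    and h: "homotopic Y S (val (inj1 C (mid C Y) (corel C X)) \<odot> x) (val (inj1 C (mid C Y) (corel C X)) \<odot> y)"
  shows "homotopic (cokernel_obj (X, \<alpha>, Y)) S x y"
  using h
proof (rule homotopicE)
  note m = adel_MorD[OF f]
  let ?i1 = "val (inj1 C (mid C Y) (corel C X))" and ?i2 = "val (inj2 C (mid C Y) (corel C X))"
  fix s1 s2 assume *: "ok s1" "dm s1 = mid C Y" "cd s1 = rel C S" "ok s2" "dm s2 = corel C Y"
    "cd s2 = mid C S" "?i1 \<odot> x = ?i1 \<odot> y \<oplus> (s1 \<odot> val (fst S) \<oplus> val (snd Y) \<odot> s2)"
  \<comment> \<open>the difference of the second components, absorbed by the identity block\<close>
  define d where "d = ?i2 \<odot> x \<oplus> \<ominus> (?i2 \<odot> y)"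
  have d: "ok d" "dm d = corel C X" "cd d = mid C S" using m x y S by (simp_all add: d_def)
  have xd: "?i2 \<odot> x = ?i2 \<odot> y \<oplus> d" unfolding d_def using m x y S by simp
  let ?s1 = "val (proj1 C (mid C Y) (corel C X)) \<odot> s1"
  let ?s2 = "val (proj1 C (corel C Y) (corel C X)) \<odot> s2 \<oplus> val (proj2 C (corel C Y) (corel C X)) \<odot> d"
  have e: "val (snd (cokernel_obj (X, \<alpha>, Y))) \<odot> ?s2 =
    val (proj1 C (mid C Y) (corel C X)) \<odot> (val (snd Y) \<odot> s2) \<oplus> val (proj2 C (mid C Y) (corel C X)) \<odot> d"
    using m * d S by (simp add: vring)
  have "x = y \<oplus> (?s1 \<odot> val (fst S) \<oplus> val (snd (cokernel_obj (X, \<alpha>, Y))) \<odot> ?s2)"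
    unfolding e
    by (rule eq_from_dsum[of _ _ "mid C Y" "corel C X"]) (use m x y * S d in \<open>simp_all add: vring xd\<close>)
  then show ?thesis by (intro homotopicI[of ?s1 _ _ ?s2]) (use m x y * S d in simp_all)
qed

end

section \<open>Decidable equality and the universal properties\<close>

locale homotopy_solver = additive_category C
  for C :: "('o::data, 'm::data, 'z) additive_data_scheme" (structure) +
  fixes solve :: "'m \<times> 'm \<times> 'm \<Rightarrow> ('m \<times> 'm) option"
  assumes solve_computable: "computable_on {(\<alpha>, \<beta>, \<gamma>). \<alpha> \<in> Mor C \<and> \<beta> \<in> Mor C \<and> \<gamma> \<in> Mor C \<and>
        tgt C \<beta> = tgt C \<alpha> \<and> src C \<gamma> = src C \<alpha>} solve"
    and solve_correct: "\<alpha> \<in> Hom C a b \<Longrightarrow> \<beta> \<in> Hom C d b \<Longrightarrow> \<gamma> \<in> Hom C a c \<Longrightarrow>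
        (case solve (\<alpha>, \<beta>, \<gamma>) of
          Some (\<sigma>1, \<sigma>2) \<Rightarrow> \<sigma>1 \<in> Hom C a d \<and> \<sigma>2 \<in> Hom C c b \<and> \<alpha> \<approx> \<sigma>1 \<cdot> \<beta> \<boxplus> \<gamma> \<cdot> \<sigma>2
        | None \<Rightarrow> \<not> (\<exists>\<sigma>1\<in>Hom C a d. \<exists>\<sigma>2\<in>Hom C c b. \<alpha> \<approx> \<sigma>1 \<cdot> \<beta> \<boxplus> \<gamma> \<cdot> \<sigma>2))"
begin

lemma computable_on_solve:
  assumes "computable_on D f" "computable_on D g" "computable_on D h"
    "\<And>x. x \<in> D \<Longrightarrow> f x \<in> Mor C \<and> g x \<in> Mor C \<and> h x \<in> Mor C \<and> tgt C (g x) = tgt C (f x) \<and> src C (h x) = src C (f x)"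
  shows "computable_on D (\<lambda>x. solve (f x, g x, h x))"
  using computable_on_compose[OF solve_computable
      computable_on_Pair[OF assms(1) computable_on_Pair[OF assms(2,3)]]] assms(4) by simp

lemma solve_eq_None:
  assumes "X \<in> adel_Obj C" "Y \<in> adel_Obj C" "\<alpha> \<in> Mor C" "src C \<alpha> = mid C X" "tgt C \<alpha> = mid C Y"
    and "solve (\<alpha>, fst Y, snd X) = None"
    and "ok s1" "dm s1 = mid C X" "cd s1 = rel C Y" "ok s2" "dm s2 = corel C X" "cd s2 = mid C Y"
  shows "val \<alpha> \<noteq> s1 \<odot> val (fst Y) \<oplus> val (snd X) \<odot> s2"
proof
  assume *: "val \<alpha> = s1 \<odot> val (fst Y) \<oplus> val (snd X) \<odot> s2"
  have "s1 \<in> vHom (mid C X) (rel C Y)" "s2 \<in> vHom (corel C X) (mid C Y)" using assms by simp_all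
  then obtain \<sigma>1 \<sigma>2 where s: "\<sigma>1 \<in> Hom C (mid C X) (rel C Y)" "s1 = val \<sigma>1"
    "\<sigma>2 \<in> Hom C (corel C X) (mid C Y)" "s2 = val \<sigma>2" unfolding vHom_eq by blast
  then have "\<alpha> \<approx> \<sigma>1 \<cdot> fst Y \<boxplus> snd X \<cdot> \<sigma>2" using * assms by (simp add: Hom_iff)
  moreover have "\<alpha> \<in> Hom C (mid C X) (mid C Y)" "fst Y \<in> Hom C (rel C Y) (mid C Y)"
    "snd X \<in> Hom C (mid C X) (corel C X)" using assms by (simp_all add: Hom_iff)
  note solve_correct[OF this, unfolded assms(6) option.case]
  ultimately show False using s by blast
qed

lemma solve_eq_Some:
  assumes "X \<in> adel_Obj C" "Y \<in> adel_Obj C" "\<alpha> \<in> Mor C" "src C \<alpha> = mid C X" "tgt C \<alpha> = mid C Y"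
    and "solve (\<alpha>, fst Y, snd X) = Some (\<sigma>1, \<sigma>2)"
  shows "\<sigma>1 \<in> Mor C" "src C \<sigma>1 = mid C X" "tgt C \<sigma>1 = rel C Y"
    "\<sigma>2 \<in> Mor C" "src C \<sigma>2 = corel C X" "tgt C \<sigma>2 = mid C Y"
    "val \<alpha> = val \<sigma>1 \<odot> val (fst Y) \<oplus> val (snd X) \<odot> val \<sigma>2"
  using solve_correct[of \<alpha> "mid C X" "mid C Y" "fst Y" "rel C Y" "snd X" "corel C X"] assms
  by (auto simp: Hom_iff)

text \<open>
  The null homotopy found by the solver for a zero morphism of the Adelman category.
\<close>

definition htpy :: "'m adel_mor \<Rightarrow> 'm \<times> 'm" where
  "htpy = (\<lambda>(X, \<alpha>, Y). the (solve (\<alpha>, fst Y, snd X)))"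

lemma null_homotopy:
  assumes "(X, \<alpha>, Y) \<in> adel_Mor C" "is_zero (Adel C) (X, \<alpha>, Y)"
  obtains \<sigma>1 \<sigma>2 where "solve (\<alpha>, fst Y, snd X) \<noteq> None" "htpy (X, \<alpha>, Y) = (\<sigma>1, \<sigma>2)"
    "\<sigma>1 \<in> Mor C" "src C \<sigma>1 = mid C X" "tgt C \<sigma>1 = rel C Y"
    "\<sigma>2 \<in> Mor C" "src C \<sigma>2 = corel C X" "tgt C \<sigma>2 = mid C Y"
    "val \<alpha> = val \<sigma>1 \<odot> val (fst Y) \<oplus> val (snd X) \<odot> val \<sigma>2"
proof -
  note m = adel_MorD[OF assms(1)]
  have "solve (\<alpha>, fst Y, snd X) \<noteq> None"
    using is_zero_AdelE[OF assms] solve_eq_None[OF m] by metis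
  then obtain \<sigma>1 \<sigma>2 where *: "solve (\<alpha>, fst Y, snd X) = Some (\<sigma>1, \<sigma>2)" by auto
  then have "solve (\<alpha>, fst Y, snd X) \<noteq> None" "htpy (X, \<alpha>, Y) = (\<sigma>1, \<sigma>2)" by (simp_all add: htpy_def)
  from that[OF this solve_eq_Some[OF m *]] show thesis .
qed

lemma htpy_Mor [simp]:
  assumes "f \<in> adel_Mor C" "is_zero (Adel C) f"
  shows "fst (htpy f) \<in> Mor C" "src C (fst (htpy f)) = mid C (fst f)"
    "tgt C (fst (htpy f)) = rel C (snd (snd f))" "snd (htpy f) \<in> Mor C"
    "src C (snd (htpy f)) = corel C (fst f)" "tgt C (snd (htpy f)) = mid C (snd (snd f))"
proof -
  obtain X \<alpha> Y where f: "f = (X, \<alpha>, Y)" by (cases f)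
  from null_homotopy[OF assms[unfolded f]] obtain \<sigma>1 \<sigma>2 where "htpy (X, \<alpha>, Y) = (\<sigma>1, \<sigma>2)"
    "\<sigma>1 \<in> Mor C" "src C \<sigma>1 = mid C X" "tgt C \<sigma>1 = rel C Y"
    "\<sigma>2 \<in> Mor C" "src C \<sigma>2 = corel C X" "tgt C \<sigma>2 = mid C Y" .
  then show "fst (htpy f) \<in> Mor C" "src C (fst (htpy f)) = mid C (fst f)"
    "tgt C (fst (htpy f)) = rel C (snd (snd f))" "snd (htpy f) \<in> Mor C"
    "src C (snd (htpy f)) = corel C (fst f)" "tgt C (snd (htpy f)) = mid C (snd (snd f))"
    unfolding f by simp_all
qed

lemma computable_on_htpy:
  assumes "computable_on D F" "\<And>x. x \<in> D \<Longrightarrow> F x \<in> adel_Mor C \<and> is_zero (Adel C) (F x)"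
  shows "computable_on D (\<lambda>x. htpy (F x))"
  unfolding htpy_def case_prod_beta
proof (intro computable_on_the computable_on_solve computable_intros assms(1))
  fix x assume "x \<in> D"
  then show "solve (fst (snd (F x)), fst (snd (snd (F x))), snd (fst (F x))) \<noteq> None"
    using null_homotopy[of "fst (F x)" "fst (snd (F x))" "snd (snd (F x))"] assms(2)[of x]
    unfolding prod.collapse by blast
qed (use assms(2) in simp_all)

text \<open>
  Two parallel morphisms are equal iff the homotopy equation for their difference is solvable.
\<close>

lemma decidable_equality_Adel: "decidable_equality (Adel C)"
  unfolding decidable_equality_def
proof (rule computable_on_cong)
  let ?D = "{(f, g). f \<in> Mor (Adel C) \<and> g \<in> Mor (Adel C) \<and> src (Adel C) f = src (Adel C) g \<and>
    tgt (Adel C) f = tgt (Adel C) g}"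
  let ?s = "\<lambda>p. solve (fst (snd (fst p)) \<boxplus> neg C (fst (snd (snd p))), fst (snd (snd (fst p))), snd (fst (fst p)))"
  show "computable_on ?D (\<lambda>p. ?s p \<noteq> None)"
    by (intro computable_on_is_Some computable_on_solve computable_intros) (simp_all add: case_prod_beta)
  fix p assume "p \<in> ?D"
  then obtain X \<alpha> Y \<beta> where p: "p = ((X, \<alpha>, Y), (X, \<beta>, Y))" "(X, \<alpha>, Y) \<in> adel_Mor C" "(X, \<beta>, Y) \<in> adel_Mor C"
    by (cases p) auto
  let ?\<delta> = "\<alpha> \<boxplus> neg C \<beta>"
  have d: "?\<delta> \<in> Mor C" "src C ?\<delta> = mid C X" "tgt C ?\<delta> = mid C Y"
    and m: "X \<in> adel_Obj C" "Y \<in> adel_Obj C" "\<alpha> \<in> Mor C" "src C \<alpha> = mid C X" "tgt C \<alpha> = mid C Y"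
     "\<beta> \<in> Mor C" "src C \<beta> = mid C X" "tgt C \<beta> = mid C Y"
    using adel_MorD[OF p(2)] adel_MorD[OF p(3)] by simp_all
  have "adel_eqv C (X, \<alpha>, Y) (X, \<beta>, Y) \<longleftrightarrow> solve (?\<delta>, fst Y, snd X) \<noteq> None"
  proof
    assume "adel_eqv C (X, \<alpha>, Y) (X, \<beta>, Y)"
    then have "homotopic X Y (val \<alpha>) (val \<beta>)" using p by (simp add: adel_eqv_iff)
    then show "solve (?\<delta>, fst Y, snd X) \<noteq> None"
    proof (rule homotopicE)
      fix s1 s2 assume *: "ok s1" "dm s1 = mid C X" "cd s1 = rel C Y" "ok s2" "dm s2 = corel C X"
        "cd s2 = mid C Y" "val \<alpha> = val \<beta> \<oplus> (s1 \<odot> val (fst Y) \<oplus> val (snd X) \<odot> s2)"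
      then have "val ?\<delta> = s1 \<odot> val (fst Y) \<oplus> val (snd X) \<odot> s2" using m by (simp add: vminus_eq_iff)
      with solve_eq_None[OF m(1,2) d _ *(1-6)] show ?thesis by blast
    qed
  next
    assume "solve (?\<delta>, fst Y, snd X) \<noteq> None"
    then obtain \<sigma>1 \<sigma>2 where "solve (?\<delta>, fst Y, snd X) = Some (\<sigma>1, \<sigma>2)" by auto
    note s = solve_eq_Some[OF m(1,2) d this]
    then have "homotopic X Y (val \<alpha>) (val \<beta>)" using m
      by (intro homotopicI[of "val \<sigma>1" _ _ "val \<sigma>2"]) (simp_all add: vminus_eq_iff)
    then show "adel_eqv C (X, \<alpha>, Y) (X, \<beta>, Y)" using p by (simp add: adel_eqv_iff)
  qed
  then show "(?s p \<noteq> None) = (case p of (f, g) \<Rightarrow> f \<approx>\<^bsub>Adel C\<^esub> g)" using p by simp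
qed

text \<open>
  With \<open>\<tau> \<cdot> \<alpha> = \<sigma>1 \<cdot> \<rho>Y + \<gamma>T \<cdot> \<sigma>2\<close>, the pair \<open>(\<tau>, -\<sigma>1)\<close> satisfies the equation defining the kernel object up to
  a multiple of \<open>\<gamma>T\<close>.
\<close>

definition kernel_lift :: "'m adel_mor \<times> 'm adel_mor \<Rightarrow> 'm adel_mor" where
  "kernel_lift = (\<lambda>((X, \<alpha>, Y), (T, \<tau>, X')).
    (T, into_dsum C \<tau> (neg C (fst (htpy (T, \<tau> \<cdot> \<alpha>, Y)))), kernel_obj (X, \<alpha>, Y)))"

definition cokernel_colift :: "'m adel_mor \<times> 'm adel_mor \<Rightarrow> 'm adel_mor" where
  "cokernel_colift = (\<lambda>((X, \<alpha>, Y), (Y', \<tau>, T)).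
    (cokernel_obj (X, \<alpha>, Y), from_dsum C \<tau> (neg C (snd (htpy (X, \<alpha> \<cdot> \<tau>, T)))), T))"

text \<open>
  Composing \<open>(\<tau>, -\<sigma>1)\<close> with the matrix \<open>\<gamma>\<close> of the kernel object gives \<open>(\<tau> \<cdot> \<gamma>X, \<tau> \<cdot> \<alpha> - \<sigma>1 \<cdot> \<rho>Y) = \<gamma>T \<cdot> (\<psi>, \<sigma>2)\<close>,
  where \<open>\<psi>\<close> is the side condition of \<open>\<tau>\<close>. Thus the lift is again a morphism, and its composite with the
  embedding is \<open>\<tau>\<close> on the nose.
\<close>

lemma kernel_lift_correct:
  assumes f: "(X, \<alpha>, Y) \<in> adel_Mor C" and t: "(T, \<tau>, X) \<in> adel_Mor C"
    and z: "is_zero (Adel C) (T, \<tau> \<cdot> \<alpha>, Y)"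
  obtains \<upsilon> where "kernel_lift ((X, \<alpha>, Y), (T, \<tau>, X)) = (T, \<upsilon>, kernel_obj (X, \<alpha>, Y))"
    "(T, \<upsilon>, kernel_obj (X, \<alpha>, Y)) \<in> adel_Mor C" "val \<upsilon> \<odot> val (proj1 C (mid C X) (rel C Y)) = val \<tau>"
proof -
  obtain \<sigma>1 \<sigma>2 where s: "htpy (T, \<tau> \<cdot> \<alpha>, Y) = (\<sigma>1, \<sigma>2)"
    "\<sigma>1 \<in> Mor C" "src C \<sigma>1 = mid C T" "tgt C \<sigma>1 = rel C Y"
    "\<sigma>2 \<in> Mor C" "src C \<sigma>2 = corel C T" "tgt C \<sigma>2 = mid C Y"
    "val (\<tau> \<cdot> \<alpha>) = val \<sigma>1 \<odot> val (fst Y) \<oplus> val (snd T) \<odot> val \<sigma>2"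
    by (rule null_homotopy[OF adel_cmp[OF t f] z])
  note m = adel_MorD[OF f]
  have ta: "val \<tau> \<odot> val \<alpha> = val \<sigma>1 \<odot> val (fst Y) \<oplus> val (snd T) \<odot> val \<sigma>2"
    using s(8) m adel_MorD[OF t] by simp
  have ta': "val \<tau> \<odot> (val \<alpha> \<odot> z) = (val \<sigma>1 \<odot> val (fst Y) \<oplus> val (snd T) \<odot> val \<sigma>2) \<odot> z" for z
    using ta by (metis vmul_assoc)
  let ?u = "into_dsum C \<tau> (neg C \<sigma>1)"
  from t have "(T, ?u, kernel_obj (X, \<alpha>, Y)) \<in> adel_Mor C"
  proof (rule adel_MorE)
    fix \<omega> \<psi> assume *: "T \<in> adel_Obj C" "X \<in> adel_Obj C" "\<tau> \<in> Mor C" "src C \<tau> = mid C T"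
      "tgt C \<tau> = mid C X" "ok \<omega>" "dm \<omega> = rel C T" "cd \<omega> = rel C X"
      "\<And>z. val (fst T) \<odot> (val \<tau> \<odot> z) = \<omega> \<odot> (val (fst X) \<odot> z)"
      "ok \<psi>" "dm \<psi> = corel C T" "cd \<psi> = corel C X"
      "\<And>z. val \<tau> \<odot> (val (snd X) \<odot> z) = val (snd T) \<odot> (\<psi> \<odot> z)"
    show ?thesis
      by (rule adel_MorI[of _ _ _ "\<omega> \<odot> val (inj1 C (rel C X) (rel C Y)) \<oplus>
            \<ominus> (val (fst T) \<odot> val \<sigma>1) \<odot> val (inj2 C (rel C X) (rel C Y))"
            "\<psi> \<odot> val (inj1 C (corel C X) (mid C Y)) \<oplus> val \<sigma>2 \<odot> val (inj2 C (corel C X) (mid C Y))"])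
         (use m * s(2-7) in \<open>simp_all add: vring ta'\<close>)
  qed
  moreover have "val ?u \<odot> val (proj1 C (mid C X) (rel C Y)) = val \<tau>"
    using s m adel_MorD[OF t] by (simp add: vring)
  ultimately show thesis using that s(1) by (simp add: kernel_lift_def)
qed

text \<open>
  Dual to \<open>kernel_lift_correct\<close>: the composite of the matrix \<open>\<rho>\<close> of the cokernel object with the column
  \<open>(\<tau>, -\<sigma>2)\<close> is \<open>(\<omega>, \<sigma>1) \<cdot> \<rho>T\<close>.
\<close>

lemma cokernel_colift_correct:
  assumes f: "(X, \<alpha>, Y) \<in> adel_Mor C" and t: "(Y, \<tau>, T) \<in> adel_Mor C"
    and z: "is_zero (Adel C) (X, \<alpha> \<cdot> \<tau>, T)"
  obtains \<upsilon> where "cokernel_colift ((X, \<alpha>, Y), (Y, \<tau>, T)) = (cokernel_obj (X, \<alpha>, Y), \<upsilon>, T)"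
    "(cokernel_obj (X, \<alpha>, Y), \<upsilon>, T) \<in> adel_Mor C" "val (inj1 C (mid C Y) (corel C X)) \<odot> val \<upsilon> = val \<tau>"
proof -
  obtain \<sigma>1 \<sigma>2 where s: "htpy (X, \<alpha> \<cdot> \<tau>, T) = (\<sigma>1, \<sigma>2)"
    "\<sigma>1 \<in> Mor C" "src C \<sigma>1 = mid C X" "tgt C \<sigma>1 = rel C T"
    "\<sigma>2 \<in> Mor C" "src C \<sigma>2 = corel C X" "tgt C \<sigma>2 = mid C T"
    "val (\<alpha> \<cdot> \<tau>) = val \<sigma>1 \<odot> val (fst T) \<oplus> val (snd X) \<odot> val \<sigma>2"
    by (rule null_homotopy[OF adel_cmp[OF f t] z])
  note m = adel_MorD[OF f]
  have at: "val \<alpha> \<odot> val \<tau> = val \<sigma>1 \<odot> val (fst T) \<oplus> val (snd X) \<odot> val \<sigma>2"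
    using s(8) m adel_MorD[OF t] by simp
  let ?u = "from_dsum C \<tau> (neg C \<sigma>2)"
  from t have "(cokernel_obj (X, \<alpha>, Y), ?u, T) \<in> adel_Mor C"
  proof (rule adel_MorE)
    fix \<omega> \<psi> assume *: "Y \<in> adel_Obj C" "T \<in> adel_Obj C" "\<tau> \<in> Mor C" "src C \<tau> = mid C Y"
      "tgt C \<tau> = mid C T" "ok \<omega>" "dm \<omega> = rel C Y" "cd \<omega> = rel C T"
      "val (fst Y) \<odot> val \<tau> = \<omega> \<odot> val (fst T)"
      "ok \<psi>" "dm \<psi> = corel C Y" "cd \<psi> = corel C T"
      "val \<tau> \<odot> val (snd T) = val (snd Y) \<odot> \<psi>"
    show ?thesis
      by (rule adel_MorI[of _ _ _ "val (proj1 C (rel C Y) (mid C X)) \<odot> \<omega> \<oplus> val (proj2 C (rel C Y) (mid C X)) \<odot> val \<sigma>1"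
            "val (proj1 C (corel C Y) (corel C X)) \<odot> \<psi> \<oplus>
            \<ominus> (val (proj2 C (corel C Y) (corel C X)) \<odot> (val \<sigma>2 \<odot> val (snd T)))"])
         (use m * s(2-7) in \<open>simp_all add: vring at\<close>)
  qed
  moreover have "val (inj1 C (mid C Y) (corel C X)) \<odot> val ?u = val \<tau>"
    using s m adel_MorD[OF t] by (simp add: vring)
  ultimately show thesis using that s(1) by (simp add: cokernel_colift_def)
qed

text \<open>
  The next facts speak of components of a morphism instead of matching a triple. In this form they apply
  to the arguments of an algorithm, which are projections of its input.
\<close>

lemma adel_cmp_sel:
  "f \<in> adel_Mor C \<Longrightarrow> g \<in> adel_Mor C \<Longrightarrow> snd (snd f) = fst g \<Longrightarrow>
    (fst f, fst (snd f) \<cdot> fst (snd g), snd (snd g)) \<in> adel_Mor C"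
  by (cases f, cases g) (auto intro: adel_cmp)

lemma kernel_cokernel_obj_sel:
  assumes "f \<in> adel_Mor C"
  shows "mid C (kernel_obj f) = dsum C (mid C (fst f)) (rel C (snd (snd f)))"
    "corel C (kernel_obj f) = dsum C (corel C (fst f)) (mid C (snd (snd f)))"
    "rel C (cokernel_obj f) = dsum C (rel C (snd (snd f))) (mid C (fst f))"
    "mid C (cokernel_obj f) = dsum C (mid C (snd (snd f))) (corel C (fst f))"
  using assms by (auto elim!: adel_Mor_cases simp del: adel_Mor_sel)

lemma kernel_emb_sel:
  assumes "f \<in> adel_Mor C"
  shows "kernel_emb f \<in> adel_Mor C" "fst (kernel_emb f) = kernel_obj f"
    "snd (snd (kernel_emb f)) = fst f" "fst (snd (kernel_emb f)) = proj1 C (mid C (fst f)) (rel C (snd (snd f)))"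
  using assms kernel_emb_Mor by (cases f; simp add: kernel_emb_def)+

lemma cokernel_proj_sel:
  assumes "f \<in> adel_Mor C"
  shows "cokernel_proj f \<in> adel_Mor C" "snd (snd (cokernel_proj f)) = cokernel_obj f"
    "fst (cokernel_proj f) = snd (snd f)" "fst (snd (cokernel_proj f)) = inj1 C (mid C (snd (snd f))) (corel C (fst f))"
  using assms cokernel_proj_Mor by (cases f; simp add: cokernel_proj_def)+

lemma computable_on_kernel_cokernel_obj:
  assumes "computable_on D F" "\<And>x. x \<in> D \<Longrightarrow> F x \<in> adel_Mor C"
  shows "computable_on D (\<lambda>x. kernel_obj (F x))" "computable_on D (\<lambda>x. cokernel_obj (F x))"
  unfolding kernel_obj_def cokernel_obj_def case_prod_beta
  by (intro computable_intros computable_on_adel assms(1); use assms(2) in simp)+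

lemma computable_on_kernel_cokernel_map:
  assumes "computable_on D F" "\<And>x. x \<in> D \<Longrightarrow> F x \<in> adel_Mor C"
  shows "computable_on D (\<lambda>x. kernel_emb (F x))" "computable_on D (\<lambda>x. cokernel_proj (F x))"
  unfolding kernel_emb_def cokernel_proj_def case_prod_beta prod.collapse
  by (intro computable_intros computable_on_adel computable_on_kernel_cokernel_obj assms(1); use assms(2) in simp)+

lemma kernel_algorithms_Adel:
  "kernel_algorithms (Adel C) kernel_obj kernel_emb kernel_lift"
  unfolding kernel_algorithms_def
proof (intro conjI ballI allI impI)
  let ?D = "{(f, t). f \<in> Mor (Adel C) \<and> t \<in> Mor (Adel C) \<and> tgt (Adel C) t = src (Adel C) f \<and>
    is_zero (Adel C) (t \<cdot>\<^bsub>Adel C\<^esub> f)}"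
  show "computable_on (Mor (Adel C)) kernel_obj" "computable_on (Mor (Adel C)) kernel_emb"
    using computable_on_kernel_cokernel_obj(1)[OF computable_on_id] computable_on_kernel_cokernel_map(1)[OF computable_on_id]
    by simp_all
  show "computable_on ?D kernel_lift"
    unfolding kernel_lift_def case_prod_beta prod.collapse
    by (intro computable_intros computable_on_htpy computable_on_kernel_cokernel_obj)
       (simp_all add: case_prod_beta adel_cmp_sel)
  fix f assume "f \<in> Mor (Adel C)"
  then obtain X \<alpha> Y where f: "f = (X, \<alpha>, Y)" "(X, \<alpha>, Y) \<in> adel_Mor C" by (cases f) auto
  note k = kernel_emb_Mor[OF f(2)] and m = adel_MorD[OF f(2)]
  show "kernel_obj f \<in> Obj (Adel C)" using f by simp
  show "kernel_emb f \<in> Hom (Adel C) (kernel_obj f) (src (Adel C) f)"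
    using f k by (simp add: kernel_emb_def Hom_Adel)
  show "is_zero (Adel C) (kernel_emb f \<cdot>\<^bsub>Adel C\<^esub> f)"
    using f kernel_emb_zero[OF f(2)] by (simp add: kernel_emb_def)
  fix T t assume "t \<in> Hom (Adel C) T (src (Adel C) f)" and z: "is_zero (Adel C) (t \<cdot>\<^bsub>Adel C\<^esub> f)"
  then obtain \<tau> where t: "t = (T, \<tau>, X)" "(T, \<tau>, X) \<in> adel_Mor C" using f by (auto simp: Hom_Adel)
  from z f t have "is_zero (Adel C) (T, \<tau> \<cdot> \<alpha>, Y)" by simp
  from kernel_lift_correct[OF f(2) t(2) this] obtain \<upsilon> where
    u: "kernel_lift ((X, \<alpha>, Y), (T, \<tau>, X)) = (T, \<upsilon>, kernel_obj (X, \<alpha>, Y))"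
    "(T, \<upsilon>, kernel_obj (X, \<alpha>, Y)) \<in> adel_Mor C" "val \<upsilon> \<odot> val (proj1 C (mid C X) (rel C Y)) = val \<tau>" .
  show "kernel_lift (f, t) \<in> Hom (Adel C) T (kernel_obj f)"
    using u f t by (simp add: Hom_Adel)
  show "kernel_lift (f, t) \<cdot>\<^bsub>Adel C\<^esub> kernel_emb f \<approx>\<^bsub>Adel C\<^esub> t"
    using u f t m adel_MorD[OF u(2)] adel_cmp[OF u(2) k] by (auto simp: kernel_emb_def intro!: adel_eqv_of_eqv)
  fix u' assume "u' \<in> Hom (Adel C) T (kernel_obj f)" and e: "u' \<cdot>\<^bsub>Adel C\<^esub> kernel_emb f \<approx>\<^bsub>Adel C\<^esub> t"
  then obtain \<upsilon>' where u': "u' = (T, \<upsilon>', kernel_obj (X, \<alpha>, Y))" "(T, \<upsilon>', kernel_obj (X, \<alpha>, Y)) \<in> adel_Mor C"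
    using f by (auto simp: Hom_Adel)
  note mm = adel_MorD[OF u(2)] adel_MorD[OF u'(2)]
  have "homotopic T X (val \<upsilon>' \<odot> val (proj1 C (mid C X) (rel C Y))) (val \<upsilon> \<odot> val (proj1 C (mid C X) (rel C Y)))"
    using e f t u u' m mm adel_cmp[OF u'(2) k] by (simp add: kernel_emb_def adel_eqv_iff)
  then have "homotopic T (kernel_obj (X, \<alpha>, Y)) (val \<upsilon>') (val \<upsilon>)"
    by (rule kernel_emb_cancel[OF f(2), rotated -1]) (use m mm in simp_all)
  then show "u' \<approx>\<^bsub>Adel C\<^esub> kernel_lift (f, t)" using u u' f t by (simp add: adel_eqv_iff)
qed

lemma cokernel_algorithms_Adel:
  "cokernel_algorithms (Adel C) cokernel_obj cokernel_proj cokernel_colift"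
  unfolding cokernel_algorithms_def
proof (intro conjI ballI allI impI)
  let ?D = "{(f, t). f \<in> Mor (Adel C) \<and> t \<in> Mor (Adel C) \<and> src (Adel C) t = tgt (Adel C) f \<and>
    is_zero (Adel C) (f \<cdot>\<^bsub>Adel C\<^esub> t)}"
  show "computable_on (Mor (Adel C)) cokernel_obj" "computable_on (Mor (Adel C)) cokernel_proj"
    using computable_on_kernel_cokernel_obj(2)[OF computable_on_id] computable_on_kernel_cokernel_map(2)[OF computable_on_id]
    by simp_all
  show "computable_on ?D cokernel_colift"
    unfolding cokernel_colift_def case_prod_beta prod.collapse
    by (intro computable_intros computable_on_htpy computable_on_kernel_cokernel_obj)
       (simp_all add: case_prod_beta adel_cmp_sel)
  fix f assume "f \<in> Mor (Adel C)"
  then obtain X \<alpha> Y where f: "f = (X, \<alpha>, Y)" "(X, \<alpha>, Y) \<in> adel_Mor C" by (cases f) auto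
  note k = cokernel_proj_Mor[OF f(2)] and m = adel_MorD[OF f(2)]
  show "cokernel_obj f \<in> Obj (Adel C)" using f by simp
  show "cokernel_proj f \<in> Hom (Adel C) (tgt (Adel C) f) (cokernel_obj f)"
    using f k by (simp add: cokernel_proj_def Hom_Adel)
  show "is_zero (Adel C) (f \<cdot>\<^bsub>Adel C\<^esub> cokernel_proj f)"
    using f cokernel_proj_zero[OF f(2)] by (simp add: cokernel_proj_def)
  fix T t assume "t \<in> Hom (Adel C) (tgt (Adel C) f) T" and z: "is_zero (Adel C) (f \<cdot>\<^bsub>Adel C\<^esub> t)"
  then obtain \<tau> where t: "t = (Y, \<tau>, T)" "(Y, \<tau>, T) \<in> adel_Mor C" using f by (auto simp: Hom_Adel)
  from z f t have "is_zero (Adel C) (X, \<alpha> \<cdot> \<tau>, T)" by simp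
  from cokernel_colift_correct[OF f(2) t(2) this] obtain \<upsilon> where
    u: "cokernel_colift ((X, \<alpha>, Y), (Y, \<tau>, T)) = (cokernel_obj (X, \<alpha>, Y), \<upsilon>, T)"
    "(cokernel_obj (X, \<alpha>, Y), \<upsilon>, T) \<in> adel_Mor C" "val (inj1 C (mid C Y) (corel C X)) \<odot> val \<upsilon> = val \<tau>" .
  show "cokernel_colift (f, t) \<in> Hom (Adel C) (cokernel_obj f) T"
    using u f t by (simp add: Hom_Adel)
  show "cokernel_proj f \<cdot>\<^bsub>Adel C\<^esub> cokernel_colift (f, t) \<approx>\<^bsub>Adel C\<^esub> t"
    using u f t m adel_MorD[OF u(2)] adel_cmp[OF k u(2)] by (auto simp: cokernel_proj_def intro!: adel_eqv_of_eqv)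
  fix u' assume "u' \<in> Hom (Adel C) (cokernel_obj f) T" and e: "cokernel_proj f \<cdot>\<^bsub>Adel C\<^esub> u' \<approx>\<^bsub>Adel C\<^esub> t"
  then obtain \<upsilon>' where u': "u' = (cokernel_obj (X, \<alpha>, Y), \<upsilon>', T)" "(cokernel_obj (X, \<alpha>, Y), \<upsilon>', T) \<in> adel_Mor C"
    using f by (auto simp: Hom_Adel)
  note mm = adel_MorD[OF u(2)] adel_MorD[OF u'(2)]
  have "homotopic Y T (val (inj1 C (mid C Y) (corel C X)) \<odot> val \<upsilon>') (val (inj1 C (mid C Y) (corel C X)) \<odot> val \<upsilon>)"
    using e f t u u' m mm adel_cmp[OF k u'(2)] by (simp add: cokernel_proj_def adel_eqv_iff)
  then have "homotopic (cokernel_obj (X, \<alpha>, Y)) T (val \<upsilon>') (val \<upsilon>)"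
    by (rule cokernel_proj_cancel[OF f(2), rotated -1]) (use m mm in simp_all)
  then show "u' \<approx>\<^bsub>Adel C\<^esub> cokernel_colift (f, t)" using u u' f t by (simp add: adel_eqv_iff)
qed

end

section \<open>Lifting along monomorphisms and colifting along epimorphisms\<close>

lemma is_mono_cancel:
  "is_mono C f \<Longrightarrow> u \<in> Hom C t (src C f) \<Longrightarrow> v \<in> Hom C t (src C f) \<Longrightarrow>
    u \<cdot>\<^bsub>C\<^esub> f \<approx>\<^bsub>C\<^esub> v \<cdot>\<^bsub>C\<^esub> f \<Longrightarrow> u \<approx>\<^bsub>C\<^esub> v"
  unfolding is_mono_def by blast

lemma is_epi_cancel:
  "is_epi C f \<Longrightarrow> u \<in> Hom C (tgt C f) t \<Longrightarrow> v \<in> Hom C (tgt C f) t \<Longrightarrow>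
    f \<cdot>\<^bsub>C\<^esub> u \<approx>\<^bsub>C\<^esub> f \<cdot>\<^bsub>C\<^esub> v \<Longrightarrow> u \<approx>\<^bsub>C\<^esub> v"
  unfolding is_epi_def by blast

context homotopy_solver
begin

text \<open>
  The kernel embedding and the zero morphism have equal composites with \<open>f\<close>, namely zero.
\<close>

lemma mono_kernel_zero:
  assumes "is_mono (Adel C) f"
  shows "f \<in> adel_Mor C" "is_zero (Adel C) (kernel_emb f)"
proof -
  show "f \<in> adel_Mor C" using assms by (simp add: is_mono_def)
  then obtain X \<alpha> Y where f: "f = (X, \<alpha>, Y)" "(X, \<alpha>, Y) \<in> adel_Mor C" by (cases f) auto
  let ?K = "kernel_obj (X, \<alpha>, Y)"
  note m = adel_MorD[OF f(2)] and k = kernel_emb_Mor[OF f(2)]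
  note z = adel_zero_mor[OF kernel_obj_simps(1)[OF m] m(1)]
  have "homotopic ?K Y (val (proj1 C (mid C X) (rel C Y)) \<odot> val \<alpha>) (vzero (mid C ?K) (mid C Y))"
    using kernel_emb_zero[OF f(2)] m adel_cmp[OF k f(2)] adel_zero_mor[OF kernel_obj_simps(1)[OF m] m(2)]
    by (simp add: is_zero_def adel_eqv_iff)
  then have "adel_eqv C (?K, proj1 C (mid C X) (rel C Y) \<cdot> \<alpha>, Y)
      (?K, zero_mor C (mid C ?K) (mid C X) \<cdot> \<alpha>, Y)"
    using m adel_cmp[OF k f(2)] adel_cmp[OF z f(2)] by (simp add: adel_eqv_iff)
  then have "adel_eqv C (?K, proj1 C (mid C X) (rel C Y), X) (?K, zero_mor C (mid C ?K) (mid C X), X)"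
    using f k z is_mono_cancel[OF assms, of "(?K, proj1 C (mid C X) (rel C Y), X)" ?K
        "(?K, zero_mor C (mid C ?K) (mid C X), X)"] by (simp add: Hom_Adel)
  then show "is_zero (Adel C) (kernel_emb f)" using f by (simp add: is_zero_def kernel_emb_def)
qed

lemma epi_cokernel_zero:
  assumes "is_epi (Adel C) f"
  shows "f \<in> adel_Mor C" "is_zero (Adel C) (cokernel_proj f)"
proof -
  show "f \<in> adel_Mor C" using assms by (simp add: is_epi_def)
  then obtain X \<alpha> Y where f: "f = (X, \<alpha>, Y)" "(X, \<alpha>, Y) \<in> adel_Mor C" by (cases f) auto
  let ?Q = "cokernel_obj (X, \<alpha>, Y)"
  note m = adel_MorD[OF f(2)] and k = cokernel_proj_Mor[OF f(2)]
  note z = adel_zero_mor[OF m(2) cokernel_obj_simps(1)[OF m]]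
  have "homotopic X ?Q (val \<alpha> \<odot> val (inj1 C (mid C Y) (corel C X))) (vzero (mid C X) (mid C ?Q))"
    using cokernel_proj_zero[OF f(2)] m adel_cmp[OF f(2) k] adel_zero_mor[OF m(1) cokernel_obj_simps(1)[OF m]]
    by (simp add: is_zero_def adel_eqv_iff)
  then have "adel_eqv C (X, \<alpha> \<cdot> inj1 C (mid C Y) (corel C X), ?Q)
      (X, \<alpha> \<cdot> zero_mor C (mid C Y) (mid C ?Q), ?Q)"
    using m adel_cmp[OF f(2) k] adel_cmp[OF f(2) z] by (simp add: adel_eqv_iff)
  then have "adel_eqv C (Y, inj1 C (mid C Y) (corel C X), ?Q) (Y, zero_mor C (mid C Y) (mid C ?Q), ?Q)"
    using f k z is_epi_cancel[OF assms, of "(Y, inj1 C (mid C Y) (corel C X), ?Q)" ?Q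
        "(Y, zero_mor C (mid C Y) (mid C ?Q), ?Q)"] by (simp add: Hom_Adel)
  then show "is_zero (Adel C) (cokernel_proj f)" using f by (simp add: is_zero_def cokernel_proj_def)
qed

text \<open>
  The morphism \<open>s2 + \<gamma>T \<cdot> (s3 \<cdot> y + s4 \<cdot> x)\<close>, where \<open>s1\<close> to \<open>s4\<close> are the blocks of the null homotopy of \<open>\<tau>\<close>
  followed by the cokernel projection, and \<open>x\<close>, \<open>y\<close> are blocks of that of the kernel embedding. The source
  of \<open>from_dsum\<close> lists \<open>mid A\<close> before \<open>corel K\<close>, hence the exchanged injections.
\<close>

definition mono_lift :: "'m adel_mor \<times> 'm adel_mor \<Rightarrow> 'm adel_mor" where
  "mono_lift = (\<lambda>((K, \<iota>, A), (T, \<tau>, A')).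
    (T, fst (htpy (T, \<tau> \<cdot> inj1 C (mid C A) (corel C K), cokernel_obj (K, \<iota>, A))) \<cdot> proj2 C (rel C A) (mid C K) \<boxplus>
        snd T \<cdot> (snd (htpy (T, \<tau> \<cdot> inj1 C (mid C A) (corel C K), cokernel_obj (K, \<iota>, A))) \<cdot>
          from_dsum C (inj2 C (corel C K) (mid C A) \<cdot> snd (htpy (kernel_emb (K, \<iota>, A))))
                      (inj1 C (corel C K) (mid C A) \<cdot> snd (htpy (kernel_emb (K, \<iota>, A))))), K))"

text \<open>
  Dual to \<open>mono_lift\<close>: the morphism \<open>t2 + (y \<cdot> t1 + z \<cdot> t4) \<cdot> \<rho>T\<close>.
\<close>

definition epi_colift :: "'m adel_mor \<times> 'm adel_mor \<Rightarrow> 'm adel_mor" where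
  "epi_colift = (\<lambda>((A, \<epsilon>, Q), (A', \<tau>, T)).
    (Q, inj2 C (corel C A) (mid C Q) \<cdot> snd (htpy (kernel_obj (A, \<epsilon>, Q), proj1 C (mid C A) (rel C Q) \<cdot> \<tau>, T)) \<boxplus>
        into_dsum C (fst (htpy (cokernel_proj (A, \<epsilon>, Q))) \<cdot> proj2 C (rel C Q) (mid C A))
                    (fst (htpy (cokernel_proj (A, \<epsilon>, Q))) \<cdot> proj1 C (rel C Q) (mid C A)) \<cdot>
        fst (htpy (kernel_obj (A, \<epsilon>, Q), proj1 C (mid C A) (rel C Q) \<cdot> \<tau>, T)) \<cdot> fst T, T))"

text \<open>
  \<open>E1\<close> to \<open>E4\<close> are the blocks of the two null homotopies. The lift \<open>u\<close> has two descriptions: the one defining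
  it shows \<open>u \<cdot> \<gamma>K\<close> to be a multiple of \<open>\<gamma>T\<close> by \<open>E2\<close>, and \<open>u = \<tau> \<cdot> y + p \<cdot> \<rho>K\<close> shows \<open>fst T \<cdot> u\<close> to be a multiple
  of \<open>\<rho>K\<close> by \<open>E4\<close>. The second follows from the first by expanding \<open>s2\<close> along \<open>E3\<close> and \<open>\<tau>\<close>
  along \<open>E1\<close>.
\<close>

lemma mono_lift_correct:
  assumes i: "(K, \<iota>, A) \<in> adel_Mor C" and mono: "is_mono (Adel C) (K, \<iota>, A)"
    and t: "(T, \<tau>, A) \<in> adel_Mor C"
    and z: "is_zero (Adel C) (T, \<tau> \<cdot> inj1 C (mid C A) (corel C K), cokernel_obj (K, \<iota>, A))"
  obtains \<upsilon> where "mono_lift ((K, \<iota>, A), (T, \<tau>, A)) = (T, \<upsilon>, K)" "(T, \<upsilon>, K) \<in> adel_Mor C"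
    "homotopic T A (val \<upsilon> \<odot> val \<iota>) (val \<tau>)"
proof -
  note m = adel_MorD[OF i] and mt = adel_MorD[OF t]
  obtain \<sigma>1 \<sigma>2 where s: "htpy (T, \<tau> \<cdot> inj1 C (mid C A) (corel C K), cokernel_obj (K, \<iota>, A)) = (\<sigma>1, \<sigma>2)"
    "\<sigma>1 \<in> Mor C" "src C \<sigma>1 = mid C T" "tgt C \<sigma>1 = rel C (cokernel_obj (K, \<iota>, A))"
    "\<sigma>2 \<in> Mor C" "src C \<sigma>2 = corel C T" "tgt C \<sigma>2 = mid C (cokernel_obj (K, \<iota>, A))"
    "val (\<tau> \<cdot> inj1 C (mid C A) (corel C K)) =
      val \<sigma>1 \<odot> val (fst (cokernel_obj (K, \<iota>, A))) \<oplus> val (snd T) \<odot> val \<sigma>2"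
    by (rule null_homotopy[OF adel_cmp[OF t cokernel_proj_Mor[OF i]] z])
  have z': "is_zero (Adel C) (kernel_obj (K, \<iota>, A), proj1 C (mid C K) (rel C A), K)"
    using mono_kernel_zero(2)[OF mono] by (simp add: kernel_emb_def)
  obtain S1 S2 where S: "htpy (kernel_emb (K, \<iota>, A)) = (S1, S2)"
    "S1 \<in> Mor C" "src C S1 = mid C (kernel_obj (K, \<iota>, A))" "tgt C S1 = rel C K"
    "S2 \<in> Mor C" "src C S2 = corel C (kernel_obj (K, \<iota>, A))" "tgt C S2 = mid C K"
    "val (proj1 C (mid C K) (rel C A)) = val S1 \<odot> val (fst K) \<oplus> val (snd (kernel_obj (K, \<iota>, A))) \<odot> val S2"
    by (rule null_homotopy[OF kernel_emb_Mor[OF i] z']) (simp add: kernel_emb_def)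
  let ?\<rho>A = "val (fst A)" and ?\<rho>K = "val (fst K)" and ?\<gamma>K = "val (snd K)" and ?\<gamma>T = "val (snd T)"
    and ?i = "val \<iota>" and ?t = "val \<tau>"
  define s1 where "s1 = val \<sigma>1 \<odot> val (proj1 C (rel C A) (mid C K))"
  define s2 where "s2 = val \<sigma>1 \<odot> val (proj2 C (rel C A) (mid C K))"
  define s3 where "s3 = val \<sigma>2 \<odot> val (proj1 C (mid C A) (corel C K))"
  define s4 where "s4 = val \<sigma>2 \<odot> val (proj2 C (mid C A) (corel C K))"
  have ts: "ok s1" "dm s1 = mid C T" "cd s1 = rel C A" "ok s2" "dm s2 = mid C T" "cd s2 = mid C K"
    "ok s3" "dm s3 = corel C T" "cd s3 = mid C A" "ok s4" "dm s4 = corel C T" "cd s4 = corel C K"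
    unfolding s1_def s2_def s3_def s4_def using m s by simp_all
  have "?t \<odot> val (inj1 C (mid C A) (corel C K)) =
      val \<sigma>1 \<odot> val (fst (cokernel_obj (K, \<iota>, A))) \<oplus> ?\<gamma>T \<odot> val \<sigma>2" (is "?l = ?r")
    using s(8) m mt by simp
  then have 1: "?l \<odot> val (proj1 C (mid C A) (corel C K)) = ?r \<odot> val (proj1 C (mid C A) (corel C K))"
    and 2: "?l \<odot> val (proj2 C (mid C A) (corel C K)) = ?r \<odot> val (proj2 C (mid C A) (corel C K))"
    by simp_all
  \<comment> \<open>the two columns of the null homotopy of \<open>\<tau>\<close> followed by the cokernel projection\<close>
  have E1: "?t = s1 \<odot> ?\<rho>A \<oplus> (s2 \<odot> ?i \<oplus> ?\<gamma>T \<odot> s3)"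
    using 1 m mt s(2-7) unfolding s1_def s2_def s3_def by (simp add: vring)
  have E2: "vzero (mid C T) (corel C K) = s2 \<odot> ?\<gamma>K \<oplus> ?\<gamma>T \<odot> s4"
    using 2 m mt s(2-7) unfolding s2_def s4_def by (simp add: vring)
  \<comment> \<open>blocks of the null homotopy of the kernel embedding of \<open>\<iota>\<close>\<close>
  define r where "r = val (inj1 C (mid C K) (rel C A)) \<odot> val S1"
  define r' where "r' = val (inj2 C (mid C K) (rel C A)) \<odot> val S1"
  define x where "x = val (inj1 C (corel C K) (mid C A)) \<odot> val S2"
  define y where "y = val (inj2 C (corel C K) (mid C A)) \<odot> val S2"
  have tr: "ok r" "dm r = mid C K" "cd r = rel C K" "ok r'" "dm r' = rel C A" "cd r' = rel C K"
    "ok x" "dm x = corel C K" "cd x = mid C K" "ok y" "dm y = mid C A" "cd y = mid C K"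
    unfolding r_def r'_def x_def y_def using m S by simp_all
  have "val (inj1 C (mid C K) (rel C A)) \<odot> val (proj1 C (mid C K) (rel C A)) =
     val (inj1 C (mid C K) (rel C A)) \<odot> (val S1 \<odot> ?\<rho>K \<oplus> val (snd (kernel_obj (K, \<iota>, A))) \<odot> val S2)"
    using S(8) by simp
  then have E3: "vide (mid C K) = r \<odot> ?\<rho>K \<oplus> (?\<gamma>K \<odot> x \<oplus> ?i \<odot> y)"
    using m S(2-7) unfolding r_def x_def y_def by (simp add: vring)
  have "val (inj2 C (mid C K) (rel C A)) \<odot> val (proj1 C (mid C K) (rel C A)) =
     val (inj2 C (mid C K) (rel C A)) \<odot> (val S1 \<odot> ?\<rho>K \<oplus> val (snd (kernel_obj (K, \<iota>, A))) \<odot> val S2)"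
    using S(8) by simp
  then have E4: "vzero (rel C A) (mid C K) = r' \<odot> ?\<rho>K \<oplus> ?\<rho>A \<odot> y"
    using m S(2-7) unfolding r'_def y_def by (simp add: vring)
  have E2': "s2 \<odot> ?\<gamma>K = \<ominus> (?\<gamma>T \<odot> s4)"
    by (rule vneg_unique) (use E2 m mt ts in \<open>simp_all add: vadd_commute\<close>)
  have E4': "?\<rho>A \<odot> y = \<ominus> (r' \<odot> ?\<rho>K)"
    by (rule vneg_unique) (use E4 m mt tr in \<open>simp_all\<close>)
  define u where "u = s2 \<oplus> ?\<gamma>T \<odot> (s3 \<odot> y \<oplus> s4 \<odot> x)"
  have tu: "ok u" "dm u = mid C T" "cd u = mid C K" unfolding u_def using ts tr mt m by simp_all
  define p where "p = s2 \<odot> r \<oplus> s1 \<odot> r'"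
  have tp: "ok p" "dm p = mid C T" "cd p = rel C K" unfolding p_def using ts tr mt m by simp_all
  have u: "u = ?t \<odot> y \<oplus> p \<odot> ?\<rho>K"
  proof -
    \<comment> \<open>\<open>?Q\<close> cancels on the left, and \<open>?V\<close> is inserted with both signs to form \<open>p\<close>\<close>
    let ?P = "s2 \<odot> (r \<odot> ?\<rho>K)" and ?Q = "?\<gamma>T \<odot> (s4 \<odot> x)" and ?R = "s2 \<odot> (?i \<odot> y)"
      and ?W = "?\<gamma>T \<odot> (s3 \<odot> y)" and ?V = "s1 \<odot> (r' \<odot> ?\<rho>K)"
    have "s2 = s2 \<odot> vide (mid C K)" using ts by simp
    also have "\<dots> = ?P \<oplus> ((s2 \<odot> ?\<gamma>K) \<odot> x \<oplus> ?R)" unfolding E3 vmul_vadd_right vmul_assoc ..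
    also have "(s2 \<odot> ?\<gamma>K) \<odot> x = \<ominus> ?Q" unfolding E2' vneg_vmul_left vmul_assoc ..
    finally have "u = (?P \<oplus> (\<ominus> ?Q \<oplus> ?R)) \<oplus> (?W \<oplus> ?Q)"
      unfolding u_def vmul_vadd_right by (rule arg_cong2[where f = "(\<oplus>)", OF _ refl])
    also have "\<dots> = (?Q \<oplus> \<ominus> ?Q) \<oplus> (?P \<oplus> (?R \<oplus> ?W))"
      by (simp only: vadd_assoc vadd_commute vadd_left_commute)
    also have "\<dots> = (?V \<oplus> \<ominus> ?V) \<oplus> (?P \<oplus> (?R \<oplus> ?W))" using ts tr m mt by simp
    also have "\<dots> = (\<ominus> ?V \<oplus> (?R \<oplus> ?W)) \<oplus> (?P \<oplus> ?V)"
      by (simp only: vadd_assoc vadd_commute vadd_left_commute)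
    also have "\<ominus> ?V \<oplus> (?R \<oplus> ?W) = ?t \<odot> y"
      unfolding E1 vmul_vadd_left vmul_assoc E4' vneg_vmul_right ..
    also have "?P \<oplus> ?V = p \<odot> ?\<rho>K" unfolding p_def vmul_vadd_left vmul_assoc ..
    finally show ?thesis .
  qed
  let ?\<upsilon> = "\<sigma>1 \<cdot> proj2 C (rel C A) (mid C K) \<boxplus> snd T \<cdot> (\<sigma>2 \<cdot>
    from_dsum C (inj2 C (corel C K) (mid C A) \<cdot> S2) (inj1 C (corel C K) (mid C A) \<cdot> S2))"
  have \<upsilon>: "?\<upsilon> \<in> Mor C" "src C ?\<upsilon> = mid C T" "tgt C ?\<upsilon> = mid C K" using m mt s S by simp_all
  have val_\<upsilon>: "val ?\<upsilon> = u" unfolding u_def s2_def s3_def s4_def x_def y_def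
    using m mt s(2-7) S(2-7) by (simp add: vring)
  from t have "(T, ?\<upsilon>, K) \<in> adel_Mor C"
  proof (rule adel_MorE)
    fix \<omega> \<psi> assume w: "ok \<omega>" "dm \<omega> = rel C T" "cd \<omega> = rel C A"
      "\<And>z. val (fst T) \<odot> (val \<tau> \<odot> z) = \<omega> \<odot> (val (fst A) \<odot> z)"
    let ?w = "\<ominus> (\<omega> \<odot> r') \<oplus> val (fst T) \<odot> p"
    have 1: "val (fst T) \<odot> u = ?w \<odot> ?\<rho>K"
      unfolding u vmul_vadd_left vmul_vadd_right vmul_assoc w(4) E4' vneg_vmul_left vneg_vmul_right ..
    let ?p = "\<ominus> s4 \<oplus> (s3 \<odot> y \<oplus> s4 \<odot> x) \<odot> ?\<gamma>K"
    have 2: "u \<odot> ?\<gamma>K = ?\<gamma>T \<odot> ?p"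
      unfolding u_def vmul_vadd_left vmul_vadd_right vmul_assoc E2' vneg_vmul_right ..
    show ?thesis
      by (rule adel_MorI[OF mt(1) m(1) \<upsilon>, of ?w ?p, unfolded val_\<upsilon>, OF _ 1 _ 2]) (use w ts tr tp m mt in simp_all)
  qed
  moreover have "homotopic T A (val ?\<upsilon> \<odot> ?i) ?t"
  proof -
    let ?c = "\<ominus> s3 \<oplus> (s3 \<odot> y \<oplus> s4 \<odot> x) \<odot> ?i" and ?W = "?\<gamma>T \<odot> ((s3 \<odot> y \<oplus> s4 \<odot> x) \<odot> ?i)"
    let ?P = "s1 \<odot> ?\<rho>A" and ?Q = "?\<gamma>T \<odot> s3" and ?R = "s2 \<odot> ?i"
    have "?t \<oplus> ((\<ominus> s1) \<odot> ?\<rho>A \<oplus> ?\<gamma>T \<odot> ?c) = (?P \<oplus> (?R \<oplus> ?Q)) \<oplus> (\<ominus> ?P \<oplus> (\<ominus> ?Q \<oplus> ?W))"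
      unfolding E1 vneg_vmul_left vneg_vmul_right vmul_vadd_right ..
    also have "\<dots> = (?P \<oplus> \<ominus> ?P) \<oplus> ((?Q \<oplus> \<ominus> ?Q) \<oplus> (?R \<oplus> ?W))"
      by (simp only: vadd_assoc vadd_commute vadd_left_commute)
    also have "\<dots> = ?R \<oplus> ?W" using ts tr m mt by simp
    also have "\<dots> = u \<odot> ?i" unfolding u_def vmul_vadd_left vmul_assoc ..
    finally have "u \<odot> ?i = ?t \<oplus> ((\<ominus> s1) \<odot> ?\<rho>A \<oplus> ?\<gamma>T \<odot> ?c)" ..
    from homotopicI[OF _ _ _ _ _ _ this] show ?thesis unfolding val_\<upsilon> using ts tr m mt by simp
  qed
  ultimately show thesis using that s(1) S(1) by (simp add: mono_lift_def)
qed

text \<open>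
  Dual to \<open>mono_lift_correct\<close>: here \<open>E3\<close> expands the identity of \<open>mid Q\<close>, and \<open>v\<close> is described once in terms of
  \<open>t2\<close>, compatible with the \<open>\<rho>\<close>'s by \<open>E2\<close>, and once in terms of \<open>y \<cdot> \<tau>\<close>, compatible with the \<open>\<gamma>\<close>'s by \<open>E4\<close>.
\<close>

lemma epi_colift_correct:
  assumes e: "(A, \<epsilon>, Q) \<in> adel_Mor C" and epi: "is_epi (Adel C) (A, \<epsilon>, Q)"
    and t: "(A, \<tau>, T) \<in> adel_Mor C"
    and z: "is_zero (Adel C) (kernel_obj (A, \<epsilon>, Q), proj1 C (mid C A) (rel C Q) \<cdot> \<tau>, T)"
  obtains \<upsilon> where "epi_colift ((A, \<epsilon>, Q), (A, \<tau>, T)) = (Q, \<upsilon>, T)" "(Q, \<upsilon>, T) \<in> adel_Mor C"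
    "homotopic A T (val \<epsilon> \<odot> val \<upsilon>) (val \<tau>)"
proof -
  note m = adel_MorD[OF e] and mt = adel_MorD[OF t]
  obtain \<sigma>1 \<sigma>2 where s: "htpy (kernel_obj (A, \<epsilon>, Q), proj1 C (mid C A) (rel C Q) \<cdot> \<tau>, T) = (\<sigma>1, \<sigma>2)"
    "\<sigma>1 \<in> Mor C" "src C \<sigma>1 = mid C (kernel_obj (A, \<epsilon>, Q))" "tgt C \<sigma>1 = rel C T"
    "\<sigma>2 \<in> Mor C" "src C \<sigma>2 = corel C (kernel_obj (A, \<epsilon>, Q))" "tgt C \<sigma>2 = mid C T"
    "val (proj1 C (mid C A) (rel C Q) \<cdot> \<tau>) =
      val \<sigma>1 \<odot> val (fst T) \<oplus> val (snd (kernel_obj (A, \<epsilon>, Q))) \<odot> val \<sigma>2"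
    by (rule null_homotopy[OF adel_cmp[OF kernel_emb_Mor[OF e] t] z])
  have z': "is_zero (Adel C) (Q, inj1 C (mid C Q) (corel C A), cokernel_obj (A, \<epsilon>, Q))"
    using epi_cokernel_zero(2)[OF epi] by (simp add: cokernel_proj_def)
  obtain S1 S2 where S: "htpy (cokernel_proj (A, \<epsilon>, Q)) = (S1, S2)"
    "S1 \<in> Mor C" "src C S1 = mid C Q" "tgt C S1 = rel C (cokernel_obj (A, \<epsilon>, Q))"
    "S2 \<in> Mor C" "src C S2 = corel C Q" "tgt C S2 = mid C (cokernel_obj (A, \<epsilon>, Q))"
    "val (inj1 C (mid C Q) (corel C A)) = val S1 \<odot> val (fst (cokernel_obj (A, \<epsilon>, Q))) \<oplus> val (snd Q) \<odot> val S2"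
    by (rule null_homotopy[OF cokernel_proj_Mor[OF e] z']) (simp add: cokernel_proj_def)
  let ?\<gamma>A = "val (snd A)" and ?\<rho>Q = "val (fst Q)" and ?\<gamma>Q = "val (snd Q)" and ?\<rho>T = "val (fst T)"
    and ?e = "val \<epsilon>" and ?t = "val \<tau>"
  define t1 where "t1 = val (inj1 C (mid C A) (rel C Q)) \<odot> val \<sigma>1"
  define t4 where "t4 = val (inj2 C (mid C A) (rel C Q)) \<odot> val \<sigma>1"
  define t3 where "t3 = val (inj1 C (corel C A) (mid C Q)) \<odot> val \<sigma>2"
  define t2 where "t2 = val (inj2 C (corel C A) (mid C Q)) \<odot> val \<sigma>2"
  have ts: "ok t1" "dm t1 = mid C A" "cd t1 = rel C T" "ok t2" "dm t2 = mid C Q" "cd t2 = mid C T"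
    "ok t3" "dm t3 = corel C A" "cd t3 = mid C T" "ok t4" "dm t4 = rel C Q" "cd t4 = rel C T"
    unfolding t1_def t2_def t3_def t4_def using m s by simp_all
  have "val (proj1 C (mid C A) (rel C Q)) \<odot> ?t =
      val \<sigma>1 \<odot> ?\<rho>T \<oplus> val (snd (kernel_obj (A, \<epsilon>, Q))) \<odot> val \<sigma>2" (is "?l = ?r")
    using s(8) m mt by simp
  then have 1: "val (inj1 C (mid C A) (rel C Q)) \<odot> ?l = val (inj1 C (mid C A) (rel C Q)) \<odot> ?r"
    and 2: "val (inj2 C (mid C A) (rel C Q)) \<odot> ?l = val (inj2 C (mid C A) (rel C Q)) \<odot> ?r"
    by simp_all
  have E1: "?t = t1 \<odot> ?\<rho>T \<oplus> (?\<gamma>A \<odot> t3 \<oplus> ?e \<odot> t2)"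
    using 1 m mt s(2-7) unfolding t1_def t2_def t3_def by (simp add: vring)
  have E2: "vzero (rel C Q) (mid C T) = t4 \<odot> ?\<rho>T \<oplus> ?\<rho>Q \<odot> t2"
    using 2 m mt s(2-7) unfolding t2_def t4_def by (simp add: vring)
  define z where "z = val S1 \<odot> val (proj1 C (rel C Q) (mid C A))"
  define y where "y = val S1 \<odot> val (proj2 C (rel C Q) (mid C A))"
  define r where "r = val S2 \<odot> val (proj1 C (mid C Q) (corel C A))"
  define r' where "r' = val S2 \<odot> val (proj2 C (mid C Q) (corel C A))"
  have tr: "ok z" "dm z = mid C Q" "cd z = rel C Q" "ok y" "dm y = mid C Q" "cd y = mid C A"
    "ok r" "dm r = corel C Q" "cd r = mid C Q" "ok r'" "dm r' = corel C Q" "cd r' = corel C A"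
    unfolding r_def r'_def z_def y_def using m S by simp_all
  have "val (inj1 C (mid C Q) (corel C A)) \<odot> val (proj1 C (mid C Q) (corel C A)) =
     (val S1 \<odot> val (fst (cokernel_obj (A, \<epsilon>, Q))) \<oplus> ?\<gamma>Q \<odot> val S2) \<odot> val (proj1 C (mid C Q) (corel C A))"
    using S(8) by simp
  then have E3: "vide (mid C Q) = z \<odot> ?\<rho>Q \<oplus> (y \<odot> ?e \<oplus> ?\<gamma>Q \<odot> r)"
    using m S(2-7) unfolding r_def z_def y_def by (simp add: vring)
  have "val (inj1 C (mid C Q) (corel C A)) \<odot> val (proj2 C (mid C Q) (corel C A)) =
     (val S1 \<odot> val (fst (cokernel_obj (A, \<epsilon>, Q))) \<oplus> ?\<gamma>Q \<odot> val S2) \<odot> val (proj2 C (mid C Q) (corel C A))"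
    using S(8) by simp
  then have E4: "vzero (mid C Q) (corel C A) = y \<odot> ?\<gamma>A \<oplus> ?\<gamma>Q \<odot> r'"
    using m S(2-7) unfolding r'_def y_def by (simp add: vring)
  have E2': "?\<rho>Q \<odot> t2 = \<ominus> (t4 \<odot> ?\<rho>T)"
    by (rule vneg_unique) (use E2 m mt ts in simp_all)
  have "y \<odot> ?\<gamma>A = \<ominus> (?\<gamma>Q \<odot> r')"
    by (rule vneg_unique) (use E4 m mt tr in \<open>simp_all add: vadd_commute\<close>)
  then have E4': "y \<odot> (?\<gamma>A \<odot> x) = \<ominus> (?\<gamma>Q \<odot> (r' \<odot> x))" for x
    by (metis vmul_assoc vneg_vmul_left)
  define v where "v = t2 \<oplus> (y \<odot> t1 \<oplus> z \<odot> t4) \<odot> ?\<rho>T"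
  define p where "p = r' \<odot> t3 \<oplus> r \<odot> t2"
  have tp: "ok v" "dm v = mid C Q" "cd v = mid C T" "ok p" "dm p = corel C Q" "cd p = mid C T"
    unfolding v_def p_def using ts tr mt m by simp_all
  have v: "v = y \<odot> ?t \<oplus> ?\<gamma>Q \<odot> p"
  proof -
    \<comment> \<open>\<open>?Q\<close> cancels on the left, and \<open>?V\<close> is inserted with both signs to form \<open>p\<close>\<close>
    let ?P = "?\<gamma>Q \<odot> (r \<odot> t2)" and ?Q = "z \<odot> (t4 \<odot> ?\<rho>T)" and ?R = "y \<odot> (?e \<odot> t2)"
      and ?W = "y \<odot> (t1 \<odot> ?\<rho>T)" and ?V = "?\<gamma>Q \<odot> (r' \<odot> t3)"
    have "t2 = vide (mid C Q) \<odot> t2" using ts by simp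
    also have "\<dots> = \<ominus> ?Q \<oplus> (?R \<oplus> ?P)"
      unfolding E3 vmul_vadd_left vmul_assoc E2' vneg_vmul_right ..
    finally have "v = (\<ominus> ?Q \<oplus> (?R \<oplus> ?P)) \<oplus> (?W \<oplus> ?Q)"
      unfolding v_def vmul_vadd_left vmul_assoc by (rule arg_cong2[where f = "(\<oplus>)", OF _ refl])
    also have "\<dots> = (?Q \<oplus> \<ominus> ?Q) \<oplus> (?P \<oplus> (?R \<oplus> ?W))"
      by (simp only: vadd_assoc vadd_commute vadd_left_commute)
    also have "\<dots> = (?V \<oplus> \<ominus> ?V) \<oplus> (?P \<oplus> (?R \<oplus> ?W))" using ts tr m mt by simp
    also have "\<dots> = (?W \<oplus> (\<ominus> ?V \<oplus> ?R)) \<oplus> (?V \<oplus> ?P)"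
      by (simp only: vadd_assoc vadd_commute vadd_left_commute)
    also have "?W \<oplus> (\<ominus> ?V \<oplus> ?R) = y \<odot> ?t" unfolding E1 vmul_vadd_right E4' ..
    also have "?V \<oplus> ?P = ?\<gamma>Q \<odot> p" unfolding p_def vmul_vadd_right ..
    finally show ?thesis .
  qed
  let ?\<upsilon> = "inj2 C (corel C A) (mid C Q) \<cdot> \<sigma>2 \<boxplus> into_dsum C (S1 \<cdot> proj2 C (rel C Q) (mid C A))
    (S1 \<cdot> proj1 C (rel C Q) (mid C A)) \<cdot> \<sigma>1 \<cdot> fst T"
  have \<upsilon>: "?\<upsilon> \<in> Mor C" "src C ?\<upsilon> = mid C Q" "tgt C ?\<upsilon> = mid C T" using m mt s S by simp_all
  have val_\<upsilon>: "val ?\<upsilon> = v" unfolding v_def t1_def t2_def t4_def z_def y_def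
    using m mt s(2-7) S(2-7) by (simp add: vring)
  from t have "(Q, ?\<upsilon>, T) \<in> adel_Mor C"
  proof (rule adel_MorE)
    fix \<omega> \<psi> assume w: "ok \<psi>" "dm \<psi> = corel C A" "cd \<psi> = corel C T"
      "?t \<odot> val (snd T) = ?\<gamma>A \<odot> \<psi>"
    let ?w = "\<ominus> t4 \<oplus> ?\<rho>Q \<odot> (y \<odot> t1 \<oplus> z \<odot> t4)"
    have 1: "?\<rho>Q \<odot> v = ?w \<odot> ?\<rho>T"
      unfolding v_def vmul_vadd_left vmul_vadd_right vmul_assoc E2' vneg_vmul_left ..
    let ?p = "\<ominus> (r' \<odot> \<psi>) \<oplus> p \<odot> val (snd T)"
    have 2: "v \<odot> val (snd T) = ?\<gamma>Q \<odot> ?p"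
      unfolding v vmul_vadd_left vmul_vadd_right vmul_assoc w(4) E4' vneg_vmul_right ..
    show ?thesis
      by (rule adel_MorI[OF m(2) mt(2) \<upsilon>, of ?w ?p, unfolded val_\<upsilon>, OF _ 1 _ 2]) (use w ts tr tp m mt in simp_all)
  qed
  moreover have "homotopic A T (?e \<odot> val ?\<upsilon>) ?t"
  proof -
    let ?c = "\<ominus> t1 \<oplus> ?e \<odot> (y \<odot> t1 \<oplus> z \<odot> t4)" and ?W = "?e \<odot> ((y \<odot> t1 \<oplus> z \<odot> t4) \<odot> ?\<rho>T)"
    let ?P = "t1 \<odot> ?\<rho>T" and ?Q = "?\<gamma>A \<odot> t3" and ?R = "?e \<odot> t2"
    have "?t \<oplus> (?c \<odot> ?\<rho>T \<oplus> ?\<gamma>A \<odot> (\<ominus> t3)) = (?P \<oplus> (?Q \<oplus> ?R)) \<oplus> ((\<ominus> ?P \<oplus> ?W) \<oplus> \<ominus> ?Q)"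
      unfolding E1 vneg_vmul_right vmul_vadd_left[of "\<ominus> t1"] vneg_vmul_left vmul_assoc ..
    also have "\<dots> = (?P \<oplus> \<ominus> ?P) \<oplus> ((?Q \<oplus> \<ominus> ?Q) \<oplus> (?R \<oplus> ?W))"
      by (simp only: vadd_assoc vadd_commute vadd_left_commute)
    also have "\<dots> = ?R \<oplus> ?W" using ts tr m mt by simp
    also have "\<dots> = ?e \<odot> v" unfolding v_def vmul_vadd_right[of ?e t2] ..
    finally have "?e \<odot> v = ?t \<oplus> (?c \<odot> ?\<rho>T \<oplus> ?\<gamma>A \<odot> (\<ominus> t3))" ..
    from homotopicI[OF _ _ _ _ _ _ this] show ?thesis unfolding val_\<upsilon> using ts tr m mt by simp
  qed
  ultimately show thesis using that s(1) S(1) by (simp add: epi_colift_def)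
qed

lemma mono_lift_algorithm_Adel: "mono_lift_algorithm (Adel C) cokernel_proj mono_lift"
  unfolding mono_lift_algorithm_def
proof (intro conjI allI ballI impI)
  define D where "D = {(\<iota>, \<tau>). is_mono (Adel C) \<iota> \<and> \<tau> \<in> Mor (Adel C) \<and> tgt (Adel C) \<tau> = tgt (Adel C) \<iota> \<and>
    is_zero (Adel C) (\<tau> \<cdot>\<^bsub>Adel C\<^esub> cokernel_proj \<iota>)}"
  have domain: "fst p \<in> adel_Mor C \<and> snd p \<in> adel_Mor C \<and> snd (snd (snd p)) = snd (snd (fst p)) \<and>
      is_zero (Adel C) (kernel_emb (fst p)) \<and>
      (fst (snd p), fst (snd (snd p)) \<cdot> inj1 C (mid C (snd (snd (fst p)))) (corel C (fst (fst p))),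
        cokernel_obj (fst p)) \<in> adel_Mor C \<and>
      is_zero (Adel C) (fst (snd p), fst (snd (snd p)) \<cdot> inj1 C (mid C (snd (snd (fst p)))) (corel C (fst (fst p))),
        cokernel_obj (fst p))" if "p \<in> D" for p
    using that unfolding D_def using mono_kernel_zero[of "fst p"] adel_cmp_sel[of "snd p" "cokernel_proj (fst p)"]
    by (simp add: case_prod_beta cokernel_proj_sel)
  have "computable_on D mono_lift"
    unfolding mono_lift_def case_prod_beta prod.collapse
    by (intro computable_intros computable_on_htpy computable_on_kernel_cokernel_obj computable_on_kernel_cokernel_map
        computable_on_adel) (drule domain, simp add: kernel_emb_sel kernel_cokernel_obj_sel)+
  then show "computable_on {(\<iota>, \<tau>). is_mono (Adel C) \<iota> \<and> \<tau> \<in> Mor (Adel C) \<and> tgt (Adel C) \<tau> = tgt (Adel C) \<iota> \<and>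
      is_zero (Adel C) (\<tau> \<cdot>\<^bsub>Adel C\<^esub> cokernel_proj \<iota>)} mono_lift" unfolding D_def .
  fix K A T f t assume "f \<in> Hom (Adel C) K A" "t \<in> Hom (Adel C) T A"
    and *: "is_mono (Adel C) f \<and> is_zero (Adel C) (t \<cdot>\<^bsub>Adel C\<^esub> cokernel_proj f)"
  then obtain \<iota> \<tau> where f: "f = (K, \<iota>, A)" "(K, \<iota>, A) \<in> adel_Mor C" and t: "t = (T, \<tau>, A)" "(T, \<tau>, A) \<in> adel_Mor C"
    by (auto simp: Hom_Adel)
  have "is_zero (Adel C) (T, \<tau> \<cdot> inj1 C (mid C A) (corel C K), cokernel_obj (K, \<iota>, A))"
    "is_mono (Adel C) (K, \<iota>, A)" using * f t by (simp_all add: cokernel_proj_def)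
  from mono_lift_correct[OF f(2) this(2) t(2) this(1)] obtain \<upsilon> where
    u: "mono_lift ((K, \<iota>, A), (T, \<tau>, A)) = (T, \<upsilon>, K)" "(T, \<upsilon>, K) \<in> adel_Mor C"
    "homotopic T A (val \<upsilon> \<odot> val \<iota>) (val \<tau>)" .
  show "mono_lift (f, t) \<in> Hom (Adel C) T K" using u f t by (simp add: Hom_Adel)
  show "mono_lift (f, t) \<cdot>\<^bsub>Adel C\<^esub> f \<approx>\<^bsub>Adel C\<^esub> t"
    using u f t adel_cmp[OF u(2) f(2)] by (simp add: adel_eqv_iff)
qed

lemma epi_colift_algorithm_Adel: "epi_colift_algorithm (Adel C) kernel_emb epi_colift"
  unfolding epi_colift_algorithm_def
proof (intro conjI allI ballI impI)
  define D where "D = {(\<epsilon>, \<tau>). is_epi (Adel C) \<epsilon> \<and> \<tau> \<in> Mor (Adel C) \<and> src (Adel C) \<tau> = src (Adel C) \<epsilon> \<and>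
    is_zero (Adel C) (kernel_emb \<epsilon> \<cdot>\<^bsub>Adel C\<^esub> \<tau>)}"
  have domain: "fst p \<in> adel_Mor C \<and> snd p \<in> adel_Mor C \<and> fst (snd p) = fst (fst p) \<and>
      is_zero (Adel C) (cokernel_proj (fst p)) \<and>
      (kernel_obj (fst p), proj1 C (mid C (fst (fst p))) (rel C (snd (snd (fst p)))) \<cdot> fst (snd (snd p)),
        snd (snd (snd p))) \<in> adel_Mor C \<and>
      is_zero (Adel C) (kernel_obj (fst p),
        proj1 C (mid C (fst (fst p))) (rel C (snd (snd (fst p)))) \<cdot> fst (snd (snd p)),
        snd (snd (snd p)))" if "p \<in> D" for p
    using that unfolding D_def using epi_cokernel_zero[of "fst p"] adel_cmp_sel[of "kernel_emb (fst p)" "snd p"]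
    by (simp add: case_prod_beta kernel_emb_sel)
  have "computable_on D epi_colift"
    unfolding epi_colift_def case_prod_beta prod.collapse
    by (intro computable_intros computable_on_htpy computable_on_kernel_cokernel_obj computable_on_kernel_cokernel_map
        computable_on_adel) (drule domain, simp add: cokernel_proj_sel kernel_cokernel_obj_sel)+
  then show "computable_on {(\<epsilon>, \<tau>). is_epi (Adel C) \<epsilon> \<and> \<tau> \<in> Mor (Adel C) \<and> src (Adel C) \<tau> = src (Adel C) \<epsilon> \<and>
      is_zero (Adel C) (kernel_emb \<epsilon> \<cdot>\<^bsub>Adel C\<^esub> \<tau>)} epi_colift" unfolding D_def .
  fix A Q T f t assume "f \<in> Hom (Adel C) A Q" "t \<in> Hom (Adel C) A T"
    and *: "is_epi (Adel C) f \<and> is_zero (Adel C) (kernel_emb f \<cdot>\<^bsub>Adel C\<^esub> t)"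
  then obtain \<epsilon> \<tau> where f: "f = (A, \<epsilon>, Q)" "(A, \<epsilon>, Q) \<in> adel_Mor C" and t: "t = (A, \<tau>, T)" "(A, \<tau>, T) \<in> adel_Mor C"
    by (auto simp: Hom_Adel)
  have "is_zero (Adel C) (kernel_obj (A, \<epsilon>, Q), proj1 C (mid C A) (rel C Q) \<cdot> \<tau>, T)"
    "is_epi (Adel C) (A, \<epsilon>, Q)" using * f t by (simp_all add: kernel_emb_def)
  from epi_colift_correct[OF f(2) this(2) t(2) this(1)] obtain \<upsilon> where
    u: "epi_colift ((A, \<epsilon>, Q), (A, \<tau>, T)) = (Q, \<upsilon>, T)" "(Q, \<upsilon>, T) \<in> adel_Mor C"
    "homotopic A T (val \<epsilon> \<odot> val \<upsilon>) (val \<tau>)" .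
  show "epi_colift (f, t) \<in> Hom (Adel C) Q T" using u f t by (simp add: Hom_Adel)
  show "f \<cdot>\<^bsub>Adel C\<^esub> epi_colift (f, t) \<approx>\<^bsub>Adel C\<^esub> t"
    using u f t adel_cmp[OF f(2) u(2)] by (simp add: adel_eqv_iff)
qed

end

section \<open>The Adelman category is computable abelian\<close>

theorem theorem1p11:
  fixes A :: "('o::data, 'm::data) additive_data"
  assumes "additive_category A"
    and "decidable_homotopy_equations A"
  shows "computable_abelian_category (Adel A)"
proof -
  obtain solve where "homotopy_solver A solve"
    using assms unfolding decidable_homotopy_equations_def homotopy_solver_def homotopy_solver_axioms_def
    by blast
  then interpret homotopy_solver A solve .
  show ?thesis unfolding computable_abelian_category_def
    using additive_category_Adel decidable_equality_Adel kernel_algorithms_Adel cokernel_algorithms_Adel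
      mono_lift_algorithm_Adel epi_colift_algorithm_Adel by blast
qed

end
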